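(* Let $\ell\in[0,1)$, $\tau\ge 0$ and $T>0$. There exist constants $\delta>0$ and $C>0$ such that the following holds. Let $\phi\in H^\ell(\mathbb{R})$ and let $f$ be a forcing term with $f(t)=f(\cdot,t)\in L^2(\mathbb{R})$ for $t\ge 0$, satisfying the smallness condition $$\|\phi\|_{H^\ell}+\sup_{t\ge 0}\|f(t)\|_{L^2(\mathbb{R})}\le \delta .$$ Then the Cauchy problem $$u_t-u_{xxt}+u-u_{xx}+uu_x=f,\quad (x,t)\in\mathbb{R}\times\mathbb{R}_+,\qquad u(x,0)=\phi(x),$$ is locally well-posed, and its solution $u$ satisfies $$\|u\|_{Y^\ell_{\tau,T}}\le C\Big(\|\phi\|_{H^\ell}+\sup_{t\ge 0}\|f(t)\|_{L^2(\mathbb{R})}\Big).$$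
   Context: For $\ell\in[0,1)$, $\tau\ge0$, $T>0$, the space $Y^\ell_{\tau,T}$ consists of functions $u$ on $\mathbb{R}\times[\tau,\tau+T]$ with finite norm $$\|u\|_{Y^\ell_{\tau,T}}=\sup_{\tau\le s\le\tau+T}\|u(s)\|_{H^\ell(\mathbb{R})}+\Big(\int_\tau^{\tau+T}\|u(s)\|_{H^\ell(\mathbb{R})}^2\,ds\Big)^{1/2},$$ where $u(s)=u(\cdot,s)$. The forcing $f$ is a (strongly measurable) map $t\mapsto f(t)\in L^2(\mathbb{R})$, $t\ge0$. Solutions are understood in the mild sense: with $uu_x=\tfrac12(u^2)_x$, $$u(t)=e^{-t}\phi+\int_0^t e^{-(t-s)}(1-\partial_{xx})^{-1}\big(f(s)-\tfrac12\partial_x(u(s)^2)\big)\,ds .$$ Local well-posedness means existence, uniqueness and continuous dependence on $\phi$ of the solution $u\in C([0,\tau+T];H^\ell(\mathbb{R}))$. *)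

theory Defs
  imports "HOL-Analysis.Analysis"
begin

section \<open>The Hilbert space of square integrable functions on the real line\<close>

definition square_integrable :: "(real \<Rightarrow> 'a::euclidean_space) \<Rightarrow> bool" where
  "square_integrable f \<longleftrightarrow>
     f \<in> borel_measurable lborel \<and> integrable lborel (\<lambda>x. (norm (f x))\<^sup>2)"

lemma square_integrable_measurable [measurable_dest]:
  "square_integrable f \<Longrightarrow> f \<in> borel_measurable lborel"
  by (simp add: square_integrable_def)

lemma square_integrable_zero [simp]: "square_integrable (\<lambda>x. 0)"
  by (simp add: square_integrable_def)

lemma square_integrable_bound:
  assumes "f \<in> borel_measurable lborel" "integrable lborel w"
    and "AE x in lborel. (norm (f x))\<^sup>2 \<le> w x"
  shows "square_integrable f"
  unfolding square_integrable_def
proof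
  show "integrable lborel (\<lambda>x. (norm (f x))\<^sup>2)"
    by (rule Bochner_Integration.integrable_bound[OF assms(2)])
       (use assms in \<open>auto intro: order_trans[OF _ abs_ge_self]\<close>)
qed (use assms in simp)

lemma norm_add_power2_le:
  fixes a b :: "'a::real_normed_vector"
  shows "(norm (a + b))\<^sup>2 \<le> 2 * (norm a)\<^sup>2 + 2 * (norm b)\<^sup>2"
proof -
  have "(norm (a + b))\<^sup>2 \<le> (norm a + norm b)\<^sup>2"
    by (intro power_mono norm_triangle_ineq) simp
  also have "\<dots> \<le> 2 * (norm a)\<^sup>2 + 2 * (norm b)\<^sup>2"
    using sum_squares_bound[of "norm a" "norm b"] by (simp add: power2_sum)
  finally show ?thesis .
qed

lemma square_integrable_add:
  assumes "square_integrable f" "square_integrable g"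
  shows "square_integrable (\<lambda>x. f x + g x)"
proof (rule square_integrable_bound)
  show "integrable lborel (\<lambda>x. 2 * (norm (f x))\<^sup>2 + 2 * (norm (g x))\<^sup>2)"
    using assms by (auto simp: square_integrable_def)
qed (use assms in \<open>auto simp: square_integrable_def norm_add_power2_le\<close>)

lemma square_integrable_scaleR:
  assumes "square_integrable f"
  shows "square_integrable (\<lambda>x. c *\<^sub>R f x)"
  using assms by (auto simp: square_integrable_def power_mult_distrib)

lemma square_integrable_minus:
  assumes "square_integrable f"
  shows "square_integrable (\<lambda>x. - f x)"
  using square_integrable_scaleR[OF assms, of "-1"] by simp

lemma square_integrable_diff:
  assumes "square_integrable f" "square_integrable g"
  shows "square_integrable (\<lambda>x. f x - g x)"
  using square_integrable_add[OF assms(1) square_integrable_minus[OF assms(2)]] by simp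

lemma square_integrable_inner:
  assumes "square_integrable f" "square_integrable g"
  shows "integrable lborel (\<lambda>x. f x \<bullet> g x)"
proof (rule Bochner_Integration.integrable_bound)
  show "integrable lborel (\<lambda>x. (norm (f x))\<^sup>2 + (norm (g x))\<^sup>2)"
    using assms by (auto simp: square_integrable_def)
  have "norm (f x \<bullet> g x) \<le> norm ((norm (f x))\<^sup>2 + (norm (g x))\<^sup>2)" for x
  proof -
    have "\<bar>f x \<bullet> g x\<bar> \<le> norm (f x) * norm (g x)"
      by (rule Cauchy_Schwarz_ineq2)
    moreover have "2 * (norm (f x) * norm (g x)) \<le> (norm (f x))\<^sup>2 + (norm (g x))\<^sup>2"
      using sum_squares_bound[of "norm (f x)" "norm (g x)"] by simp
    moreover have "0 \<le> norm (f x) * norm (g x)" by simp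
    ultimately show ?thesis unfolding real_norm_def by linarith
  qed
  then show "AE x in lborel. norm (f x \<bullet> g x) \<le> norm ((norm (f x))\<^sup>2 + (norm (g x))\<^sup>2)"
    by simp
qed (use assms in \<open>auto simp: square_integrable_def\<close>)

quotient_type (overloaded) 'a L2 = "real \<Rightarrow> 'a::euclidean_space" /
  partial: "\<lambda>f g. square_integrable f \<and> square_integrable g \<and> (AE x in lborel. f x = g x)"
proof (intro part_equivpI sympI transpI)
  show "\<exists>f :: real \<Rightarrow> 'a. square_integrable f \<and> square_integrable f \<and> (AE x in lborel. f x = f x)"
    by (rule exI[of _ "\<lambda>x. 0"]) simp
qed auto

lemma square_integrable_rep [simp]: "square_integrable (rep_L2 u)"
  using Quotient3_rep_reflp[OF Quotient3_L2, of u] by simp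

lemma rep_L2_measurable [measurable]: "rep_L2 u \<in> borel_measurable lborel"
  using square_integrable_rep by (rule square_integrable_measurable)

lemma abs_rep_L2 [simp]: "abs_L2 (rep_L2 u) = u"
  by (rule Quotient3_abs_rep[OF Quotient3_L2])

lemma rep_abs_L2:
  assumes "square_integrable f"
  shows "AE x in lborel. rep_L2 (abs_L2 f) x = f x"
  using rep_abs_rsp_left[OF Quotient3_L2, of f f] assms by auto

lemma abs_L2_eq_iff:
  assumes "square_integrable f" "square_integrable g"
  shows "abs_L2 f = abs_L2 g \<longleftrightarrow> (AE x in lborel. f x = g x)"
  using Quotient3_rel[OF Quotient3_L2, of f g] assms by auto

instantiation L2 :: (euclidean_space) real_vector
begin

lift_definition zero_L2 :: "'a L2" is "\<lambda>x. 0" by simp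

lift_definition plus_L2 :: "'a L2 \<Rightarrow> 'a L2 \<Rightarrow> 'a L2" is "\<lambda>f g x. f x + g x"
  by (auto intro: square_integrable_add)

lift_definition minus_L2 :: "'a L2 \<Rightarrow> 'a L2 \<Rightarrow> 'a L2" is "\<lambda>f g x. f x - g x"
  by (auto intro: square_integrable_diff)

lift_definition uminus_L2 :: "'a L2 \<Rightarrow> 'a L2" is "\<lambda>f x. - f x"
  by (auto intro: square_integrable_minus)

lift_definition scaleR_L2 :: "real \<Rightarrow> 'a L2 \<Rightarrow> 'a L2" is "\<lambda>c f x. c *\<^sub>R f x"
  by (auto intro: square_integrable_scaleR)

instance
proof
  fix u v w :: "'a L2" and a b :: real
  show "u + v + w = u + (v + w)" by transfer (auto intro!: square_integrable_add simp: add.assoc)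
  show "u + v = v + u" by transfer (auto intro!: square_integrable_add simp: add.commute)
  show "0 + u = u" by transfer auto
  show "- u + u = 0" by transfer auto
  show "u - v = u + - v"
    by transfer (auto intro!: square_integrable_diff square_integrable_add square_integrable_minus)
  show "a *\<^sub>R (u + v) = a *\<^sub>R u + a *\<^sub>R v"
    by transfer (auto intro!: square_integrable_scaleR square_integrable_add simp: algebra_simps)
  show "(a + b) *\<^sub>R u = a *\<^sub>R u + b *\<^sub>R u"
    by transfer (auto intro!: square_integrable_scaleR square_integrable_add simp: algebra_simps)
  show "a *\<^sub>R b *\<^sub>R u = (a * b) *\<^sub>R u"
    by transfer (auto intro!: square_integrable_scaleR)
  show "1 *\<^sub>R u = u" by transfer auto
qed

end

instantiation L2 :: (euclidean_space) real_inner
begin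

lift_definition inner_L2 :: "'a L2 \<Rightarrow> 'a L2 \<Rightarrow> real" is "\<lambda>f g. \<integral>x. f x \<bullet> g x \<partial>lborel"
  by (rule integral_cong_AE)
     (auto dest!: square_integrable_measurable)

definition norm_L2 :: "'a L2 \<Rightarrow> real" where "norm_L2 u = sqrt (u \<bullet> u)"

definition dist_L2 :: "'a L2 \<Rightarrow> 'a L2 \<Rightarrow> real" where "dist_L2 u v = norm (u - v)"

definition sgn_L2 :: "'a L2 \<Rightarrow> 'a L2" where "sgn_L2 u = u /\<^sub>R norm u"

definition uniformity_L2 :: "('a L2 \<times> 'a L2) filter" where
  "uniformity_L2 = (INF e\<in>{0 <..}. principal {(u, v). dist u v < e})"

definition open_L2 :: "'a L2 set \<Rightarrow> bool" where
  "open_L2 U \<longleftrightarrow> (\<forall>u\<in>U. eventually (\<lambda>(u', v). u' = u \<longrightarrow> v \<in> U) uniformity)"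

instance
proof
  fix u v w :: "'a L2" and a :: real and U :: "'a L2 set"
  show "dist u v = norm (u - v)" by (rule dist_L2_def)
  show "sgn u = u /\<^sub>R norm u" by (rule sgn_L2_def)
  show "uniformity = (INF e\<in>{0 <..}. principal {(u, v::'a L2). dist u v < e})"
    by (rule uniformity_L2_def)
  show "open U \<longleftrightarrow> (\<forall>u\<in>U. eventually (\<lambda>(u', v). u' = u \<longrightarrow> v \<in> U) uniformity)"
    by (rule open_L2_def)
  show "u \<bullet> v = v \<bullet> u" by transfer (simp add: inner_commute)
  show "(u + v) \<bullet> w = u \<bullet> w + v \<bullet> w"
    by transfer (auto simp: inner_add_left square_integrable_inner)
  show "(a *\<^sub>R u) \<bullet> v = a * (u \<bullet> v)" by transfer simp
  show "0 \<le> u \<bullet> u" by transfer simp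
  show "u \<bullet> u = 0 \<longleftrightarrow> u = 0"
    by transfer (auto simp: integral_nonneg_eq_0_iff_AE square_integrable_inner)
  show "norm u = sqrt (u \<bullet> u)" by (rule norm_L2_def)
qed

end

lemma norm_abs_L2:
  assumes "square_integrable f"
  shows "norm (abs_L2 f) = sqrt (\<integral>x. (norm (f x))\<^sup>2 \<partial>lborel)"
  using assms by (simp add: norm_L2_def inner_L2.abs_eq power2_norm_eq_inner)

lemma norm_L2_eq: "norm u = sqrt (\<integral>x. (norm (rep_L2 u x))\<^sup>2 \<partial>lborel)"
  using norm_abs_L2[OF square_integrable_rep, of u] by simp

lemma abs_L2_add:
  assumes "square_integrable f" "square_integrable g"
  shows "abs_L2 f + abs_L2 g = abs_L2 (\<lambda>x. f x + g x)"
  using assms by (simp add: plus_L2.abs_eq)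

lemma abs_L2_diff:
  assumes "square_integrable f" "square_integrable g"
  shows "abs_L2 f - abs_L2 g = abs_L2 (\<lambda>x. f x - g x)"
  using assms by (simp add: minus_L2.abs_eq)

lemma abs_L2_scaleR:
  assumes "square_integrable f"
  shows "c *\<^sub>R abs_L2 f = abs_L2 (\<lambda>x. c *\<^sub>R f x)"
  using assms by (simp add: scaleR_L2.abs_eq)

lemma abs_L2_zero: "abs_L2 (\<lambda>x. 0) = 0"
  by (simp add: zero_L2.abs_eq)

lemma rep_L2_diff: "AE x in lborel. rep_L2 (u - v) x = rep_L2 u x - rep_L2 v x"
proof -
  have "u - v = abs_L2 (\<lambda>x. rep_L2 u x - rep_L2 v x)"
    using abs_L2_diff[OF square_integrable_rep square_integrable_rep, of u v]
    unfolding abs_rep_L2 .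
  then show ?thesis
    using rep_abs_L2[OF square_integrable_diff[OF square_integrable_rep square_integrable_rep]]
    by (elim ssubst)
qed

lemma L2_dominated_convergence:
  fixes s :: "nat \<Rightarrow> real \<Rightarrow> 'a::euclidean_space"
  assumes s: "\<And>i. square_integrable (s i)" and f: "square_integrable f"
    and w: "square_integrable w"
    and lim: "AE x in lborel. (\<lambda>i. s i x) \<longlonglongrightarrow> f x"
    and bd: "\<And>i x. norm (s i x) \<le> norm (w x)"
  shows "(\<lambda>i. abs_L2 (s i)) \<longlonglongrightarrow> abs_L2 f"
proof -
  have [measurable]: "s i \<in> borel_measurable lborel" "f \<in> borel_measurable lborel" for i
    using s f by (auto simp: square_integrable_def)
  have "(\<lambda>i. \<integral>x. (norm (s i x - f x))\<^sup>2 \<partial>lborel) \<longlonglongrightarrow> (\<integral>x. 0 \<partial>(lborel::real measure))"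
  proof (rule integral_dominated_convergence)
    show "integrable lborel (\<lambda>x. 2 * (norm (w x))\<^sup>2 + 2 * (norm (f x))\<^sup>2)"
      using w f by (auto simp: square_integrable_def)
    show "AE x in lborel. (\<lambda>i. (norm (s i x - f x))\<^sup>2) \<longlonglongrightarrow> 0"
      using lim
    proof eventually_elim
      case (elim x)
      have "(\<lambda>i. (norm (s i x - f x))\<^sup>2) \<longlonglongrightarrow> (norm (f x - f x))\<^sup>2"
        by (intro tendsto_intros elim)
      then show ?case by simp
    qed
    show "AE x in lborel. norm ((norm (s i x - f x))\<^sup>2) \<le> 2 * (norm (w x))\<^sup>2 + 2 * (norm (f x))\<^sup>2" for i
    proof (rule AE_I2)
      fix x
      have "(norm (s i x - f x))\<^sup>2 \<le> 2 * (norm (s i x))\<^sup>2 + 2 * (norm (f x))\<^sup>2"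
        using norm_add_power2_le[of "s i x" "- f x"] by simp
      also have "(norm (s i x))\<^sup>2 \<le> (norm (w x))\<^sup>2"
        using bd by (intro power_mono) auto
      finally show "norm ((norm (s i x - f x))\<^sup>2) \<le> 2 * (norm (w x))\<^sup>2 + 2 * (norm (f x))\<^sup>2"
        by simp
    qed
  qed measurable
  then have "(\<lambda>i. sqrt (\<integral>x. (norm (s i x - f x))\<^sup>2 \<partial>lborel)) \<longlonglongrightarrow> sqrt 0"
    by (intro tendsto_intros) simp
  then have "(\<lambda>i. norm (abs_L2 (s i) - abs_L2 f)) \<longlonglongrightarrow> 0"
    using s f by (simp add: abs_L2_diff norm_abs_L2 square_integrable_diff)
  then show ?thesis
    by (rule LIM_zero_cancel[OF tendsto_norm_zero_cancel])
qed

subsection \<open>Completeness\<close>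

lemma nn_integral_norm_L2:
  "(\<integral>\<^sup>+x. ennreal ((norm (rep_L2 u x))\<^sup>2) \<partial>lborel) = ennreal ((norm u)\<^sup>2)"
proof -
  have "integrable lborel (\<lambda>x. (norm (rep_L2 u x))\<^sup>2)"
    using square_integrable_rep[of u] by (simp add: square_integrable_def)
  then show ?thesis
    by (subst nn_integral_eq_integral) (auto simp: norm_L2_eq)
qed

lemma L2_fast_Cauchy_AE_convergent:
  fixes X :: "nat \<Rightarrow> 'a::euclidean_space L2"
  assumes X: "\<And>n. norm (X (Suc n) - X n) \<le> (1/2) ^ n"
  shows "AE x in lborel. convergent (\<lambda>n. rep_L2 (X n) x)"
proof -
  define d where "d n x = norm (rep_L2 (X (Suc n) - X n) x)" for n x
  have [measurable]: "d n \<in> borel_measurable lborel" for n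
    unfolding d_def by measurable
  have "(\<integral>\<^sup>+x. (\<Sum>n. ennreal (2 ^ n * (d n x)\<^sup>2)) \<partial>lborel)
      = (\<Sum>n. \<integral>\<^sup>+x. ennreal (2 ^ n * (d n x)\<^sup>2) \<partial>lborel)"
    by (intro nn_integral_suminf) measurable
  also have "\<dots> \<le> (\<Sum>n. ennreal ((1/2) ^ n))"
  proof (intro suminf_le summableI)
    fix n
    have "(\<integral>\<^sup>+x. ennreal (2 ^ n * (d n x)\<^sup>2) \<partial>lborel)
        = ennreal (2 ^ n) * (\<integral>\<^sup>+x. ennreal ((d n x)\<^sup>2) \<partial>lborel)"
      by (simp add: ennreal_mult nn_integral_cmult)
    also have "\<dots> = ennreal (2 ^ n * (norm (X (Suc n) - X n))\<^sup>2)"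
      unfolding d_def nn_integral_norm_L2 by (simp add: ennreal_mult)
    also have "\<dots> \<le> ennreal (2 ^ n * ((1/2) ^ n)\<^sup>2)"
      by (intro ennreal_leI mult_left_mono power_mono X) auto
    also have "(2::real) ^ n * ((1/2) ^ n)\<^sup>2 = (1/2) ^ n"
      by (simp add: power2_eq_square power_one_over)
    finally show "(\<integral>\<^sup>+x. ennreal (2 ^ n * (d n x)\<^sup>2) \<partial>lborel) \<le> ennreal ((1/2) ^ n)" .
  qed
  also have "\<dots> < \<infinity>"
    by (subst suminf_ennreal2) (auto intro!: summable_geometric)
  finally have "(\<integral>\<^sup>+x. (\<Sum>n. ennreal (2 ^ n * (d n x)\<^sup>2)) \<partial>lborel) \<noteq> \<infinity>" by simp
  then have "AE x in lborel. (\<Sum>n. ennreal (2 ^ n * (d n x)\<^sup>2)) \<noteq> \<infinity>"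
    by (intro nn_integral_PInf_AE) auto
  moreover have "AE x in lborel. \<forall>n. rep_L2 (X (Suc n) - X n) x = rep_L2 (X (Suc n)) x - rep_L2 (X n) x"
    unfolding AE_all_countable by (auto intro: rep_L2_diff)
  ultimately show ?thesis
  proof eventually_elim
    case (elim x)
    let ?b = "\<lambda>n. rep_L2 (X (Suc n)) x - rep_L2 (X n) x"
    have sm: "summable (\<lambda>n. 2 ^ n * (d n x)\<^sup>2)"
      using elim(1) by (intro summable_suminf_not_top) (auto simp: infinity_ennreal_def)
    have "summable (\<lambda>n. 2 ^ n * (d n x)\<^sup>2 + (1/2) ^ n)"
      by (intro summable_add sm summable_geometric) simp
    then have "summable d'" if "d' = (\<lambda>n. d n x)" for d'
    proof (rule summable_comparison_test'[where N = 0])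
      fix n :: nat
      have "0 \<le> (2 ^ n * d n x - 1)\<^sup>2" by simp
      then have "2 * (2 ^ n * d n x) \<le> (2 ^ n)\<^sup>2 * (d n x)\<^sup>2 + 1"
        by (simp add: power2_diff power_mult_distrib)
      also have "\<dots> = 2 ^ n * (2 ^ n * (d n x)\<^sup>2 + (1/2) ^ n)"
        by (simp add: power2_eq_square algebra_simps power_one_over)
      finally have "2 ^ n * (2 * d n x) \<le> 2 ^ n * (2 ^ n * (d n x)\<^sup>2 + (1/2) ^ n)"
        by (simp add: mult.left_commute)
      then have "2 * d n x \<le> 2 ^ n * (d n x)\<^sup>2 + (1/2) ^ n"
        by (subst (asm) mult_le_cancel_left_pos) auto
      moreover have "0 \<le> d n x" by (simp add: d_def)
      ultimately show "norm (d' n) \<le> 2 ^ n * (d n x)\<^sup>2 + (1/2) ^ n"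
        using that by simp
    qed
    then have "summable (\<lambda>n. norm (?b n))"
      using elim(2) by (simp add: d_def)
    then have "summable ?b" by (rule summable_norm_cancel)
    then have "convergent (\<lambda>n. (\<Sum>i<n. ?b i) + rep_L2 (X 0) x)"
      by (intro convergent_add convergent_const) (simp add: summable_iff_convergent)
    moreover have "(\<Sum>i<n. ?b i) + rep_L2 (X 0) x = rep_L2 (X n) x" for n
      using sum_lessThan_telescope[of "\<lambda>n. rep_L2 (X n) x" n] by simp
    ultimately show ?case by simp
  qed
qed

instance L2 :: (euclidean_space) banach
proof
  fix X :: "nat \<Rightarrow> 'a L2"
  assume "Cauchy X"
  have "\<exists>r. strict_mono r \<and> (\<forall>n. \<forall>m\<ge>r n. \<forall>k\<ge>r n. norm (X m - X k) \<le> (1/2) ^ n)"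
  proof -
    have "\<exists>M. \<forall>m\<ge>M. \<forall>k\<ge>M. norm (X m - X k) < (1/2) ^ n" for n :: nat
      using \<open>Cauchy X\<close> unfolding Cauchy_iff by auto
    then obtain M where M: "\<And>n m k. m \<ge> M n \<Longrightarrow> k \<ge> M n \<Longrightarrow> norm (X m - X k) < (1/2) ^ n"
      by metis
    define r where "r n = n + (\<Sum>i\<le>n. M i)" for n
    have "strict_mono r" by (auto simp: strict_mono_Suc_iff r_def)
    moreover have "M n \<le> r n" for n
      unfolding r_def by (rule trans_le_add2, rule member_le_sum) auto
    ultimately show ?thesis
      using M by (meson less_imp_le order_trans)
  qed
  then obtain r where r: "strict_mono r"
    and fast: "\<And>n m k. m \<ge> r n \<Longrightarrow> k \<ge> r n \<Longrightarrow> norm (X m - X k) \<le> (1/2) ^ n"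
    by blast
  have "norm (X (r (Suc n)) - X (r n)) \<le> (1/2) ^ n" for n
    using r by (intro fast) (auto simp: strict_mono_less_eq)
  then have conv: "AE x in lborel. convergent (\<lambda>n. rep_L2 (X (r n)) x)"
    by (rule L2_fast_Cauchy_AE_convergent[of "\<lambda>n. X (r n)"])
  define f where "f x = lim (\<lambda>n. rep_L2 (X (r n)) x)" for x
  have [measurable]: "f \<in> borel_measurable lborel"
    unfolding f_def by (rule borel_measurable_lim_metric) measurable
  have lim_f: "AE x in lborel. (\<lambda>n. rep_L2 (X (r n)) x) \<longlonglongrightarrow> f x"
    using conv by eventually_elim (simp add: f_def convergent_LIMSEQ_iff)
  have est: "(\<integral>\<^sup>+x. ennreal ((norm (f x - rep_L2 (X k) x))\<^sup>2) \<partial>lborel) \<le> ennreal (((1/2) ^ n)\<^sup>2)"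
    if k: "k \<ge> r n" for n k
  proof -
    have "(\<integral>\<^sup>+x. ennreal ((norm (f x - rep_L2 (X k) x))\<^sup>2) \<partial>lborel)
        \<le> (\<integral>\<^sup>+x. liminf (\<lambda>m. ennreal ((norm (rep_L2 (X (r m) - X k) x))\<^sup>2)) \<partial>lborel)"
    proof (rule nn_integral_mono_AE)
      have "AE x in lborel. \<forall>m. rep_L2 (X (r m) - X k) x = rep_L2 (X (r m)) x - rep_L2 (X k) x"
        unfolding AE_all_countable by (auto intro: rep_L2_diff)
      then show "AE x in lborel. ennreal ((norm (f x - rep_L2 (X k) x))\<^sup>2)
          \<le> liminf (\<lambda>m. ennreal ((norm (rep_L2 (X (r m) - X k) x))\<^sup>2))"
        using lim_f
      proof eventually_elim
        case (elim x)
        have "(\<lambda>m. ennreal ((norm (rep_L2 (X (r m) - X k) x))\<^sup>2))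
            \<longlonglongrightarrow> ennreal ((norm (f x - rep_L2 (X k) x))\<^sup>2)"
          using elim by (auto intro!: tendsto_intros)
        from lim_imp_Liminf[OF _ this] show ?case by simp
      qed
    qed
    also have "\<dots> \<le> liminf (\<lambda>m. \<integral>\<^sup>+x. ennreal ((norm (rep_L2 (X (r m) - X k) x))\<^sup>2) \<partial>lborel)"
      by (intro nn_integral_liminf) measurable
    also have "\<dots> = liminf (\<lambda>m. ennreal ((norm (X (r m) - X k))\<^sup>2))"
      unfolding nn_integral_norm_L2 ..
    also have "\<dots> \<le> liminf (\<lambda>m::nat. ennreal (((1/2) ^ n)\<^sup>2))"
    proof (rule Liminf_mono)
      show "\<forall>\<^sub>F m in sequentially. ennreal ((norm (X (r m) - X k))\<^sup>2) \<le> ennreal (((1/2) ^ n)\<^sup>2)"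
        unfolding eventually_sequentially
        by (rule exI[of _ n])
           (use r k in \<open>auto intro!: ennreal_leI power_mono fast simp: strict_mono_less_eq\<close>)
    qed
    also have "\<dots> = ennreal (((1/2) ^ n)\<^sup>2)"
      by (simp add: Liminf_const)
    finally show ?thesis .
  qed
  have sq: "square_integrable (\<lambda>x. f x - rep_L2 (X k) x)" if "k \<ge> r n" for n k
    unfolding square_integrable_def
  proof
    show "integrable lborel (\<lambda>x. (norm (f x - rep_L2 (X k) x))\<^sup>2)"
      using est[OF that] by (intro integrableI_nonneg) (auto simp: le_less_trans)
  qed measurable
  have f: "square_integrable f"
    using square_integrable_add[OF sq[of 0 "r 0"] square_integrable_rep[of "X (r 0)"]] by simp
  have le: "norm (abs_L2 f - X k) \<le> (1/2) ^ n" if k: "k \<ge> r n" for n k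
  proof -
    have "abs_L2 f - X k = abs_L2 (\<lambda>x. f x - rep_L2 (X k) x)"
      using abs_L2_diff[OF f square_integrable_rep, of "X k"] by simp
    then have "norm (abs_L2 f - X k) = sqrt (\<integral>x. (norm (f x - rep_L2 (X k) x))\<^sup>2 \<partial>lborel)"
      using norm_abs_L2[OF sq[OF k]] by simp
    moreover have "ennreal (\<integral>x. (norm (f x - rep_L2 (X k) x))\<^sup>2 \<partial>lborel) \<le> ennreal (((1/2) ^ n)\<^sup>2)"
      using est[OF k] sq[OF k] by (subst (asm) nn_integral_eq_integral) (auto simp: square_integrable_def)
    ultimately show ?thesis
      by (subst (asm) ennreal_le_iff) (auto intro!: real_le_lsqrt)
  qed
  have "X \<longlonglongrightarrow> abs_L2 f"
  proof (rule LIMSEQ_I)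
    fix e :: real assume "0 < e"
    then obtain n where n: "(1/2) ^ n < e"
      using real_arch_pow_inv[of e "1/2"] by auto
    show "\<exists>no. \<forall>k\<ge>no. norm (X k - abs_L2 f) < e"
      by (rule exI[of _ "r n"]) (use le[of n] n in \<open>auto simp: norm_minus_commute intro: le_less_trans\<close>)
  qed
  then show "convergent X" by (auto simp: convergent_def)
qed

subsection \<open>Separability\<close>

lemma square_integrable_sum:
  "(\<And>i. i \<in> S \<Longrightarrow> square_integrable (f i)) \<Longrightarrow> square_integrable (\<lambda>x. \<Sum>i\<in>S. f i x)"
proof (induction S rule: infinite_finite_induct)
  case (insert i S)
  then have "square_integrable (\<lambda>x. f i x + (\<Sum>i\<in>S. f i x))"
    by (intro square_integrable_add) auto
  then show ?case using insert.hyps by simp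
qed simp_all

lemma abs_L2_sum:
  assumes "finite S" "\<And>i. i \<in> S \<Longrightarrow> square_integrable (f i)"
  shows "abs_L2 (\<lambda>x. \<Sum>i\<in>S. f i x) = (\<Sum>i\<in>S. abs_L2 (f i))"
  using assms
proof (induction S rule: finite_induct)
  case empty
  show ?case by (simp add: abs_L2_zero)
next
  case (insert i S)
  have "square_integrable (f i)" "square_integrable (\<lambda>x. \<Sum>j\<in>S. f j x)"
    using insert.prems by (auto intro: square_integrable_sum)
  from abs_L2_add[OF this] show ?case
    using insert by simp
qed

lemma square_integrable_indicator:
  assumes "A \<in> sets borel"
  shows "square_integrable (\<lambda>x. indicat_real (A \<inter> {-real n..real n}) x *\<^sub>R c)"
proof (rule square_integrable_bound)
  show "(\<lambda>x. indicat_real (A \<inter> {-real n..real n}) x *\<^sub>R c) \<in> borel_measurable lborel"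
    using assms by measurable
  show "integrable lborel (\<lambda>x. indicator {-real n..real n} x *\<^sub>R (norm c)\<^sup>2)"
    by (intro integrable_scaleR_left) simp
  show "AE x in lborel. (norm (indicat_real (A \<inter> {-real n..real n}) x *\<^sub>R c))\<^sup>2
      \<le> indicator {-real n..real n} x *\<^sub>R (norm c)\<^sup>2"
    by (auto simp: indicator_def)
qed

lemma L2_closed_subspace_eq_UNIV:
  fixes V :: "'a::euclidean_space L2 set"
  assumes "closed V" and zero: "0 \<in> V"
    and add: "\<And>u v. u \<in> V \<Longrightarrow> v \<in> V \<Longrightarrow> u + v \<in> V"
    and scale: "\<And>c u. u \<in> V \<Longrightarrow> c *\<^sub>R u \<in> V"
    and G: "Int_stable G" "sets borel = sigma_sets UNIV G"
    and ind: "\<And>A n b. A \<in> insert UNIV G \<Longrightarrow> b \<in> Basis \<Longrightarrow>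
        abs_L2 (\<lambda>x. indicat_real (A \<inter> {-real n..real n}) x *\<^sub>R b) \<in> V"
  shows "V = UNIV"
proof -
  define F where "F n b A = abs_L2 (\<lambda>x. indicat_real (A \<inter> {-real n..real n}) x *\<^sub>R b)"
    for n and b :: 'a and A
  have limV: "l \<in> V" if "\<And>i. s i \<in> V" "s \<longlonglongrightarrow> l" for s l
    using that \<open>closed V\<close> closed_sequentially by blast
  have sumV: "(\<Sum>i\<in>S. g i) \<in> V" if "\<And>i. i \<in> S \<Longrightarrow> g i \<in> V" for S and g :: "'i \<Rightarrow> 'a L2"
    using that by (induction S rule: infinite_finite_induct) (auto intro: zero add)
  have basis: "F n b A \<in> V" if A: "A \<in> sets borel" and b: "b \<in> Basis" for n b A
    using G(1) subset_UNIV[THEN PowI, THEN subsetI, of G] A[unfolded G(2)]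
  proof (induction rule: sigma_sets_induct_disjoint)
    case (basic A)
    then show ?case using ind[of A b n] b by (simp add: F_def)
  next
    case empty
    show ?case by (simp add: F_def abs_L2_zero zero)
  next
    case (compl A)
    have A: "A \<in> sets borel" using compl(1) by (simp add: G(2))
    have "F n b (UNIV - A) = F n b UNIV - F n b A"
      unfolding F_def
      by (subst abs_L2_diff[OF square_integrable_indicator square_integrable_indicator[OF A]])
         (auto intro!: arg_cong[where f = abs_L2] simp: indicator_def)
    then have "F n b (UNIV - A) = F n b UNIV + (-1) *\<^sub>R F n b A" by simp
    moreover have "F n b UNIV \<in> V" using ind[of UNIV b n] b by (simp add: F_def)
    ultimately show ?case using compl(2) add scale by metis
  next
    case (union A)
    have A: "A i \<in> sets borel" for i using union(2) by (auto simp: G(2))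
    have *: "F n b (\<Union>i<k. A i) \<in> V" for k
    proof (induction k)
      case 0
      show ?case by (simp add: F_def abs_L2_zero zero)
    next
      case (Suc k)
      have disj: "(\<Union>i<k. A i) \<inter> A k = {}"
        using union(1) unfolding disjoint_family_on_def by (fastforce dest: less_imp_neq)
      have U: "(\<Union>i<k. A i) \<in> sets borel" using A by auto
      have "F n b (\<Union>i<Suc k. A i) = F n b (\<Union>i<k. A i) + F n b (A k)"
        unfolding F_def
        by (subst abs_L2_add[OF square_integrable_indicator[OF U] square_integrable_indicator[OF A]])
           (rule arg_cong[where f = abs_L2], use disj in \<open>auto simp: indicator_def lessThan_Suc fun_eq_iff\<close>)
      then show ?case using Suc union(3)[of k] by (auto intro: add)
    qed
    have "(\<lambda>k. F n b (\<Union>i<k. A i)) \<longlonglongrightarrow> F n b (\<Union>i. A i)"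
      unfolding F_def
    proof (rule L2_dominated_convergence)
      show "square_integrable (\<lambda>x. indicat_real ((\<Union>i<k. A i) \<inter> {-real n..real n}) x *\<^sub>R b)" for k
        using A by (intro square_integrable_indicator) auto
      show "square_integrable (\<lambda>x. indicat_real ((\<Union>i. A i) \<inter> {-real n..real n}) x *\<^sub>R b)"
        using A by (intro square_integrable_indicator) auto
      show "square_integrable (\<lambda>x. indicat_real (UNIV \<inter> {-real n..real n}) x *\<^sub>R b)"
        by (intro square_integrable_indicator) auto
      show "norm (indicat_real ((\<Union>i<k. A i) \<inter> {-real n..real n}) x *\<^sub>R b)
          \<le> norm (indicat_real (UNIV \<inter> {-real n..real n}) x *\<^sub>R b)" for k x
        by (auto simp: indicator_def)
      show "AE x in lborel. (\<lambda>k. indicat_real ((\<Union>i<k. A i) \<inter> {-real n..real n}) x *\<^sub>R b)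
          \<longlonglongrightarrow> indicat_real ((\<Union>i. A i) \<inter> {-real n..real n}) x *\<^sub>R b"
      proof (rule AE_I2)
        fix x
        show "(\<lambda>k. indicat_real ((\<Union>i<k. A i) \<inter> {-real n..real n}) x *\<^sub>R b)
            \<longlonglongrightarrow> indicat_real ((\<Union>i. A i) \<inter> {-real n..real n}) x *\<^sub>R b"
        proof (rule tendsto_eventually, cases "\<exists>i. x \<in> A i")
          case True
          then obtain i where i: "x \<in> A i" ..
          show "\<forall>\<^sub>F k in sequentially. indicat_real ((\<Union>i<k. A i) \<inter> {-real n..real n}) x *\<^sub>R b
              = indicat_real ((\<Union>i. A i) \<inter> {-real n..real n}) x *\<^sub>R b"
            using eventually_gt_at_top[of i]
            by eventually_elim (use i in \<open>auto simp: indicator_def\<close>)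
        qed (auto simp: indicator_def)
      qed
    qed
    from limV[OF * this] show ?case .
  qed
  have vec: "F n c A \<in> V" if A: "A \<in> sets borel" for n c A
  proof -
    have "F n c A = abs_L2 (\<lambda>x. \<Sum>b\<in>Basis. (c \<bullet> b) *\<^sub>R (indicat_real (A \<inter> {-real n..real n}) x *\<^sub>R b))"
      unfolding F_def
    proof (rule arg_cong[where f = abs_L2], rule ext)
      fix x
      let ?i = "indicat_real (A \<inter> {-real n..real n}) x"
      have "?i *\<^sub>R c = ?i *\<^sub>R (\<Sum>b\<in>Basis. (c \<bullet> b) *\<^sub>R b)"
        by (simp only: euclidean_representation)
      also have "\<dots> = (\<Sum>b\<in>Basis. (c \<bullet> b) *\<^sub>R (?i *\<^sub>R b))"
        by (simp only: scaleR_sum_right scaleR_left_commute)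
      finally show "?i *\<^sub>R c = (\<Sum>b\<in>Basis. (c \<bullet> b) *\<^sub>R (?i *\<^sub>R b))" .
    qed
    also have "\<dots> = (\<Sum>b\<in>Basis. (c \<bullet> b) *\<^sub>R F n b A)"
      unfolding F_def
      by (simp only: abs_L2_sum[OF finite_Basis] abs_L2_scaleR
            square_integrable_scaleR square_integrable_indicator[OF A])
    also have "\<dots> \<in> V"
      by (intro sumV scale basis A)
    finally show ?thesis .
  qed
  have "u \<in> V" for u
  proof -
    obtain s where "(\<forall>i. simple_function lborel (s i)) \<and>
        (\<forall>x\<in>space lborel. (\<lambda>i. s i x) \<longlonglongrightarrow> rep_L2 u x) \<and>
        (\<forall>i. \<forall>x\<in>space lborel. dist (s i x) 0 \<le> 2 * dist (rep_L2 u x) 0)"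
      using borel_measurable_implies_sequence_metric[OF rep_L2_measurable[of u], of 0] by (elim exE)
    then have s: "\<And>i. simple_function lborel (s i)" "\<And>x. (\<lambda>i. s i x) \<longlonglongrightarrow> rep_L2 u x"
      "\<And>i x. norm (s i x) \<le> 2 * norm (rep_L2 u x)"
      by auto
    have [measurable]: "s i \<in> borel_measurable lborel" for i
      using s(1) by (rule borel_measurable_simple_function)
    define h where "h i x = indicat_real {-real i..real i} x *\<^sub>R s i x" for i x
    have bd: "norm (h i x) \<le> norm (2 *\<^sub>R rep_L2 u x)" for i x
      using s(3)[of i x] by (auto simp: h_def indicator_def)
    have sq2: "square_integrable (\<lambda>x. 2 *\<^sub>R rep_L2 u x)"
      by (intro square_integrable_scaleR) simp
    have sqh: "square_integrable (h i)" for i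
    proof (rule square_integrable_bound)
      show "h i \<in> borel_measurable lborel" unfolding h_def by measurable
      show "integrable lborel (\<lambda>x. (norm (2 *\<^sub>R rep_L2 u x))\<^sup>2)"
        using sq2 by (simp add: square_integrable_def)
      show "AE x in lborel. (norm (h i x))\<^sup>2 \<le> (norm (2 *\<^sub>R rep_L2 u x))\<^sup>2"
        by (intro AE_I2 power_mono bd) auto
    qed
    have "abs_L2 (h i) \<in> V" for i
    proof -
      have fin: "finite (range (s i))"
        and pre: "\<And>y. y \<in> range (s i) \<Longrightarrow> s i -` {y} \<in> sets borel"
        using s(1)[of i] by (auto simp: simple_function_def)
      have "h i = (\<lambda>x. \<Sum>y\<in>range (s i). indicat_real (s i -` {y} \<inter> {-real i..real i}) x *\<^sub>R y)"
      proof
        fix x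
        have "(\<Sum>y\<in>range (s i). indicat_real (s i -` {y} \<inter> {-real i..real i}) x *\<^sub>R y)
            = (\<Sum>y\<in>range (s i). if y = s i x then h i x else 0)"
        proof (rule sum.cong)
          fix y
          show "indicat_real (s i -` {y} \<inter> {-real i..real i}) x *\<^sub>R y
              = (if y = s i x then h i x else 0)"
            by (cases "y = s i x") (simp_all add: indicator_def h_def)
        qed simp
        then show "h i x = (\<Sum>y\<in>range (s i). indicat_real (s i -` {y} \<inter> {-real i..real i}) x *\<^sub>R y)"
          using fin by simp
      qed
      then have "abs_L2 (h i) = (\<Sum>y\<in>range (s i). F i y (s i -` {y}))"
        unfolding F_def using abs_L2_sum[OF fin square_integrable_indicator[OF pre]]
        by simp
      also have "\<dots> \<in> V"
        by (intro sumV vec pre)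
      finally show ?thesis .
    qed
    moreover have "(\<lambda>i. abs_L2 (h i)) \<longlonglongrightarrow> abs_L2 (rep_L2 u)"
    proof (rule L2_dominated_convergence[OF sqh square_integrable_rep sq2 _ bd], rule AE_I2)
      fix x
      have "\<forall>\<^sub>F i in sequentially. s i x = h i x"
        using eventually_ge_at_top[of "nat \<lceil>\<bar>x\<bar>\<rceil>"]
      proof eventually_elim
        case (elim i)
        then have "\<bar>x\<bar> \<le> real i" by linarith
        then have "x \<in> {-real i..real i}" by auto
        then show ?case by (simp add: h_def)
      qed
      from Lim_transform_eventually[OF s(2) this]
      show "(\<lambda>i. h i x) \<longlonglongrightarrow> rep_L2 u x" .
    qed
    ultimately have "abs_L2 (rep_L2 u) \<in> V" by (rule limV)
    then show ?thesis by simp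
  qed
  then show ?thesis by auto
qed

lemma second_countable_if_separable:
  fixes D :: "'b::metric_space set"
  assumes "countable D" "closure D = UNIV"
  shows "\<exists>B::'b set set. countable B \<and> open = generate_topology B"
proof (intro exI conjI)
  let ?B = "(\<lambda>(d, n). ball d (1 / real (Suc n))) ` (D \<times> (UNIV :: nat set))"
  show "countable ?B" using assms(1) by blast
  have "topological_basis ?B"
  proof (rule topological_basisI)
    fix U :: "'b set" and x
    assume "open U" "x \<in> U"
    then obtain e where e: "0 < e" "ball x e \<subseteq> U" by (auto simp: open_contains_ball)
    obtain n where n: "1 / real (Suc n) < e / 2"
      using nat_approx_posE[of "e / 2"] e by auto
    have "x \<in> closure D" using assms by simp
    then obtain d where d: "d \<in> D" "dist d x < 1 / real (Suc n)"
      unfolding closure_approachable by (meson of_nat_0_less_iff zero_less_Suc zero_less_divide_1_iff)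
    have "ball d (1 / real (Suc n)) \<subseteq> ball x e"
    proof
      fix y assume "y \<in> ball d (1 / real (Suc n))"
      then have "dist x y < 1 / real (Suc n) + 1 / real (Suc n)"
        using d dist_triangle3[of x y d] by simp
      then show "y \<in> ball x e" using n by simp
    qed
    then show "\<exists>B'\<in>?B. x \<in> B' \<and> B' \<subseteq> U"
      using d e by (intro bexI[of _ "ball d (1 / real (Suc n))"]) auto
  qed auto
  then show "open = generate_topology ?B" by (rule topological_basis_imp_subbasis)
qed

lemma ex_countable_Int_stable_generator:
  "\<exists>G :: real set set. countable G \<and> Int_stable G \<and> sets borel = sigma_sets UNIV G"
proof -
  obtain B :: "real set set" where B: "countable B" "topological_basis B"
    using ex_countable_basis by blast
  define G where "G = Inter ` {F. finite F \<and> F \<subseteq> B}"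
  have "countable G"
    unfolding G_def using B(1) by (intro countable_image countable_Collect_finite_subset)
  moreover have "Int_stable G"
  proof (rule Int_stableI)
    fix a b assume "a \<in> G" "b \<in> G"
    then obtain F1 F2 where "finite F1" "F1 \<subseteq> B" "a = \<Inter>F1" "finite F2" "F2 \<subseteq> B" "b = \<Inter>F2"
      by (auto simp: G_def)
    then show "a \<inter> b \<in> G"
      unfolding G_def by (intro image_eqI[of _ _ "F1 \<union> F2"]) auto
  qed
  moreover have "sets borel = sigma_sets UNIV G"
  proof
    have "B \<subseteq> G" unfolding G_def by (auto intro!: image_eqI[of _ _ "{_}"])
    then show "sets borel \<subseteq> sigma_sets UNIV G"
      by (subst borel_eq_countable_basis[OF B]) (simp add: sigma_sets_mono')
    have "open A" if "A \<in> G" for A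
      using that topological_basis_open[OF B(2)] by (auto simp: G_def intro!: open_Inter)
    then have "G \<subseteq> sets borel" by auto
    then show "sigma_sets UNIV G \<subseteq> sets borel"
      using sets.sigma_sets_subset[of G borel] by simp
  qed
  ultimately show ?thesis by blast
qed

instance L2 :: (euclidean_space) second_countable_topology
proof
  obtain G :: "real set set" where G: "countable G" "Int_stable G" "sets borel = sigma_sets UNIV G"
    using ex_countable_Int_stable_generator by blast
  define E :: "'a L2 set" where
    "E = (\<lambda>(A, n, b). abs_L2 (\<lambda>x. indicat_real (A \<inter> {-real n..real n}) x *\<^sub>R b))
           ` (insert UNIV G \<times> UNIV \<times> Basis)"
  define comb :: "(real \<times> 'a L2) list \<Rightarrow> 'a L2" where "comb xs = (\<Sum>(q, e)\<leftarrow>xs. q *\<^sub>R e)" for xs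
  define D where "D = comb ` lists (\<rat> \<times> E)"
  have "countable E"
    unfolding E_def using G(1) by (intro countable_image countable_SIGMA) (auto intro: countable_finite)
  then have "countable D"
    unfolding D_def by (intro countable_image countable_lists countable_SIGMA) (auto intro: countable_rat)
  moreover have "closure D = UNIV"
  proof (rule L2_closed_subspace_eq_UNIV[OF closed_closure _ _ _ G(2,3)])
    have D_add: "u + v \<in> D" if "u \<in> D" "v \<in> D" for u v
    proof -
      obtain xs where "u = comb xs" "xs \<in> lists (\<rat> \<times> E)"
        using \<open>u \<in> D\<close> unfolding D_def by blast
      moreover obtain ys where "v = comb ys" "ys \<in> lists (\<rat> \<times> E)"
        using \<open>v \<in> D\<close> unfolding D_def by blast
      ultimately show ?thesis
        unfolding D_def by (intro image_eqI[of _ _ "xs @ ys"]) (auto simp: comb_def)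
    qed
    have D_scale: "q *\<^sub>R u \<in> D" if "q \<in> \<rat>" "u \<in> D" for q u
    proof -
      obtain xs where xs: "u = comb xs" "xs \<in> lists (\<rat> \<times> E)"
        using \<open>u \<in> D\<close> unfolding D_def by blast
      have "q *\<^sub>R comb xs = comb (map (\<lambda>(p, e). (q * p, e)) xs)"
        by (induction xs) (auto simp: comb_def scaleR_add_right)
      then show ?thesis
        unfolding D_def xs(1) using xs(2) that(1) by (intro image_eqI[of _ _ "map (\<lambda>(p, e). (q * p, e)) xs"]) fastforce+
    qed
    have "comb [] \<in> D" unfolding D_def by (rule imageI) simp
    then have "0 \<in> D" by (simp add: comb_def)
    then show "0 \<in> closure D" using closure_subset by blast
    show "u + v \<in> closure D" if uv: "u \<in> closure D" "v \<in> closure D" for u v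
    proof -
      obtain p q where "\<And>n. p n \<in> D" "p \<longlonglongrightarrow> u" "\<And>n. q n \<in> D" "q \<longlonglongrightarrow> v"
        using uv unfolding closure_sequential by blast
      then show ?thesis
        unfolding closure_sequential
        by (intro exI[of _ "\<lambda>n. p n + q n"]) (auto intro: D_add tendsto_add)
    qed
    show "c *\<^sub>R u \<in> closure D" if u: "u \<in> closure D" for c u
    proof -
      have "c \<in> closure \<rat>" by (simp add: Rats_closure_real)
      then obtain q where "\<And>n. q n \<in> \<rat>" "q \<longlonglongrightarrow> c" unfolding closure_sequential by blast
      moreover obtain p where "\<And>n. p n \<in> D" "p \<longlonglongrightarrow> u"
        using u unfolding closure_sequential by blast
      ultimately show ?thesis
        unfolding closure_sequential
        by (intro exI[of _ "\<lambda>n. q n *\<^sub>R p n"]) (auto intro: D_scale tendsto_scaleR)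
    qed
    show "abs_L2 (\<lambda>x. indicat_real (A \<inter> {-real n..real n}) x *\<^sub>R b) \<in> closure D"
      if "A \<in> insert UNIV G" "b \<in> Basis" for A n and b :: 'a
    proof -
      let ?e = "abs_L2 (\<lambda>x. indicat_real (A \<inter> {-real n..real n}) x *\<^sub>R b)"
      have "?e \<in> E" unfolding E_def using that by (intro image_eqI[of _ _ "(A, n, b)"]) auto
      then have "comb [(1, ?e)] \<in> D" unfolding D_def by (intro imageI) auto
      then show ?thesis using closure_subset[of D] by (auto simp: comb_def)
    qed
  qed
  ultimately show "\<exists>B::'a L2 set set. countable B \<and> open = generate_topology B"
    by (rule second_countable_if_separable)
qed

section \<open>Fourier transform and Sobolev spaces on the real line\<close>

definition fourier_integral :: "(real \<Rightarrow> real) \<Rightarrow> real \<Rightarrow> complex" where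
  "fourier_integral g \<xi> = (LINT x|lborel. g x *\<^sub>R cis (- (x * \<xi>))) /\<^sub>R sqrt (2 * pi)"

text \<open>
  The unitary Fourier transform on \<open>L\<^sup>2\<close>: the limit in the mean of the Fourier integrals of the
  truncations of \<open>u\<close> to \<open>[-n, n]\<close>, which are integrable.
\<close>

definition fourier_L2 :: "real L2 \<Rightarrow> complex L2" where
  "fourier_L2 u =
     lim (\<lambda>n. abs_L2 (fourier_integral (\<lambda>x. indicator {-real n..real n} x * rep_L2 u x)))"

text \<open>
  \<open>H\<^sup>l\<close>, realised as a set of (classes of) real-valued square integrable functions; this is
  the usual space for \<open>l \<ge> 0\<close> only.  Outside the space the norm below has no meaning (a divergent
  integral evaluates to \<open>0\<close>), so it is only ever used together with membership.
\<close>

definition sobolev_space :: "real \<Rightarrow> real L2 set" where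
  "sobolev_space l =
     {u. integrable lborel (\<lambda>\<xi>. (1 + \<xi>\<^sup>2) powr l * (cmod (rep_L2 (fourier_L2 u) \<xi>))\<^sup>2)}"

definition sobolev_norm :: "real \<Rightarrow> real L2 \<Rightarrow> real" where
  "sobolev_norm l u =
     sqrt (LINT \<xi>|lborel. (1 + \<xi>\<^sup>2) powr l * (cmod (rep_L2 (fourier_L2 u) \<xi>))\<^sup>2)"

definition continuous_into_sobolev :: "real \<Rightarrow> real set \<Rightarrow> (real \<Rightarrow> real L2) \<Rightarrow> bool" where
  "continuous_into_sobolev l I u \<longleftrightarrow>
     (\<forall>t\<in>I. u t \<in> sobolev_space l \<and> ((\<lambda>s. sobolev_norm l (u s - u t)) \<longlongrightarrow> 0) (at t within I))"

text \<open>\<open>Y_space l \<tau> T\<close> collects the \<open>u\<close> for which both terms of \<open>Y_norm l \<tau> T u\<close> are finite.\<close>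

definition Y_space :: "real \<Rightarrow> real \<Rightarrow> real \<Rightarrow> (real \<Rightarrow> real L2) set" where
  "Y_space l \<tau> T =
     {u. (\<forall>s\<in>{\<tau>..\<tau> + T}. u s \<in> sobolev_space l) \<and>
         bdd_above ((\<lambda>s. sobolev_norm l (u s)) ` {\<tau>..\<tau> + T}) \<and>
         set_integrable lebesgue {\<tau>..\<tau> + T} (\<lambda>s. (sobolev_norm l (u s))\<^sup>2)}"

definition Y_norm :: "real \<Rightarrow> real \<Rightarrow> real \<Rightarrow> (real \<Rightarrow> real L2) \<Rightarrow> real" where
  "Y_norm l \<tau> T u =
     (SUP s\<in>{\<tau>..\<tau> + T}. sobolev_norm l (u s)) +
     sqrt (LINT s:{\<tau>..\<tau> + T}|lebesgue. (sobolev_norm l (u s))\<^sup>2)"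

section \<open>The Cauchy problem\<close>

text \<open>
  The Fourier transform of the tempered distribution \<open>g - (v\<^sup>2)\<^sub>x / 2\<close> for square integrable \<open>g\<close> and
  \<open>v\<close>.  Since \<open>v\<^sup>2\<close> is merely integrable, the Fourier integral is used for it, and the derivative
  becomes multiplication by \<open>\<i> \<xi>\<close>.
\<close>

definition source_hat :: "real L2 \<Rightarrow> real L2 \<Rightarrow> real \<Rightarrow> complex" where
  "source_hat g v \<xi> = rep_L2 (fourier_L2 g) \<xi>
     - (1/2) * (\<i> * complex_of_real \<xi> * fourier_integral (\<lambda>x. (rep_L2 v x)\<^sup>2) \<xi>)"

text \<open>
  \<open>(1 - \<partial>\<^sub>x\<^sub>x)\<^sup>-\<^sup>1\<close> as the Fourier multiplier \<open>1 / (1 + \<xi>\<^sup>2)\<close>, applied to the real tempered distribution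
  whose Fourier transform is \<open>m\<close>.
\<close>

definition helmholtz_inverse :: "(real \<Rightarrow> complex) \<Rightarrow> real L2" where
  "helmholtz_inverse m =
     (THE w. AE \<xi> in lborel. rep_L2 (fourier_L2 w) \<xi> = m \<xi> / complex_of_real (1 + \<xi>\<^sup>2))"

text \<open>
  Mild solutions in \<open>C([0, S]; H\<^sup>l)\<close>.  Only the values \<open>u t\<close> with \<open>0 \<le> t \<le> S\<close> matter.  The time
  integral is the Bochner integral in \<open>L\<^sup>2\<close>.
\<close>

definition mild_solution ::
    "real \<Rightarrow> real \<Rightarrow> real L2 \<Rightarrow> (real \<Rightarrow> real L2) \<Rightarrow> (real \<Rightarrow> real L2) \<Rightarrow> bool" where
  "mild_solution l S \<phi> f u \<longleftrightarrow>
     continuous_into_sobolev l {0..S} u \<and>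
     (\<forall>t\<in>{0..S}.
        set_integrable lebesgue {0..t}
          (\<lambda>s. exp (- (t - s)) *\<^sub>R helmholtz_inverse (source_hat (f s) (u s))) \<and>
        u t = exp (- t) *\<^sub>R \<phi> +
          (LINT s:{0..t}|lebesgue.
             exp (- (t - s)) *\<^sub>R helmholtz_inverse (source_hat (f s) (u s))))"

definition well_posed_at :: "real \<Rightarrow> real \<Rightarrow> real L2 \<Rightarrow> (real \<Rightarrow> real L2) \<Rightarrow> bool" where
  "well_posed_at l S \<phi> f \<longleftrightarrow>
     (\<exists>u. mild_solution l S \<phi> f u) \<and>
     (\<forall>u v. mild_solution l S \<phi> f u \<longrightarrow> mild_solution l S \<phi> f v \<longrightarrow> (\<forall>t\<in>{0..S}. u t = v t)) \<and>
     (\<forall>u. mild_solution l S \<phi> f u \<longrightarrow>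
        (\<forall>\<epsilon>>0. \<exists>\<eta>>0. \<forall>\<psi>\<in>sobolev_space l. \<forall>v.
           sobolev_norm l (\<psi> - \<phi>) < \<eta> \<longrightarrow> mild_solution l S \<psi> f v \<longrightarrow>
           (\<forall>t\<in>{0..S}. sobolev_norm l (v t - u t) < \<epsilon>)))"

end

theory Submission
  imports Defs "HOL-Probability.Characteristic_Functions" "HOL-Probability.Sinc_Integral"
begin

text \<open>
  Write \<open>u = \<Lambda> U\<close> with the Bessel potential \<open>\<Lambda>\<close>, the Fourier multiplier \<open>(1 + \<xi>\<^sup>2) powr (- l / 2)\<close>, so
  that the \<open>H\<^sup>l\<close> norm of \<open>u\<close> is the \<open>L\<^sup>2\<close> norm of \<open>U\<close>.  The mild equation becomes
  \<open>U t = exp (- t) \<Phi> + \<integral>\<^sub>0\<^sup>t exp (- (t - s)) (g s + B (U s) (U s)) ds\<close> in \<open>L\<^sup>2\<close>, with \<open>B\<close> bounded and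
  bilinear.  Since the kernel has total mass at most \<open>1\<close>, small data give a contraction on a ball
  whatever the length of the time interval.  A continuity argument shows that every solution stays
  in that ball, and then the contraction also gives uniqueness and continuous dependence.

  The boundedness of \<open>B\<close> is a convolution estimate on the Fourier side.  By Cauchy-Schwarz, the
  square of the transform of \<open>u v\<close> at \<open>\<xi>\<close> is at most the squared \<open>H\<^sup>l\<close> norm of \<open>u\<close> times the integral
  over \<open>\<eta>\<close> of \<open>(1 + \<eta>\<^sup>2) powr (- l)\<close> against the squared transform of \<open>v\<close> at \<open>\<xi> - \<eta>\<close>, up to a constant.
  Because \<open>(1 + \<xi>\<^sup>2) powr (l - 1) * (1 + \<eta>\<^sup>2) powr (- l) \<le> 1 / (1 + \<xi>\<^sup>2) + 1 / (1 + \<eta>\<^sup>2)\<close>, integrating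
  this over \<open>\<xi>\<close> with the weight \<open>(1 + \<xi>\<^sup>2) powr (l - 1)\<close> gives a multiple of the squared \<open>L\<^sup>2\<close> norm of
  \<open>v\<close>, uniformly in \<open>l\<close>.

  Plancherel's identity comes from a Gaussian regularisation of the integral of the squared
  transform.  Surjectivity onto Hermitian functions needs no inversion formula: if \<open>w\<close> is the adjoint
  of the transform \<open>F\<close> applied to \<open>M\<close> and \<open>\<parallel>w\<parallel> = \<parallel>M\<parallel>\<close>, then
  \<open>\<parallel>F w - M\<parallel>\<^sup>2 = \<parallel>w\<parallel>\<^sup>2 - 2 (w \<bullet> w) + \<parallel>M\<parallel>\<^sup>2 = 0\<close>.
\<close>

section \<open>The damped evolution equation with a bilinear source\<close>

text \<open>The solution of \<open>U' = h - U\<close> with \<open>U 0 = 0\<close>. The measure is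
  \<open>lebesgue\<close>, so that the integral has the form used in
  \<open>mild_solution\<close>.\<close>

definition duhamel :: "(real \<Rightarrow> 'a::{banach,second_countable_topology}) \<Rightarrow> real \<Rightarrow> 'a" where
  "duhamel h t = (LINT s:{0..t}|lebesgue. exp (- (t - s)) *\<^sub>R h s)"

lemma set_integrable_bounded_interval:
  fixes h :: "real \<Rightarrow> 'a::{banach,second_countable_topology}"
  assumes "h \<in> borel_measurable (lebesgue_on {a..b})" "\<And>s. s \<in> {a..b} \<Longrightarrow> norm (h s) \<le> M"
    and "A \<subseteq> {a..b}" "A \<in> sets lebesgue"
  shows "set_integrable lebesgue A h"
proof -
  \<comment> \<open>\<open>h\<close> is measurable only on the interval; its extension by 0 is
    measurable on the whole line.\<close>
  define k where "k s = indicator {a..b} s *\<^sub>R h s" for s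
  have k: "k \<in> borel_measurable lebesgue"
    unfolding k_def using assms(1) by (subst (asm) borel_measurable_restrict_space_iff) auto
  have "emeasure lebesgue A \<le> emeasure lebesgue {a..b}"
    using assms by (intro emeasure_mono) auto
  then have "emeasure lebesgue A < \<infinity>" by (rule le_less_trans) (simp add: emeasure_lborel_Icc_eq)
  then have "integrable lebesgue (\<lambda>s. indicator A s *\<^sub>R k s)"
    by (rule integrableI_bounded_set_indicator[where B = M, OF assms(4) k])
       (use assms(2,3) in \<open>auto simp: k_def subset_eq\<close>)
  moreover have "(\<lambda>s. indicator A s *\<^sub>R k s) = (\<lambda>s. indicator A s *\<^sub>R h s)"
    using assms(3) by (auto simp: k_def indicator_def fun_eq_iff)
  ultimately show ?thesis by (simp add: set_integrable_def)
qed

lemma borel_measurable_lebesgue_on_continuous: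
  fixes f :: "real \<Rightarrow> 'a::{second_countable_topology,real_normed_vector}"
  assumes "continuous_on A f" "A \<in> sets borel"
  shows "f \<in> borel_measurable (lebesgue_on A)"
proof -
  have "f \<in> borel_measurable (restrict_space borel A)"
    using assms(1) by (rule borel_measurable_continuous_on_restrict)
  then have "(\<lambda>x. indicator A x *\<^sub>R f x) \<in> borel_measurable borel"
    using assms(2) by (subst (asm) borel_measurable_restrict_space_iff) auto
  then have "(\<lambda>x. indicator A x *\<^sub>R f x) \<in> borel_measurable lebesgue"
    by (intro measurable_completion) simp
  then show ?thesis
    using assms(2) by (subst borel_measurable_restrict_space_iff) auto
qed

lemma duhamel_0 [simp]: "duhamel h 0 = 0"
proof -
  have "AE s in lebesgue. s \<noteq> (0::real)"
    by (intro AE_completion AE_lborel_singleton)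
  then show ?thesis
    unfolding duhamel_def set_lebesgue_integral_def
    by (intro integral_eq_zero_AE) (elim eventually_mono, simp add: indicator_def)
qed

lemma duhamel_integrable:
  fixes h :: "real \<Rightarrow> 'a::{banach,second_countable_topology}"
  assumes "h \<in> borel_measurable (lebesgue_on {0..S})" "\<And>s. s \<in> {0..S} \<Longrightarrow> norm (h s) \<le> M"
    and "t \<in> {0..S}"
  shows "set_integrable lebesgue {0..t} (\<lambda>s. exp (- (t - s)) *\<^sub>R h s)"
proof (rule set_integrable_bounded_interval)
  have "(\<lambda>s. exp (- (t - s))) \<in> borel_measurable (lebesgue_on {0..S})"
    by (intro borel_measurable_lebesgue_on_continuous continuous_intros) auto
  then show "(\<lambda>s. exp (- (t - s)) *\<^sub>R h s) \<in> borel_measurable (lebesgue_on {0..S})"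
    using assms(1) by (intro borel_measurable_scaleR) auto
  have S: "0 \<le> S" using assms(3) by simp
  show "norm (exp (- (t - s)) *\<^sub>R h s) \<le> exp S * M" if "s \<in> {0..S}" for s
    unfolding norm_scaleR using that assms(2)[OF that] assms(3) by (intro mult_mono) auto
qed (use assms(3) in auto)

text \<open>The kernel \<open>exp (- (t - s))\<close> has mass \<open>1 - exp (- t)\<close> on
  \<open>{0..t}\<close>, hence at most 1 for every \<open>t\<close>. Because no factor grows with
  \<open>t\<close>, one smallness threshold serves all time intervals.\<close>

lemma norm_duhamel_le:
  fixes h :: "real \<Rightarrow> 'a::{banach,second_countable_topology}"
  assumes "h \<in> borel_measurable (lebesgue_on {0..t})" "\<And>s. s \<in> {0..t} \<Longrightarrow> norm (h s) \<le> M" "0 \<le> t"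
  shows "norm (duhamel h t) \<le> M"
proof -
  have M: "0 \<le> M" using order_trans[OF norm_ge_zero assms(2)[of 0]] assms(3) by simp
  have exp: "((\<lambda>s. exp (- (t - s))) has_integral (exp (- (t - t)) - exp (- (t - 0)))) {0..t}"
    using assms(3)
    by (intro fundamental_theorem_of_calculus)
       (auto intro!: derivative_eq_intros simp: has_real_derivative_iff_has_vector_derivative[symmetric])
  have int: "set_integrable lebesgue {0..t} (\<lambda>s. exp (- (t - s)))"
    by (rule set_integrable_bounded_interval[where a = 0 and b = t and M = 1])
       (auto intro!: borel_measurable_lebesgue_on_continuous continuous_intros)
  have int': "set_integrable lebesgue {0..t} (\<lambda>s. M * exp (- (t - s)))"
    using int by (rule set_integrable_mult_right)
  have "norm (duhamel h t) \<le> (LINT s:{0..t}|lebesgue. M * exp (- (t - s)))"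
    unfolding duhamel_def set_lebesgue_integral_def
    by (rule Bochner_Integration.integral_norm_bound_integral[OF
          duhamel_integrable[OF assms(1,2), of t, unfolded set_integrable_def] int'[unfolded set_integrable_def]])
       (use assms in \<open>auto simp: indicator_def\<close>)
  also have "\<dots> = M * (1 - exp (- t))"
    using set_lebesgue_integral_eq_integral(2)[OF int] exp
    by (simp add: integral_unique)
  also have "\<dots> \<le> M" using M by (simp add: mult_left_le)
  finally show ?thesis .
qed

text \<open>Factoring out \<open>exp (- t)\<close> leaves the integral over \<open>{0..t}\<close> of
  an integrand that does not depend on \<open>t\<close> and is bounded on \<open>{0..S}\<close>.
  Such an integral is Lipschitz in its end point.\<close>

lemma continuous_on_duhamel:
  fixes h :: "real \<Rightarrow> 'a::{banach,second_countable_topology}"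
  assumes h: "h \<in> borel_measurable (lebesgue_on {0..S})" "\<And>s. s \<in> {0..S} \<Longrightarrow> norm (h s) \<le> M"
  shows "continuous_on {0..S} (duhamel h)"
proof -
  define k where "k s = exp s *\<^sub>R h s" for s
  define I where "I t = (LINT s:{0..t}|lebesgue. k s)" for t
  have k: "norm (k s) \<le> exp S * M" if "s \<in> {0..S}" for s
    unfolding norm_scaleR k_def using that h(2)[OF that] by (intro mult_mono) auto
  have "(\<lambda>s. exp s) \<in> borel_measurable (lebesgue_on {0..S})"
    by (intro borel_measurable_lebesgue_on_continuous continuous_intros) auto
  then have "k \<in> borel_measurable (lebesgue_on {0..S})"
    unfolding k_def using h(1) by (intro borel_measurable_scaleR) auto
  from set_integrable_bounded_interval[OF this k]
  have kint: "set_integrable lebesgue A k" if "A \<subseteq> {0..S}" "A \<in> sets lebesgue" for A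
    using that by blast
  have le: "norm (I b - I a) \<le> exp S * M * (b - a)" if "0 \<le> a" "a \<le> b" "b \<le> S" for a b
  proof -
    have sub: "{0..a} \<subseteq> {0..S}" "{a<..b} \<subseteq> {0..S}" using that by auto
    \<comment> \<open>The second interval is open on the left, so that the union is
      disjoint.\<close>
    have "{0..b} = {0..a} \<union> {a<..b}" using that by auto
    then have "I b = I a + (LINT s:{a<..b}|lebesgue. k s)"
      unfolding I_def using that by (auto intro!: set_integral_Un kint)
    then have "norm (I b - I a) = norm (LINT s:{a<..b}|lebesgue. k s)" by simp
    also have "\<dots> \<le> (LINT s:{a<..b}|lebesgue. exp S * M)"
      unfolding set_lebesgue_integral_def
    proof (rule Bochner_Integration.integral_norm_bound_integral)
      show "integrable lebesgue (\<lambda>s. indicator {a<..b} s *\<^sub>R k s)"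
        using kint[OF sub(2)] by (simp add: set_integrable_def)
      show "integrable lebesgue (\<lambda>s. indicator {a<..b} s *\<^sub>R (exp S * M))"
        by (intro integrable_scaleR_left integrable_real_indicator)
           (simp_all add: emeasure_lborel_Ioc that)
      show "norm (indicator {a<..b} s *\<^sub>R k s) \<le> indicator {a<..b} s *\<^sub>R (exp S * M)" for s
        using k[of s] that by (auto simp: indicator_def)
    qed
    also have "\<dots> = exp S * M * (b - a)"
      using that by (simp add: set_lebesgue_integral_def measure_def emeasure_lborel_Ioc)
    finally show ?thesis .
  qed
  have "continuous_on {0..S} I"
  proof (cases "0 \<le> S")
    case True
    have M: "0 \<le> M" using order_trans[OF norm_ge_zero h(2)[of 0]] True by simp
    have "(exp S * M)-lipschitz_on {0..S} I"
    proof (rule lipschitz_onI)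
      fix x y assume "x \<in> {0..S}" "y \<in> {0..S}"
      then show "dist (I x) (I y) \<le> exp S * M * dist x y"
        using le[of x y] le[of y x]
        by (cases "x \<le> y") (auto simp: dist_norm norm_minus_commute)
    qed (use M in simp)
    then show ?thesis by (rule lipschitz_on_continuous_on)
  qed simp
  moreover have "duhamel h = (\<lambda>t. exp (- t) *\<^sub>R I t)"
  proof
    fix t
    have "exp (- (t - s)) *\<^sub>R h s = exp (- t) *\<^sub>R k s" for s
      by (simp add: k_def exp_add[symmetric])
    then show "duhamel h t = exp (- t) *\<^sub>R I t"
      by (simp add: duhamel_def I_def)
  qed
  ultimately show ?thesis by (auto intro!: continuous_intros)
qed

lemma duhamel_diff:
  fixes h k :: "real \<Rightarrow> 'a::{banach,second_countable_topology}"
  assumes "h \<in> borel_measurable (lebesgue_on {0..S})" "\<And>s. s \<in> {0..S} \<Longrightarrow> norm (h s) \<le> M"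
    and "k \<in> borel_measurable (lebesgue_on {0..S})" "\<And>s. s \<in> {0..S} \<Longrightarrow> norm (k s) \<le> M'"
    and "t \<in> {0..S}"
  shows "duhamel h t - duhamel k t = duhamel (\<lambda>s. h s - k s) t"
  unfolding duhamel_def scaleR_diff_right
  by (rule set_integral_diff(2)[symmetric]; rule duhamel_integrable[OF _ _ assms(5)])
     (use assms in auto)

section \<open>Small-data theory of the abstract equation\<close>

locale damped_bilinear = bounded_bilinear B
  for B :: "'a \<Rightarrow> 'a \<Rightarrow> 'a::{banach,second_countable_topology}" +
  fixes g :: "real \<Rightarrow> 'a" and K G :: real
  assumes K_pos: "0 < K"
    and norm_B: "norm (B x y) \<le> K * norm x * norm y"
    and g_measurable: "g \<in> borel_measurable (lebesgue_on {0..})"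
    and norm_g: "0 \<le> s \<Longrightarrow> norm (g s) \<le> G"
begin

definition source :: "(real \<Rightarrow> 'a) \<Rightarrow> real \<Rightarrow> 'a" where
  "source U s = g s + B (U s) (U s)"

definition sol :: "real \<Rightarrow> 'a \<Rightarrow> (real \<Rightarrow> 'a) \<Rightarrow> bool" where
  "sol S x U \<longleftrightarrow> continuous_on {0..S} U \<and>
     (\<forall>t\<in>{0..S}. U t = exp (- t) *\<^sub>R x + duhamel (source U) t)"

lemma G_nonneg: "0 \<le> G"
  using order_trans[OF norm_ge_zero norm_g[of 0]] by simp

lemma source_measurable:
  assumes "continuous_on {0..S} U"
  shows "source U \<in> borel_measurable (lebesgue_on {0..S})"
proof -
  have "continuous_on {0..S} (\<lambda>s. B (U s) (U s))"
    by (intro continuous_on assms)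
  then have "(\<lambda>s. B (U s) (U s)) \<in> borel_measurable (lebesgue_on {0..S})"
    by (rule borel_measurable_lebesgue_on_continuous) simp
  moreover have "g \<in> borel_measurable (lebesgue_on {0..S})"
    by (rule measurable_restrict_mono[OF g_measurable]) auto
  ultimately show ?thesis
    unfolding source_def by (rule borel_measurable_add[rotated])
qed

lemma norm_source:
  assumes "0 \<le> s" "norm (U s) \<le> R"
  shows "norm (source U s) \<le> G + K * R\<^sup>2"
proof -
  have "norm (B (U s) (U s)) \<le> K * norm (U s) * norm (U s)" by (rule norm_B)
  also have "\<dots> = K * (norm (U s))\<^sup>2" by (simp add: power2_eq_square)
  also have "\<dots> \<le> K * R\<^sup>2"
    using K_pos assms(2) by (intro mult_left_mono power_mono) auto
  finally show ?thesis
    unfolding source_def by (intro norm_triangle_le add_mono norm_g assms)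
qed

text \<open>The forcing cancels, and bilinearity splits the rest into
  \<open>B (U s) (U s - V s) + B (U s - V s) (V s)\<close>. On the ball of radius \<open>R\<close>
  the source is therefore Lipschitz with constant \<open>2 * K * R\<close>.\<close>

lemma norm_source_diff:
  assumes "norm (U s) \<le> R" "norm (V s) \<le> R"
  shows "norm (source U s - source V s) \<le> 2 * K * R * norm (U s - V s)"
proof -
  have "source U s - source V s = B (U s) (U s - V s) + B (U s - V s) (V s)"
    by (simp add: source_def diff_left diff_right)
  also have "norm \<dots> \<le> K * norm (U s) * norm (U s - V s) + K * norm (U s - V s) * norm (V s)"
    by (intro norm_triangle_le add_mono norm_B)
  also have "\<dots> \<le> K * R * norm (U s - V s) + K * norm (U s - V s) * R"
    using K_pos assms order_trans[OF norm_ge_zero assms(1)] by (intro add_mono mult_mono) auto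
  finally show ?thesis by (simp add: algebra_simps)
qed

text \<open>Serves twice: in the continuity argument for given solutions, and to show that the fixed
  point map preserves a ball.\<close>

lemma step_bound:
  assumes "continuous_on {0..t} U" "\<And>s. s \<in> {0..t} \<Longrightarrow> norm (U s) \<le> R" "0 \<le> t"
  shows "norm (exp (- t) *\<^sub>R x + duhamel (source U) t) \<le> norm x + G + K * R\<^sup>2"
proof -
  have "norm (exp (- t) *\<^sub>R x) \<le> norm x"
    using assms(3) by (simp add: mult_left_le_one_le)
  moreover have "norm (duhamel (source U) t) \<le> G + K * R\<^sup>2"
    using assms by (intro norm_duhamel_le source_measurable norm_source) auto
  ultimately show ?thesis
    by (intro norm_triangle_le) simp
qed

text \<open>Continuity argument: at the first time where the norm equals \<open>R\<close>, the equation forces it below \<open>R\<close>.\<close>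

lemma sol_less:
  assumes sol: "sol S x U" and R: "0 < R" "norm x + G \<le> R / 2" "4 * K * R \<le> 1"
    and t: "t \<in> {0..S}"
  shows "norm (U t) < R"
proof (rule ccontr)
  assume "\<not> norm (U t) < R"
  have cont: "continuous_on {0..S} U"
    and eq: "\<And>t. t \<in> {0..S} \<Longrightarrow> U t = exp (- t) *\<^sub>R x + duhamel (source U) t"
    using sol by (auto simp: sol_def)
  define m where "m s = norm (U s)" for s
  have m: "continuous_on {0..S} m" unfolding m_def by (intro continuous_on_norm cont)
  have "m 0 \<le> R / 2"
  proof -
    have "U 0 = x" using eq[of 0] t by simp
    then show ?thesis using R(2) G_nonneg by (simp add: m_def)
  qed
  then have m0: "m 0 < R" using R(1) by simp
  have ivt: "\<exists>r. 0 \<le> r \<and> r \<le> s \<and> m r = R" if "s \<in> {0..S}" "R \<le> m s" for s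
    using that m0 by (intro IVT') (auto intro: continuous_on_subset[OF m])
  define Z where "Z = {s \<in> {0..S}. m s = R}"
  have "R \<le> m t" using \<open>\<not> norm (U t) < R\<close> by (simp add: m_def)
  then obtain q where "0 \<le> q" "q \<le> t" "m q = R" using ivt[OF t] by blast
  then have "q \<in> Z" using t by (simp add: Z_def)
  then have "Z \<noteq> {}" by blast
  \<comment> \<open>Compactness provides a first time \<open>r\<close> at which the norm equals
    \<open>R\<close>.\<close>
  moreover have "compact Z"
  proof -
    have "closed ({0..S} \<inter> m -` {R})"
      by (rule continuous_closed_preimage[OF m]) auto
    then have "compact (({0..S} \<inter> m -` {R}) \<inter> {0..S})"
      by (rule closed_Int_compact) simp
    moreover have "({0..S} \<inter> m -` {R}) \<inter> {0..S} = Z" by (auto simp: Z_def)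
    ultimately show ?thesis by simp
  qed
  ultimately obtain r where r: "r \<in> Z" "\<And>s. s \<in> Z \<Longrightarrow> r \<le> s"
    using compact_attains_inf[of Z] by blast
  \<comment> \<open>A value above \<open>R\<close> at \<open>s \<le> r\<close> would, by the
    intermediate value theorem, give a time \<open>q \<le> s\<close> with value exactly
    \<open>R\<close>. Minimality of \<open>r\<close> forces \<open>q = s\<close>, where the value
    exceeds \<open>R\<close>.\<close>
  have "m s \<le> R" if "s \<in> {0..r}" for s
  proof (rule ccontr)
    assume "\<not> m s \<le> R"
    moreover have "s \<in> {0..S}" using that r(1) by (auto simp: Z_def)
    ultimately obtain q where q: "0 \<le> q" "q \<le> s" "m q = R" using ivt[of s] by auto
    then have "q \<in> Z" using \<open>s \<in> {0..S}\<close> by (auto simp: Z_def)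
    then have "q = s" using r(2)[of q] that q(2) by auto
    then show False using q(3) \<open>\<not> m s \<le> R\<close> by simp
  qed
  then have "norm (exp (- r) *\<^sub>R x + duhamel (source U) r) \<le> norm x + G + K * R\<^sup>2"
    using r(1) by (intro step_bound continuous_on_subset[OF cont]) (auto simp: m_def Z_def)
  then have "m r \<le> norm x + G + K * R\<^sup>2"
    using eq[of r] r(1) by (simp add: Z_def m_def)
  \<comment> \<open>The data contribute at most \<open>R / 2\<close> and, since
    \<open>4 * K * R \<le> 1\<close>, the quadratic term at most \<open>R / 4\<close>. The sum stays
    strictly below the value \<open>R\<close> attained at \<open>r\<close>.\<close>
  also have "\<dots> \<le> R / 2 + R / 4"
  proof (intro add_mono R)
    have "(K * R) * R \<le> (1 / 4) * R" using R by (intro mult_right_mono) auto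
    then show "K * R\<^sup>2 \<le> R / 4" by (simp add: power2_eq_square)
  qed
  also have "\<dots> < R" using R by simp
  finally show False using r(1) by (simp add: Z_def)
qed

text \<open>\<open>sol_less\<close> asks for a positive radius and gives a strict inequality, so it
  is applied with radii slightly above \<open>2 * (norm x + G)\<close>, and the excess
  \<open>e\<close> is then removed.\<close>

lemma sol_bound:
  assumes sol: "sol S x U" and small: "8 * K * (norm x + G) < 1" and t: "t \<in> {0..S}"
  shows "norm (U t) \<le> 2 * (norm x + G)"
proof (rule field_le_epsilon)
  fix e :: real assume "0 < e"
  \<comment> \<open>The cap \<open>1 / (4 * K)\<close> secures \<open>4 * K * R \<le> 1\<close> also
    for large \<open>e\<close>; the smallness assumption puts \<open>2 * (norm x + G)\<close> below
    this cap.\<close>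
  define R where "R = min (2 * (norm x + G) + e) (1 / (4 * K))"
  have "2 * (norm x + G) \<le> 1 / (4 * K)" using small K_pos by (simp add: field_simps)
  then have "norm x + G \<le> R / 2" using \<open>0 < e\<close> by (auto simp: R_def min_def)
  moreover have "4 * K * R \<le> 1"
    using mult_left_mono[of R "1 / (4 * K)" "4 * K"] K_pos by (simp add: R_def)
  moreover have "0 < R"
    using K_pos \<open>0 < e\<close> G_nonneg by (auto simp: R_def intro!: add_nonneg_pos)
  ultimately have "norm (U t) < R" using sol_less[OF sol _ _ _ t] by blast
  then show "norm (U t) \<le> 2 * (norm x + G) + e" by (simp add: R_def)
qed

text \<open>The distance attains a maximum \<open>D\<close> on the compact interval. At that time
  the equation gives \<open>D \<le> norm (x - y) + D / 2\<close>, because the source has Lipschitz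
  constant \<open>2 * K * R \<le> 1 / 2\<close> on the ball. The case \<open>x = y\<close> is
  uniqueness, the general case continuous dependence.\<close>

lemma sol_dist:
  assumes sol: "sol S x U" "sol S y V" and R: "4 * K * R \<le> 1"
    and bd: "\<And>s. s \<in> {0..S} \<Longrightarrow> norm (U s) \<le> R" "\<And>s. s \<in> {0..S} \<Longrightarrow> norm (V s) \<le> R"
    and t: "t \<in> {0..S}"
  shows "norm (U t - V t) \<le> 2 * norm (x - y)"
proof -
  have cont: "continuous_on {0..S} U" "continuous_on {0..S} V"
    and eqU: "\<And>t. t \<in> {0..S} \<Longrightarrow> U t = exp (- t) *\<^sub>R x + duhamel (source U) t"
    and eqV: "\<And>t. t \<in> {0..S} \<Longrightarrow> V t = exp (- t) *\<^sub>R y + duhamel (source V) t"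
    using sol by (auto simp: sol_def)
  have "continuous_on {0..S} (\<lambda>s. norm (U s - V s))"
    by (intro continuous_intros cont)
  then obtain r where r: "r \<in> {0..S}" "\<And>s. s \<in> {0..S} \<Longrightarrow> norm (U s - V s) \<le> norm (U r - V r)"
    using continuous_attains_sup[of "{0..S}" "\<lambda>s. norm (U s - V s)"] t by auto
  define D where "D = norm (U r - V r)"
  have "U r - V r = exp (- r) *\<^sub>R (x - y) + (duhamel (source U) r - duhamel (source V) r)"
    using eqU[OF r(1)] eqV[OF r(1)] by (simp add: algebra_simps)
  also have "duhamel (source U) r - duhamel (source V) r = duhamel (\<lambda>s. source U s - source V s) r"
    by (rule duhamel_diff[OF source_measurable[OF cont(1)] _ source_measurable[OF cont(2)] _ r(1)])
       (rule norm_source[where R = R]; use bd in simp)+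
  finally have eq: "U r - V r = exp (- r) *\<^sub>R (x - y) + duhamel (\<lambda>s. source U s - source V s) r" .
  have "norm (duhamel (\<lambda>s. source U s - source V s) r) \<le> D / 2"
  proof (rule norm_duhamel_le)
    have "continuous_on {0..r} U" "continuous_on {0..r} V"
      using r(1) by (auto intro: continuous_on_subset[OF cont(1)] continuous_on_subset[OF cont(2)])
    then show "(\<lambda>s. source U s - source V s) \<in> borel_measurable (lebesgue_on {0..r})"
      by (intro borel_measurable_diff source_measurable)
    show "norm (source U s - source V s) \<le> D / 2" if "s \<in> {0..r}" for s
    proof -
      have s: "s \<in> {0..S}" using that r(1) by auto
      have "norm (source U s - source V s) \<le> 2 * K * R * norm (U s - V s)"
        by (intro norm_source_diff bd s)
      also have "\<dots> \<le> 1 / 2 * D"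
        unfolding D_def using R r(2)[OF s] by (intro mult_mono) auto
      finally show ?thesis by simp
    qed
  qed (use r in auto)
  moreover have "norm (exp (- r) *\<^sub>R (x - y)) \<le> norm (x - y)"
    using r(1) by (simp add: mult_left_le_one_le)
  ultimately have "norm (exp (- r) *\<^sub>R (x - y) + duhamel (\<lambda>s. source U s - source V s) r)
      \<le> norm (x - y) + D / 2"
    by (intro norm_triangle_le add_mono)
  then have "D \<le> norm (x - y) + D / 2" using eq by (simp add: D_def)
  then show ?thesis using r(2)[OF t] by (simp add: D_def)
qed

text \<open>Banach's fixed point theorem on the closed ball of radius
  \<open>2 * (norm x + G)\<close> in the bounded continuous functions. The map has contraction
  constant 1/2 whatever the value of \<open>S\<close>.\<close>

lemma sol_exists:
  assumes "0 \<le> S" and small: "8 * K * (norm x + G) < 1"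
  shows "\<exists>U. sol S x U"
proof -
  define R where "R = 2 * (norm x + G)"
  \<comment> \<open>Clamping time to \<open>{0..S}\<close> turns the problem into one for bounded
    continuous functions on the whole line, whose type is a complete space. On \<open>{0..S}\<close>
    itself \<open>c\<close> is the identity, so a fixed point solves the original equation
    there.\<close>
  define c where "c t = max 0 (min S t)" for t
  have c: "c t \<in> {0..S}" "t \<in> {0..S} \<Longrightarrow> c t = t" for t
    using \<open>0 \<le> S\<close> by (auto simp: c_def)
  have c_cont: "continuous_on UNIV c" unfolding c_def by (intro continuous_intros)
  define \<Phi> where "\<Phi> U t = exp (- c t) *\<^sub>R x + duhamel (source U) (c t)" for U t
  define X :: "(real \<Rightarrow>\<^sub>C 'a) set" where "X = PiC UNIV (\<lambda>_. cball 0 R)"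
  have X: "norm (apply_bcontfun U s) \<le> R" if "U \<in> X" for U s
    using that by (auto simp: X_def mem_PiC_iff)
  have R0: "0 \<le> R" using G_nonneg by (simp add: R_def)
  have R4: "4 * K * R < 1" using small by (simp add: R_def algebra_simps)
  have Ucont: "continuous_on A (apply_bcontfun U)" for A and U :: "real \<Rightarrow>\<^sub>C 'a"
    by simp
  have \<Phi>_bound: "norm (\<Phi> U t) \<le> R" if "U \<in> X" for U t
  proof -
    have "norm (\<Phi> U t) \<le> norm x + G + K * R\<^sup>2"
      unfolding \<Phi>_def using c(1)[of t] by (intro step_bound Ucont X that) auto
    also have "\<dots> \<le> R / 2 + R / 4"
    proof (rule add_mono)
      have "(K * R) * R \<le> (1 / 4) * R" using R0 R4 by (intro mult_right_mono) auto
      then show "K * R\<^sup>2 \<le> R / 4" by (simp add: power2_eq_square)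
    qed (simp add: R_def)
    finally show ?thesis using R0 by simp
  qed
  have \<Phi>_cont: "continuous_on UNIV (\<Phi> U)" if "U \<in> X" for U
  proof -
    have "continuous_on {0..S} (duhamel (source U))"
      by (rule continuous_on_duhamel[OF source_measurable[OF Ucont] norm_source])
         (use X[OF that] in auto)
    then have "continuous_on UNIV (\<lambda>t. duhamel (source U) (c t))"
      by (rule continuous_on_compose2[OF _ c_cont]) (use c in auto)
    then show ?thesis unfolding \<Phi>_def by (intro continuous_intros c_cont)
  qed
  define P where "P U = Bcontfun (\<Phi> U)" for U :: "real \<Rightarrow>\<^sub>C 'a"
  have P: "apply_bcontfun (P U) = \<Phi> U" if "U \<in> X" for U
    unfolding P_def using \<Phi>_cont[OF that] \<Phi>_bound[OF that]
    by (intro Bcontfun_inverse bcontfun_normI)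
  have "\<exists>!U\<in>X. P U = U"
  proof (rule Banach_fix[of _ "1/2"])
    show "complete X"
      unfolding X_def complete_eq_closed by (rule closed_PiC) auto
    show "X \<noteq> {}"
      using R0 by (auto simp: X_def mem_PiC_iff ex_in_conv[symmetric] simp del: ex_in_conv
          intro!: exI[of _ "const_bcontfun 0"])
    show "P ` X \<subseteq> X"
      using P \<Phi>_bound by (auto simp: X_def mem_PiC_iff)
    show "dist (P U) (P V) \<le> 1 / 2 * dist U V" if "U \<in> X" "V \<in> X" for U V
    proof (rule dist_bound)
      fix t
      have "dist (apply_bcontfun (P U) t) (apply_bcontfun (P V) t)
          = norm (duhamel (source U) (c t) - duhamel (source V) (c t))"
        using that by (simp add: P \<Phi>_def dist_norm)
      also have "\<dots> = norm (duhamel (\<lambda>s. source U s - source V s) (c t))"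
        by (subst duhamel_diff[OF source_measurable[OF Ucont] norm_source
              source_measurable[OF Ucont] norm_source c(1)]) (use X that in auto)
      also have "\<dots> \<le> 1 / 2 * dist U V"
      proof (rule norm_duhamel_le)
        show "(\<lambda>s. source U s - source V s) \<in> borel_measurable (lebesgue_on {0..c t})"
          by (intro borel_measurable_diff source_measurable Ucont)
        fix s
        have "norm (source U s - source V s) \<le> 2 * K * R * norm (U s - V s)"
          by (intro norm_source_diff X that)
        also have "\<dots> \<le> 1 / 2 * dist U V"
          using R4 dist_bounded[of U s V] by (intro mult_mono) (auto simp: dist_norm)
        finally show "norm (source U s - source V s) \<le> 1 / 2 * dist U V" .
      qed (use c(1)[of t] in auto)
      finally show "dist (apply_bcontfun (P U) t) (apply_bcontfun (P V) t) \<le> 1 / 2 * dist U V" .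
    qed
  qed auto
  then obtain U where U: "U \<in> X" "P U = U" by blast
  have "U t = \<Phi> U t" for t using P[OF U(1)] U(2) by simp
  then have "sol S x U"
    unfolding sol_def using c(2) Ucont[of "{0..S}" U] by (simp add: \<Phi>_def)
  then show ?thesis by blast
qed

end

section \<open>Operators on square integrable functions\<close>

lemma square_integrable_AE_cong:
  assumes "square_integrable f" "AE x in lborel. f x = g x" "g \<in> borel_measurable lborel"
  shows "square_integrable g"
  by (rule square_integrable_bound[where w = "\<lambda>x. (norm (f x))\<^sup>2"])
     (use assms in \<open>auto simp: square_integrable_def elim: eventually_mono\<close>)

lemma abs_L2_eqI:
  assumes "square_integrable f" "AE x in lborel. rep_L2 u x = f x"
  shows "u = abs_L2 f"
  using assms abs_L2_eq_iff[of "rep_L2 u" f] by simp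

lemma L2_eqI: "(AE x in lborel. rep_L2 u x = rep_L2 v x) \<Longrightarrow> u = v"
  using abs_L2_eqI[of "rep_L2 v" u] by simp

lemma rep_L2_add: "AE x in lborel. rep_L2 (u + v) x = rep_L2 u x + rep_L2 v x"
proof -
  have "u + v = abs_L2 (\<lambda>x. rep_L2 u x + rep_L2 v x)"
    using abs_L2_add[OF square_integrable_rep square_integrable_rep, of u v]
    unfolding abs_rep_L2 .
  then show ?thesis
    using rep_abs_L2[OF square_integrable_add[OF square_integrable_rep square_integrable_rep]]
    by (elim ssubst)
qed

lemma rep_L2_scaleR: "AE x in lborel. rep_L2 (c *\<^sub>R u) x = c *\<^sub>R rep_L2 u x"
proof -
  have "c *\<^sub>R u = abs_L2 (\<lambda>x. c *\<^sub>R rep_L2 u x)"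
    using abs_L2_scaleR[OF square_integrable_rep, of c u] unfolding abs_rep_L2 .
  then show ?thesis
    using rep_abs_L2[OF square_integrable_scaleR[OF square_integrable_rep]] by (elim ssubst)
qed

lemma inner_L2_eq: "u \<bullet> v = (LINT x|lborel. rep_L2 u x \<bullet> rep_L2 v x)"
  using inner_L2.abs_eq[of "rep_L2 u" "rep_L2 v"] by simp

lemma inner_abs_L2:
  assumes "square_integrable f" "square_integrable g"
  shows "abs_L2 f \<bullet> abs_L2 g = (LINT x|lborel. f x \<bullet> g x)"
  using assms by (simp add: inner_L2.abs_eq)

lemma norm_L2_power2: "(norm u)\<^sup>2 = (LINT x|lborel. (norm (rep_L2 u x))\<^sup>2)"
  by (simp add: norm_L2_eq)

lemma norm_abs_L2_power2:
  "square_integrable f \<Longrightarrow> (norm (abs_L2 f))\<^sup>2 = (LINT x|lborel. (norm (f x))\<^sup>2)"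
  by (simp add: norm_abs_L2)

section \<open>Operators acting pointwise\<close>

definition pw_L2 :: "(real \<Rightarrow> 'a \<Rightarrow> 'b) \<Rightarrow> 'a::euclidean_space L2 \<Rightarrow> 'b::euclidean_space L2" where
  "pw_L2 A u = abs_L2 (\<lambda>x. A x (rep_L2 u x))"

text \<open>Joint measurability makes \<open>A x (f x)\<close> measurable for each measurable
  \<open>f\<close>. Linearity is over the reals, so that \<open>Re\<close>, \<open>Im\<close> and
  \<open>cnj\<close> are included.\<close>

definition pw_op :: "real \<Rightarrow> (real \<Rightarrow> 'a::euclidean_space \<Rightarrow> 'b::euclidean_space) \<Rightarrow> bool" where
  "pw_op C A \<longleftrightarrow> case_prod A \<in> borel_measurable (borel \<Otimes>\<^sub>M borel) \<and>
     (\<forall>x. linear (A x)) \<and> (\<forall>x v. norm (A x v) \<le> C * norm v)"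

context
  fixes A :: "real \<Rightarrow> 'a::euclidean_space \<Rightarrow> 'b::euclidean_space" and C
  assumes A: "pw_op C A"
begin

lemma pw_L2_measurable:
  "f \<in> borel_measurable lborel \<Longrightarrow> (\<lambda>x. A x (f x)) \<in> borel_measurable lborel"
proof -
  assume [measurable]: "f \<in> borel_measurable lborel"
  have [measurable]: "case_prod A \<in> borel_measurable (borel \<Otimes>\<^sub>M borel)"
    using A by (simp add: pw_op_def)
  have "(\<lambda>x. case_prod A (x, f x)) \<in> borel_measurable lborel" by measurable
  then show ?thesis by simp
qed

lemma square_integrable_pw_L2:
  assumes "square_integrable f"
  shows "square_integrable (\<lambda>x. A x (f x))"
proof (rule square_integrable_bound)
  show "integrable lborel (\<lambda>x. C\<^sup>2 * (norm (f x))\<^sup>2)"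
    using assms by (simp add: square_integrable_def)
  have "(norm (A x (f x)))\<^sup>2 \<le> (C * norm (f x))\<^sup>2" for x
    using A by (intro power_mono) (auto simp: pw_op_def)
  then show "AE x in lborel. (norm (A x (f x)))\<^sup>2 \<le> C\<^sup>2 * (norm (f x))\<^sup>2"
    by (simp add: power_mult_distrib)
qed (use assms pw_L2_measurable[of f] in \<open>simp add: square_integrable_def\<close>)

lemma rep_pw_L2: "AE x in lborel. rep_L2 (pw_L2 A u) x = A x (rep_L2 u x)"
  unfolding pw_L2_def by (intro rep_abs_L2 square_integrable_pw_L2) simp

lemma pw_L2_abs:
  assumes "square_integrable f"
  shows "pw_L2 A (abs_L2 f) = abs_L2 (\<lambda>x. A x (f x))"
  unfolding pw_L2_def
  using rep_abs_L2[OF assms]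
  by (subst abs_L2_eq_iff) (auto intro!: square_integrable_pw_L2 assms)

lemma pw_L2_eqI:
  assumes "AE x in lborel. rep_L2 v x = A x (rep_L2 u x)"
  shows "v = pw_L2 A u"
proof (rule L2_eqI)
  show "AE x in lborel. rep_L2 v x = rep_L2 (pw_L2 A u) x"
    using assms rep_pw_L2[of u] by eventually_elim simp
qed

lemma norm_pw_L2: "0 \<le> C \<Longrightarrow> norm (pw_L2 A u) \<le> C * norm u"
proof -
  assume C: "0 \<le> C"
  have "(norm (pw_L2 A u))\<^sup>2 = (LINT x|lborel. (norm (A x (rep_L2 u x)))\<^sup>2)"
    unfolding pw_L2_def by (intro norm_abs_L2_power2 square_integrable_pw_L2) simp
  also have "\<dots> \<le> (LINT x|lborel. C\<^sup>2 * (norm (rep_L2 u x))\<^sup>2)"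
  proof (rule integral_mono)
    show "integrable lborel (\<lambda>x. (norm (A x (rep_L2 u x)))\<^sup>2)"
      using square_integrable_pw_L2[OF square_integrable_rep, of u]
      by (simp add: square_integrable_def)
    show "integrable lborel (\<lambda>x. C\<^sup>2 * (norm (rep_L2 u x))\<^sup>2)"
      using square_integrable_rep[of u] by (simp add: square_integrable_def)
    have "(norm (A x (rep_L2 u x)))\<^sup>2 \<le> (C * norm (rep_L2 u x))\<^sup>2" for x
      using A by (intro power_mono) (auto simp: pw_op_def)
    then show "(norm (A x (rep_L2 u x)))\<^sup>2 \<le> C\<^sup>2 * (norm (rep_L2 u x))\<^sup>2" for x
      by (simp add: power_mult_distrib)
  qed
  also have "\<dots> = (C * norm u)\<^sup>2"
    by (simp add: norm_L2_power2 power_mult_distrib)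
  finally show ?thesis
    using C by (intro power2_le_imp_le[of "norm (pw_L2 A u)"]) auto
qed

lemma pw_L2_add: "pw_L2 A (u + v) = pw_L2 A u + pw_L2 A v"
proof (rule L2_eqI)
  have lin: "linear (A x)" for x using A by (simp add: pw_op_def)
  show "AE x in lborel. rep_L2 (pw_L2 A (u + v)) x = rep_L2 (pw_L2 A u + pw_L2 A v) x"
    using rep_pw_L2[of "u + v"] rep_pw_L2[of u] rep_pw_L2[of v] rep_L2_add[of u v]
      rep_L2_add[of "pw_L2 A u" "pw_L2 A v"]
    by eventually_elim (simp add: linear_add[OF lin])
qed

lemma pw_L2_scaleR: "pw_L2 A (c *\<^sub>R u) = c *\<^sub>R pw_L2 A u"
proof (rule L2_eqI)
  have lin: "linear (A x)" for x using A by (simp add: pw_op_def)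
  show "AE x in lborel. rep_L2 (pw_L2 A (c *\<^sub>R u)) x = rep_L2 (c *\<^sub>R pw_L2 A u) x"
    using rep_pw_L2[of "c *\<^sub>R u"] rep_pw_L2[of u] rep_L2_scaleR[of c u]
      rep_L2_scaleR[of c "pw_L2 A u"]
    by eventually_elim (simp add: linear_scale[OF lin])
qed

lemma bounded_linear_pw_L2: "0 \<le> C \<Longrightarrow> bounded_linear (pw_L2 A)"
  by (rule bounded_linear_intro[of _ C])
     (simp_all add: pw_L2_add pw_L2_scaleR norm_pw_L2 mult.commute)

end

section \<open>Translations and reflections\<close>

definition affine_L2 :: "real \<Rightarrow> real \<Rightarrow> 'a::euclidean_space L2 \<Rightarrow> 'a L2" where
  "affine_L2 c z u = abs_L2 (\<lambda>x. rep_L2 u (z + c * x))"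

context
  fixes c :: real
  assumes c: "\<bar>c\<bar> = 1"
begin

lemma nonzero_if_abs_eq_1: "c \<noteq> 0" using c by auto

lemma integral_affine:
  fixes f :: "real \<Rightarrow> 'b::{banach,second_countable_topology}"
  shows "(LINT x|lborel. f (z + c * x)) = (LINT x|lborel. f x)"
  using lborel_integral_real_affine[OF nonzero_if_abs_eq_1, of f z] c by simp

lemma square_integrable_affine:
  assumes "square_integrable f"
  shows "square_integrable (\<lambda>x. f (z + c * x))"
  unfolding square_integrable_def
proof
  have [measurable]: "f \<in> borel_measurable lborel" using assms by (simp add: square_integrable_def)
  show "(\<lambda>x. f (z + c * x)) \<in> borel_measurable lborel" by measurable
  show "integrable lborel (\<lambda>x. (norm (f (z + c * x)))\<^sup>2)"
    using assms lborel_integrable_real_affine[OF _ nonzero_if_abs_eq_1, of "\<lambda>x. (norm (f x))\<^sup>2"]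
    by (simp add: square_integrable_def)
qed

lemma AE_affine:
  assumes "AE x in lborel. P x" and [measurable]: "Measurable.pred borel P"
  shows "AE x in lborel. P (z + c * x)"
  using AE_borel_affine[OF nonzero_if_abs_eq_1 _ assms(1)] by simp

lemma affine_L2_abs:
  assumes "square_integrable f"
  shows "affine_L2 c z (abs_L2 f) = abs_L2 (\<lambda>x. f (z + c * x))"
proof -
  have [measurable]: "f \<in> borel_measurable lborel" using assms by (simp add: square_integrable_def)
  have "AE x in lborel. rep_L2 (abs_L2 f) (z + c * x) = f (z + c * x)"
    by (rule AE_affine[OF rep_abs_L2[OF assms]]) measurable
  then show ?thesis
    unfolding affine_L2_def
    by (subst abs_L2_eq_iff) (auto intro!: square_integrable_affine assms)
qed

lemma rep_affine_L2: "AE x in lborel. rep_L2 (affine_L2 c z u) x = rep_L2 u (z + c * x)"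
  unfolding affine_L2_def by (intro rep_abs_L2 square_integrable_affine) simp

lemma inner_affine_L2: "affine_L2 c z u \<bullet> affine_L2 c z v = u \<bullet> v"
proof -
  have "affine_L2 c z u \<bullet> affine_L2 c z v
      = (LINT x|lborel. rep_L2 u (z + c * x) \<bullet> rep_L2 v (z + c * x))"
    unfolding affine_L2_def by (intro inner_abs_L2 square_integrable_affine) simp_all
  also have "\<dots> = u \<bullet> v"
    unfolding inner_L2_eq by (rule integral_affine)
  finally show ?thesis .
qed

lemma norm_affine_L2: "norm (affine_L2 c z u) = norm u"
  by (simp add: norm_eq_sqrt_inner inner_affine_L2)

lemma affine_L2_add: "affine_L2 c z (u + v) = affine_L2 c z u + affine_L2 c z v"
proof (rule L2_eqI)
  have "AE x in lborel. rep_L2 (u + v) (z + c * x) = rep_L2 u (z + c * x) + rep_L2 v (z + c * x)"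
    by (rule AE_affine[OF rep_L2_add]) measurable
  then show "AE x in lborel. rep_L2 (affine_L2 c z (u + v)) x
      = rep_L2 (affine_L2 c z u + affine_L2 c z v) x"
    using rep_affine_L2[of z "u + v"] rep_affine_L2[of z u] rep_affine_L2[of z v]
      rep_L2_add[of "affine_L2 c z u" "affine_L2 c z v"]
    by eventually_elim simp
qed

lemma affine_L2_scaleR: "affine_L2 c z (k *\<^sub>R u) = k *\<^sub>R affine_L2 c z u"
proof (rule L2_eqI)
  have "AE x in lborel. rep_L2 (k *\<^sub>R u) (z + c * x) = k *\<^sub>R rep_L2 u (z + c * x)"
    by (rule AE_affine[OF rep_L2_scaleR]) measurable
  then show "AE x in lborel. rep_L2 (affine_L2 c z (k *\<^sub>R u)) x
      = rep_L2 (k *\<^sub>R affine_L2 c z u) x"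
    using rep_affine_L2[of z "k *\<^sub>R u"] rep_affine_L2[of z u]
      rep_L2_scaleR[of k "affine_L2 c z u"]
    by eventually_elim simp
qed

lemma bounded_linear_affine_L2: "bounded_linear (affine_L2 c z)"
  by (rule bounded_linear_intro[of _ 1])
     (simp_all add: affine_L2_add affine_L2_scaleR norm_affine_L2)

lemma affine_L2_pw_L2:
  assumes A: "pw_op C A" and inv: "\<And>x. A (z + c * x) = A x"
  shows "affine_L2 c z (pw_L2 A u) = pw_L2 A (affine_L2 c z u)"
proof (rule L2_eqI)
  \<comment> \<open>Measurability lets the almost everywhere description of \<open>pw_L2 A u\<close>
    be composed with the affine map.\<close>
  have [measurable]: "(\<lambda>x. A x (rep_L2 u x)) \<in> borel_measurable borel"
    using pw_L2_measurable[OF A rep_L2_measurable[of u]] by simp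
  have "AE x in lborel. rep_L2 (pw_L2 A u) (z + c * x) = A (z + c * x) (rep_L2 u (z + c * x))"
    by (rule AE_affine[OF rep_pw_L2[OF A]]) measurable
  then show "AE x in lborel. rep_L2 (affine_L2 c z (pw_L2 A u)) x
      = rep_L2 (pw_L2 A (affine_L2 c z u)) x"
    using rep_affine_L2[of z "pw_L2 A u"] rep_affine_L2[of z u] rep_pw_L2[OF A, of "affine_L2 c z u"]
    by eventually_elim (simp add: inv)
qed

end

text \<open>The interval and its translate differ only within distance \<open>\<bar>z\<bar>\<close>
  of the two end points, a set of measure at most \<open>4 * \<bar>z\<bar>\<close>.\<close>

lemma tendsto_translation_indicator:
  fixes b :: "'a::euclidean_space"
  assumes "p \<le> q"
  shows "((\<lambda>z. affine_L2 1 z (abs_L2 (\<lambda>x. indicat_real {p..q} x *\<^sub>R b)))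
            \<longlongrightarrow> abs_L2 (\<lambda>x. indicat_real {p..q} x *\<^sub>R b)) (at 0)"
    (is "(?T \<longlongrightarrow> ?u) _")
proof -
  let ?f = "\<lambda>x. indicat_real {p..q} x *\<^sub>R b"
  have sq: "square_integrable ?f"
  proof (rule square_integrable_bound)
    show "integrable lborel (\<lambda>x. indicat_real {p..q} x *\<^sub>R (norm b)\<^sup>2)"
      using assms by (intro integrable_scaleR_left) simp
  qed (auto simp: indicator_def)
  have sqz: "square_integrable (\<lambda>x. ?f (z + 1 * x))" for z
    by (rule square_integrable_affine[OF _ sq]) simp
  have "(norm (?T z - ?u))\<^sup>2 \<le> 4 * \<bar>z\<bar> * (norm b)\<^sup>2" for z
  proof -
    let ?w = "\<lambda>x. (indicat_real {p - \<bar>z\<bar>..p + \<bar>z\<bar>} x + indicat_real {q - \<bar>z\<bar>..q + \<bar>z\<bar>} x) * (norm b)\<^sup>2"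
    have "?T z - ?u = abs_L2 (\<lambda>x. ?f (z + 1 * x) - ?f x)"
      by (subst affine_L2_abs[OF _ sq]) (simp_all only: abs_L2_diff sq sqz abs_one)
    then have "(norm (?T z - ?u))\<^sup>2 = (LINT x|lborel. (norm (?f (z + 1 * x) - ?f x))\<^sup>2)"
      using norm_abs_L2_power2[OF square_integrable_diff[OF sqz sq], of z] by (simp only:)
    also have "\<dots> \<le> (LINT x|lborel. ?w x)"
    proof (rule integral_mono)
      show "integrable lborel (\<lambda>x. (norm (?f (z + 1 * x) - ?f x))\<^sup>2)"
        using square_integrable_diff[OF sqz sq, of z] by (simp add: square_integrable_def)
      show "integrable lborel ?w" by simp
      show "(norm (?f (z + 1 * x) - ?f x))\<^sup>2 \<le> ?w x" for x
        by (auto simp: indicator_def)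
    qed
    also have "\<dots> = 4 * \<bar>z\<bar> * (norm b)\<^sup>2" by simp
    finally show ?thesis .
  qed
  then have le: "norm (?T z - ?u) \<le> sqrt (4 * \<bar>z\<bar> * (norm b)\<^sup>2)" for z
    by (rule real_le_rsqrt)
  have "((\<lambda>z. sqrt (4 * \<bar>z\<bar> * (norm b)\<^sup>2)) \<longlongrightarrow> sqrt (4 * \<bar>0\<bar> * (norm b)\<^sup>2)) (at 0)"
    by (intro tendsto_intros)
  then have "((\<lambda>z. sqrt (4 * \<bar>z\<bar> * (norm b)\<^sup>2)) \<longlongrightarrow> 0) (at 0)" by simp
  then have "((\<lambda>z. ?T z - ?u) \<longlongrightarrow> 0) (at 0)"
    by (rule Lim_null_comparison[rotated]) (use le in simp)
  then show ?thesis by (rule LIM_zero_cancel)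
qed

text \<open>Translations are isometries, so the functions with this property form a closed subspace.
  It contains the indicators of bounded intervals, and these suffice for
  \<open>L2_closed_subspace_eq_UNIV\<close>.\<close>

lemma tendsto_translation:
  fixes u :: "'a::euclidean_space L2"
  shows "((\<lambda>z. affine_L2 1 z u) \<longlongrightarrow> u) (at 0)"
proof -
  \<comment> \<open>The half-lines \<open>{..a}\<close> generate the Borel sets and are stable under
    intersection; their traces on \<open>{- real n..real n}\<close> are again closed intervals,
    possibly empty.\<close>
  let ?G = "range (atMost :: real \<Rightarrow> real set)"
  define V where "V = {u :: 'a L2. ((\<lambda>z. affine_L2 1 z u) \<longlongrightarrow> u) (at 0)}"
  have "V = UNIV"
  proof (rule L2_closed_subspace_eq_UNIV)
    show "closed V"
      unfolding closed_sequential_limits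
    proof (intro allI impI, elim conjE)
      fix X and v :: "'a L2"
      assume X: "\<forall>n. X n \<in> V" "X \<longlonglongrightarrow> v"
      have "((\<lambda>z. affine_L2 1 z v) \<longlongrightarrow> v) (at 0)"
      proof (rule tendstoI)
        fix e :: real assume "0 < e"
        then obtain n where n: "norm (X n - v) < e / 3"
          using X(2) unfolding LIMSEQ_iff by (meson zero_less_divide_iff zero_less_numeral le_refl)
        have "\<forall>\<^sub>F z in at 0. dist (affine_L2 1 z (X n)) (X n) < e / 3"
          using X(1) \<open>0 < e\<close> by (intro tendstoD) (auto simp: V_def)
        then show "\<forall>\<^sub>F z in at 0. dist (affine_L2 1 z v) v < e"
        proof eventually_elim
          case (elim z)
          have "affine_L2 1 z (X n - v) = affine_L2 1 z (X n) - affine_L2 1 z v"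
            by (rule linear_diff[OF bounded_linear.linear[OF bounded_linear_affine_L2]]) simp
          \<comment> \<open>Of the three terms only the middle one depends on a limit in
            \<open>z\<close>; the last is bounded by \<open>norm (X n - v)\<close> uniformly in
            \<open>z\<close>.\<close>
          then have eq: "affine_L2 1 z v - v
              = (X n - v) + (affine_L2 1 z (X n) - X n) - affine_L2 1 z (X n - v)"
            by simp
          have "norm (affine_L2 1 z v - v)
              \<le> norm (X n - v) + norm (affine_L2 1 z (X n) - X n) + norm (affine_L2 1 z (X n - v))"
            unfolding eq by (intro norm_triangle_le_diff add_right_mono norm_triangle_ineq)
          then show ?case using n elim by (simp add: dist_norm norm_affine_L2)
        qed
      qed
      then show "v \<in> V" by (simp add: V_def)
    qed
    have lin: "linear (affine_L2 1 z :: 'a L2 \<Rightarrow> 'a L2)" for z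
      by (rule bounded_linear.linear[OF bounded_linear_affine_L2]) simp
    show "0 \<in> V" by (simp add: V_def linear_0[OF lin])
    show "u + v \<in> V" if "u \<in> V" "v \<in> V" for u v
      using that by (auto simp: V_def linear_add[OF lin] intro: tendsto_add)
    show "k *\<^sub>R u \<in> V" if "u \<in> V" for k u
      using that by (auto simp: V_def linear_scale[OF lin] intro: tendsto_scaleR)
    show "Int_stable ?G"
      by (auto simp: Int_stable_def)
    show "sets borel = sigma_sets UNIV ?G"
      unfolding borel_eq_atMost by (rule sets_measure_of) simp
    show "abs_L2 (\<lambda>x. indicat_real (A \<inter> {- real n..real n}) x *\<^sub>R b) \<in> V"
      if A: "A \<in> insert UNIV ?G" for A n and b :: 'a
    proof -
      have "\<exists>p q. A \<inter> {- real n..real n} = {p..q}"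
      proof (cases "A = UNIV")
        case False
        then obtain a where "A = {..a}" using A by blast
        then have "A \<inter> {- real n..real n} = {- real n..min a (real n)}" by auto
        then show ?thesis by blast
      qed auto
      then obtain p q where pq: "A \<inter> {- real n..real n} = {p..q}" by blast
      show ?thesis
      proof (cases "p \<le> q")
        case True
        then show ?thesis using tendsto_translation_indicator[of p q b] by (simp add: V_def pq)
      qed (simp add: pq V_def linear_0[OF lin] abs_L2_zero)
    qed
  qed
  then show ?thesis by (auto simp: V_def)
qed

section \<open>Plancherel identity\<close>

lemma gaussian_fourier_std:
  "(LINT x|lborel. std_normal_density x *\<^sub>R cis (t * x)) = complex_of_real (exp (- t\<^sup>2 / 2))"
proof -
  have "complex_of_real (exp (- t\<^sup>2 / 2)) = char std_normal_distribution t"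
    by (simp add: char_std_normal_distribution)
  also have "\<dots> = (LINT x|lborel. std_normal_density x *\<^sub>R cis (t * x))"
    unfolding char_def cis_conv_exp by (subst integral_density) auto
  finally show ?thesis by simp
qed

text \<open>The substitution \<open>x = s * \<xi>\<close> reduces this to the characteristic
  function of the standard normal law at \<open>z / s\<close>. The right-hand side is
  \<open>2 * pi\<close> times the density of the centred normal law with standard deviation
  \<open>s\<close>, an approximate identity as \<open>s\<close> tends to 0.\<close>

lemma gaussian_fourier:
  assumes "0 < s"
  shows "(LINT \<xi>|lborel. complex_of_real (exp (- (s * \<xi>)\<^sup>2 / 2)) * cis (z * \<xi>))
    = complex_of_real (2 * pi * (std_normal_density (z / s) / s))"
proof -
  have "(LINT \<xi>|lborel. complex_of_real (exp (- (s * \<xi>)\<^sup>2 / 2)) * cis (z * \<xi>))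
      = (LINT \<xi>|lborel. sqrt (2 * pi) *\<^sub>R (std_normal_density (0 + s * \<xi>) *\<^sub>R cis ((z / s) * (0 + s * \<xi>))))"
    using assms by (intro Bochner_Integration.integral_cong)
      (auto simp: std_normal_density_def scaleR_conv_of_real)
  also have "\<dots> = sqrt (2 * pi) *\<^sub>R (LINT \<xi>|lborel. std_normal_density (0 + s * \<xi>) *\<^sub>R cis ((z / s) * (0 + s * \<xi>)))"
    by (rule integral_scaleR_right)
  also have "(LINT \<xi>|lborel. std_normal_density (0 + s * \<xi>) *\<^sub>R cis ((z / s) * (0 + s * \<xi>)))
      = (LINT x|lborel. std_normal_density x *\<^sub>R cis ((z / s) * x)) /\<^sub>R s"
    using lborel_integral_real_affine[of s "\<lambda>x. std_normal_density x *\<^sub>R cis ((z / s) * x)" 0] assms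
    by simp
  also have "\<dots> = complex_of_real (exp (- (z / s)\<^sup>2 / 2)) /\<^sub>R s"
    by (simp only: gaussian_fourier_std)
  finally have "(LINT \<xi>|lborel. complex_of_real (exp (- (s * \<xi>)\<^sup>2 / 2)) * cis (z * \<xi>))
      = complex_of_real (sqrt (2 * pi) * (inverse s * exp (- (z / s)\<^sup>2 / 2)))"
    by (simp only: scaleR_conv_of_real of_real_mult)
  also have "sqrt (2 * pi) * (inverse s * exp (- (z / s)\<^sup>2 / 2))
      = 2 * pi * (std_normal_density (z / s) / s)"
  proof -
    have "2 * pi * (std_normal_density (z / s) / s)
        = (2 * pi / sqrt (2 * pi)) * (inverse s * exp (- (z / s)\<^sup>2 / 2))"
      by (simp only: std_normal_density_def divide_inverse mult_1_left mult_ac)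
    also have "2 * pi / sqrt (2 * pi) = sqrt (2 * pi)" by (rule real_div_sqrt) simp
    finally show ?thesis by (rule sym)
  qed
  finally show ?thesis .
qed

section \<open>Fubini's theorem and bounds for the Fourier integral\<close>

lemma integrable_mult_bounded:
  fixes a c :: "real \<Rightarrow> complex"
  assumes "integrable lborel a" "c \<in> borel_measurable lborel" "\<And>x. cmod (c x) \<le> C"
  shows "integrable lborel (\<lambda>x. a x * c x)"
proof (rule Bochner_Integration.integrable_bound)
  show "integrable lborel (\<lambda>x. C * cmod (a x))" using assms by simp
  show "(\<lambda>x. a x * c x) \<in> borel_measurable lborel" using assms by measurable
  show "AE x in lborel. cmod (a x * c x) \<le> norm (C * cmod (a x))"
  proof (rule AE_I2)
    fix x
    have "cmod (a x * c x) \<le> cmod (a x) * C"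
      unfolding norm_mult by (intro mult_left_mono assms) simp
    then show "cmod (a x * c x) \<le> norm (C * cmod (a x))" by (simp add: mult.commute)
  qed
qed

text \<open>The integrand is dominated by \<open>C\<close> times a product of two integrable
  functions of one variable each, so Fubini's theorem applies. The kernels used later are multiples
  of complex exponentials.\<close>

lemma swap_integrals:
  fixes a b :: "real \<Rightarrow> complex"
  assumes a: "integrable lborel a" and b: "integrable lborel b"
    and [measurable]: "case_prod c \<in> borel_measurable (borel \<Otimes>\<^sub>M borel)"
    and c: "\<And>x y. cmod (c x y) \<le> C"
  shows "(LINT x|lborel. a x * (LINT y|lborel. b y * c x y))
    = (LINT y|lborel. b y * (LINT x|lborel. a x * c x y))"
proof -
  have [measurable]: "a \<in> borel_measurable borel" "b \<in> borel_measurable borel"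
    using a b by auto
  have cx: "c x \<in> borel_measurable lborel" for x
  proof -
    have "(\<lambda>y. case_prod c (x, y)) \<in> borel_measurable lborel" by measurable
    then show ?thesis by simp
  qed
  have "integrable (lborel \<Otimes>\<^sub>M lborel) (\<lambda>(x, y). a x * (b y * c x y))"
  proof (rule lborel_pair.Fubini_integrable)
    show "integrable lborel (\<lambda>x. LINT y|lborel. norm (case (x, y) of (x, y) \<Rightarrow> a x * (b y * c x y)))"
    proof (rule Bochner_Integration.integrable_bound)
      show "integrable lborel (\<lambda>x. cmod (a x) * (LINT y|lborel. cmod (b y) * C))"
        using a by simp
      show "AE x in lborel. norm (LINT y|lborel. norm (case (x, y) of (x, y) \<Rightarrow> a x * (b y * c x y)))
          \<le> norm (cmod (a x) * (LINT y|lborel. cmod (b y) * C))"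
      proof (rule AE_I2)
        fix x
        have "(LINT y|lborel. cmod (b y * c x y)) \<le> (LINT y|lborel. cmod (b y) * C)"
        proof (rule integral_mono)
          show "integrable lborel (\<lambda>y. cmod (b y * c x y))"
            by (intro integrable_norm integrable_mult_bounded[OF b cx c])
          show "cmod (b y * c x y) \<le> cmod (b y) * C" for y
            unfolding norm_mult by (intro mult_left_mono c) simp
        qed (use b in simp)
        then have "cmod (a x) * (LINT y|lborel. cmod (b y * c x y))
            \<le> cmod (a x) * (LINT y|lborel. cmod (b y) * C)"
          by (rule mult_left_mono) simp
        moreover have "(LINT y|lborel. cmod (a x * (b y * c x y)))
            = cmod (a x) * (LINT y|lborel. cmod (b y * c x y))"
          by (subst norm_mult) simp
        moreover have "0 \<le> (LINT y|lborel. cmod (b y * c x y))"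
          by (rule integral_nonneg_AE) simp
        ultimately show "norm (LINT y|lborel. norm (case (x, y) of (x, y) \<Rightarrow> a x * (b y * c x y)))
          \<le> norm (cmod (a x) * (LINT y|lborel. cmod (b y) * C))"
          by simp
      qed
    qed measurable
    show "AE x in lborel. integrable lborel (\<lambda>y. case (x, y) of (x, y) \<Rightarrow> a x * (b y * c x y))"
      by (auto intro!: integrable_mult_bounded[OF b cx c])
  qed measurable
  from lborel_pair.Fubini_integral[OF this]
  have "(LINT x|lborel. LINT y|lborel. a x * (b y * c x y))
      = (LINT y|lborel. LINT x|lborel. b y * (a x * c x y))"
    by (simp add: mult.left_commute)
  then show ?thesis by simp
qed

text \<open>If \<open>g\<close> is not measurable, neither is the integrand, because multiplying by
  the conjugate exponential would recover \<open>g\<close>. The integral then takes its default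
  value 0 at every \<open>\<xi>\<close>, and the transform is constant.\<close>

lemma fourier_integral_measurable [measurable]:
  "fourier_integral g \<in> borel_measurable borel"
proof (cases "g \<in> borel_measurable lborel")
  case True
  then have [measurable]: "g \<in> borel_measurable borel" by simp
  have [measurable]: "cis \<in> borel_measurable borel"
    by (intro borel_measurable_continuous_onI continuous_intros)
  show ?thesis unfolding fourier_integral_def by measurable
next
  case False
  have "fourier_integral g \<xi> = 0" for \<xi>
  proof -
    have "\<not> integrable lborel (\<lambda>x. g x *\<^sub>R cis (- (x * \<xi>)))"
    proof
      assume *: "integrable lborel (\<lambda>x. g x *\<^sub>R cis (- (x * \<xi>)))"
      have [measurable]: "cis \<in> borel_measurable borel"
        by (intro borel_measurable_continuous_onI continuous_intros)
      have [measurable]: "(\<lambda>x. g x *\<^sub>R cis (- (x * \<xi>))) \<in> borel_measurable lborel"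
        using * by auto
      have "(\<lambda>x. Re ((g x *\<^sub>R cis (- (x * \<xi>))) * cis (x * \<xi>))) \<in> borel_measurable lborel"
        by measurable
      then have "g \<in> borel_measurable lborel"
        by (simp add: cis_mult mult.assoc)
      then show False using False by simp
    qed
    then show ?thesis by (simp add: fourier_integral_def not_integrable_integral_eq)
  qed
  then have "fourier_integral g = (\<lambda>_. 0)" by auto
  then show ?thesis by simp
qed

lemma norm_fourier_integral_le:
  "cmod (fourier_integral g \<xi>) \<le> (LINT x|lborel. \<bar>g x\<bar>) / sqrt (2 * pi)"
proof -
  have "cmod (LINT x|lborel. g x *\<^sub>R cis (- (x * \<xi>))) \<le> (LINT x|lborel. \<bar>g x\<bar>)"
    using integral_norm_bound[of lborel "\<lambda>x. g x *\<^sub>R cis (- (x * \<xi>))"] by simp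
  then show ?thesis
    by (simp add: fourier_integral_def divide_simps)
qed

lemma cnj_fourier_integral: "cnj (fourier_integral g \<xi>) = fourier_integral g (- \<xi>)"
proof -
  have "cnj (fourier_integral g \<xi>) = (LINT x|lborel. cnj (g x *\<^sub>R cis (- (x * \<xi>)))) /\<^sub>R sqrt (2 * pi)"
    unfolding fourier_integral_def by (simp only: complex_cnj_scaleR Bochner_Integration.integral_cnj[symmetric])
  then show ?thesis by (simp add: fourier_integral_def cis_cnj)
qed

section \<open>Gaussian regularisation of the squared transform\<close>

text \<open>Concerns the autocorrelation of \<open>g\<close>. By Cauchy-Schwarz and translation
  invariance it is bounded by the squared norm of \<open>g\<close>, uniformly in the shift, so a
  Gaussian weight makes the double integral finite.\<close>

lemma integrable_smear:
  assumes g: "square_integrable (g :: real \<Rightarrow> real)"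
  shows "integrable (lborel \<Otimes>\<^sub>M lborel) (\<lambda>(t, y). std_normal_density t * (g y * g (y + s * t)))"
    and "integrable lborel (\<lambda>y. g y * g (y + z))"
    and "(LINT y|lborel. g y * g (y + z)) = abs_L2 g \<bullet> affine_L2 1 z (abs_L2 g)"
    and "(\<lambda>t. LINT y|lborel. g y * g (y + s * t)) \<in> borel_measurable lborel"
proof -
  have [measurable]: "g \<in> borel_measurable borel" using g by (simp add: square_integrable_def)
  have sq: "square_integrable (\<lambda>x. g (x + z))" for z
    using square_integrable_affine[OF _ g, of 1 z] by (simp add: add.commute)
  show int: "integrable lborel (\<lambda>y. g y * g (y + z))" for z
    using square_integrable_inner[OF g sq, of z] by simp
  have eq: "(LINT y|lborel. k y * k (y + z)) = abs_L2 k \<bullet> affine_L2 1 z (abs_L2 k)"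
    if k: "square_integrable k" for z :: real and k :: "real \<Rightarrow> real"
  proof -
    have "abs_L2 k \<bullet> affine_L2 1 z (abs_L2 k) = abs_L2 k \<bullet> abs_L2 (\<lambda>x. k (z + 1 * x))"
      by (subst affine_L2_abs[OF abs_one k]) (rule refl)
    also have "\<dots> = (LINT y|lborel. k y \<bullet> k (z + 1 * y))"
      by (rule inner_abs_L2[OF k square_integrable_affine[OF abs_one k]])
    finally show ?thesis by (simp add: add.commute)
  qed
  show "(LINT y|lborel. g y * g (y + z)) = abs_L2 g \<bullet> affine_L2 1 z (abs_L2 g)"
    by (rule eq[OF g])
  show "(\<lambda>t. LINT y|lborel. g y * g (y + s * t)) \<in> borel_measurable lborel"
    by measurable
  show "integrable (lborel \<Otimes>\<^sub>M lborel) (\<lambda>(t, y). std_normal_density t * (g y * g (y + s * t)))"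
  proof (rule lborel_pair.Fubini_integrable)
    let ?N = "(norm (abs_L2 (\<lambda>x. \<bar>g x\<bar>)))\<^sup>2"
    have sqa: "square_integrable (\<lambda>x. \<bar>g x\<bar>)" using g by (simp add: square_integrable_def)
    have le: "\<bar>LINT y|lborel. \<bar>g y\<bar> * \<bar>g (y + z)\<bar>\<bar> \<le> ?N" for z
      unfolding eq[OF sqa]
      by (rule order_trans[OF Cauchy_Schwarz_ineq2]) (simp add: norm_affine_L2 power2_eq_square)
    show "integrable lborel (\<lambda>t. LINT y|lborel. norm (case (t, y) of (t, y) \<Rightarrow>
        std_normal_density t * (g y * g (y + s * t))))"
    proof (rule Bochner_Integration.integrable_bound)
      show "integrable lborel (\<lambda>t. std_normal_density t * ?N)" by simp
      show "AE t in lborel. norm (LINT y|lborel. norm (case (t, y) of (t, y) \<Rightarrow>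
          std_normal_density t * (g y * g (y + s * t)))) \<le> norm (std_normal_density t * ?N)"
        using le by (auto simp: abs_mult intro!: mult_left_mono)
    qed measurable
    show "AE t in lborel. integrable lborel (\<lambda>y. case (t, y) of (t, y) \<Rightarrow>
        std_normal_density t * (g y * g (y + s * t)))"
      using int by auto
  qed measurable
qed

text \<open>The squared modulus is the transform times its conjugate. Writing the conjugate as an
  integral and exchanging the order of integration moves the Gaussian factor to the space side,
  where it averages the autocorrelation of \<open>g\<close> over shifts of scale
  \<open>s\<close>.\<close>

lemma fourier_integral_gaussian:
  assumes g1: "integrable lborel g" and g2: "square_integrable g" and s: "0 < s"
  shows "integrable lborel (\<lambda>\<xi>. exp (- (s * \<xi>)\<^sup>2 / 2) * (cmod (fourier_integral g \<xi>))\<^sup>2)"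
    and "(LINT \<xi>|lborel. exp (- (s * \<xi>)\<^sup>2 / 2) * (cmod (fourier_integral g \<xi>))\<^sup>2)
      = (LINT t|lborel. std_normal_density t * (abs_L2 g \<bullet> affine_L2 1 (s * t) (abs_L2 g)))"
proof -
  let ?E = "\<lambda>\<xi>. complex_of_real (exp (- (s * \<xi>)\<^sup>2 / 2))"
  let ?c = "complex_of_real (1 / sqrt (2 * pi))"
  let ?G = "\<lambda>x. complex_of_real (g x)"
  have [measurable]: "g \<in> borel_measurable borel" using g1 by auto
  have [measurable]: "cis \<in> borel_measurable borel"
    by (intro borel_measurable_continuous_onI continuous_intros)
  have G: "integrable lborel ?G" using g1 by simp
  have cc: "cmod (?c * cis z) \<le> cmod ?c" for z by (simp only: norm_mult norm_cis mult_1_right)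
  have Ereal: "integrable lborel (\<lambda>\<xi>. exp (- (s * \<xi>)\<^sup>2 / 2))"
  proof -
    have "integrable lborel (\<lambda>\<xi>. std_normal_density (0 + s * \<xi>))"
      using s by (intro lborel_integrable_real_affine) auto
    then have "integrable lborel (\<lambda>\<xi>. sqrt (2 * pi) * std_normal_density (0 + s * \<xi>))"
      by (rule integrable_mult_right)
    then show ?thesis by (simp add: std_normal_density_def)
  qed
  then have E: "integrable lborel ?E" by (rule integrable_of_real)
  define M where "M = (LINT x|lborel. \<bar>g x\<bar>) / sqrt (2 * pi)"
  have M: "cmod (fourier_integral g \<xi>) \<le> M" for \<xi>
    unfolding M_def by (rule norm_fourier_integral_le)
  have EF: "integrable lborel (\<lambda>\<xi>. ?E \<xi> * fourier_integral g \<xi>)"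
    by (rule integrable_mult_bounded[OF E _ M]) measurable
  have fi: "fourier_integral g \<xi> = (LINT x|lborel. ?G x * (?c * cis (- (x * \<xi>))))" for \<xi>
  proof -
    have "fourier_integral g \<xi> = ?c * (LINT x|lborel. ?G x * cis (- (x * \<xi>)))"
      by (simp add: fourier_integral_def scaleR_conv_of_real inverse_eq_divide)
    also have "\<dots> = (LINT x|lborel. ?c * (?G x * cis (- (x * \<xi>))))" by simp
    finally show ?thesis by (simp add: mult.left_commute)
  qed
  \<comment> \<open>A damped inversion formula: transforming the Gaussian times
    \<open>fourier_integral g\<close> back gives the average of \<open>g\<close> around
    \<open>y\<close> at scale \<open>s\<close>.\<close>
  have smear: "(LINT \<xi>|lborel. (?E \<xi> * fourier_integral g \<xi>) * (?c * cis (y * \<xi>)))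
      = complex_of_real (LINT t|lborel. std_normal_density t * g (y + s * t))" for y
  proof -
    have "(LINT \<xi>|lborel. (?E \<xi> * fourier_integral g \<xi>) * (?c * cis (y * \<xi>)))
        = (LINT \<xi>|lborel. (?E \<xi> * (?c * cis (y * \<xi>))) * (LINT x|lborel. ?G x * (?c * cis (- (x * \<xi>)))))"
      by (rule Bochner_Integration.integral_cong[OF refl]) (unfold fi[symmetric], simp only: mult_ac)
    also have "\<dots> = (LINT x|lborel. ?G x * (LINT \<xi>|lborel. (?E \<xi> * (?c * cis (y * \<xi>))) * (?c * cis (- (x * \<xi>)))))"
    proof (rule swap_integrals[OF _ G, where C = "cmod ?c"
          and a = "\<lambda>\<xi>. ?E \<xi> * (?c * cis (y * \<xi>))" and c = "\<lambda>\<xi> x. ?c * cis (- (x * \<xi>))"])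
      show "integrable lborel (\<lambda>\<xi>. ?E \<xi> * (?c * cis (y * \<xi>)))"
        by (rule integrable_mult_bounded[OF E, where C = "cmod ?c"]) (measurable, rule cc)
      show "cmod (?c * cis (- (x * \<xi>))) \<le> cmod ?c" for x \<xi> by (rule cc)
    qed measurable
    also have "\<dots> = (LINT x|lborel. complex_of_real (g x * (std_normal_density ((x - y) / s) / s)))"
    proof (rule Bochner_Integration.integral_cong[OF refl])
      fix x
      have cis: "cis ((y - x) * \<xi>) = cis (y * \<xi>) * cis (- (x * \<xi>))" for \<xi>
        by (simp add: cis_mult left_diff_distrib)
      have "(LINT \<xi>|lborel. (?E \<xi> * (?c * cis (y * \<xi>))) * (?c * cis (- (x * \<xi>))))
          = (LINT \<xi>|lborel. (?c * ?c) * (?E \<xi> * cis ((y - x) * \<xi>)))"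
        by (intro Bochner_Integration.integral_cong refl) (unfold cis, simp only: mult_ac)
      also have "\<dots> = (?c * ?c) * (LINT \<xi>|lborel. ?E \<xi> * cis ((y - x) * \<xi>))"
        by (rule integral_mult_right_zero)
      also have "\<dots> = (?c * ?c) * complex_of_real (2 * pi * (std_normal_density ((y - x) / s) / s))"
        by (simp only: gaussian_fourier[OF s])
      also have "\<dots> = complex_of_real (std_normal_density ((x - y) / s) / s)"
      proof -
        have "?c * ?c = complex_of_real (1 / (2 * pi))"
          by (simp flip: of_real_mult)
        moreover have "std_normal_density ((y - x) / s) = std_normal_density ((x - y) / s)"
          by (simp add: std_normal_density_def power_divide power2_commute)
        ultimately show ?thesis by (simp only: of_real_mult[symmetric]) simp
      qed
      finally show "?G x * (LINT \<xi>|lborel. (?E \<xi> * (?c * cis (y * \<xi>))) * (?c * cis (- (x * \<xi>))))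
          = complex_of_real (g x * (std_normal_density ((x - y) / s) / s))" by simp
    qed
    also have "\<dots> = complex_of_real (LINT x|lborel. g x * (std_normal_density ((x - y) / s) / s))"
      by (rule integral_complex_of_real)
    also have "(LINT x|lborel. g x * (std_normal_density ((x - y) / s) / s))
        = (LINT t|lborel. std_normal_density t * g (y + s * t))"
      using lborel_integral_real_affine[of s "\<lambda>x. g x * (std_normal_density ((x - y) / s) / s)" y] s
      by (simp add: mult.commute)
    finally show ?thesis .
  qed
  show "integrable lborel (\<lambda>\<xi>. exp (- (s * \<xi>)\<^sup>2 / 2) * (cmod (fourier_integral g \<xi>))\<^sup>2)"
  proof (rule Bochner_Integration.integrable_bound)
    show "integrable lborel (\<lambda>\<xi>. exp (- (s * \<xi>)\<^sup>2 / 2) * M\<^sup>2)" using Ereal by simp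
    show "AE \<xi> in lborel. norm (exp (- (s * \<xi>)\<^sup>2 / 2) * (cmod (fourier_integral g \<xi>))\<^sup>2)
        \<le> norm (exp (- (s * \<xi>)\<^sup>2 / 2) * M\<^sup>2)"
      using M by (auto intro!: mult_left_mono power_mono)
  qed measurable
  have "complex_of_real (LINT \<xi>|lborel. exp (- (s * \<xi>)\<^sup>2 / 2) * (cmod (fourier_integral g \<xi>))\<^sup>2)
      = (LINT \<xi>|lborel. (?E \<xi> * fourier_integral g \<xi>) * (LINT y|lborel. ?G y * (?c * cis (y * \<xi>))))"
  proof -
    \<comment> \<open>The opposite sign in the exponent is conjugation, since \<open>g\<close> is
      real.\<close>
    have "(LINT y|lborel. ?G y * (?c * cis (y * \<xi>))) = cnj (fourier_integral g \<xi>)" for \<xi>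
      using cnj_fourier_integral[of g \<xi>] fi[of "- \<xi>"] by (simp only: mult_minus_right minus_minus)
    then show ?thesis
      by (simp only: mult.assoc complex_norm_square[symmetric])
         (simp only: of_real_mult[symmetric] integral_complex_of_real)
  qed
  also have "\<dots> = (LINT y|lborel. ?G y * (LINT \<xi>|lborel. (?E \<xi> * fourier_integral g \<xi>) * (?c * cis (y * \<xi>))))"
    by (rule swap_integrals[OF EF G, where C = "cmod ?c" and c = "\<lambda>\<xi> y. ?c * cis (y * \<xi>)"])
       (measurable, rule cc)
  also have "\<dots> = complex_of_real (LINT y|lborel. g y * (LINT t|lborel. std_normal_density t * g (y + s * t)))"
    by (simp only: smear of_real_mult[symmetric] integral_complex_of_real)
  also have "(LINT y|lborel. g y * (LINT t|lborel. std_normal_density t * g (y + s * t)))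
      = (LINT y|lborel. LINT t|lborel. std_normal_density t * (g y * g (y + s * t)))"
    by (rule Bochner_Integration.integral_cong[OF refl],
        subst integral_mult_right_zero[symmetric], simp only: mult.left_commute)
  also have "\<dots> = (LINT t|lborel. LINT y|lborel. std_normal_density t * (g y * g (y + s * t)))"
    by (rule lborel_pair.Fubini_integral[OF integrable_smear(1)[OF g2]])
  also have "\<dots> = (LINT t|lborel. std_normal_density t * (abs_L2 g \<bullet> affine_L2 1 (s * t) (abs_L2 g)))"
    by (simp only: integral_mult_right_zero integrable_smear(3)[OF g2])
  finally show "(LINT \<xi>|lborel. exp (- (s * \<xi>)\<^sup>2 / 2) * (cmod (fourier_integral g \<xi>))\<^sup>2)
      = (LINT t|lborel. std_normal_density t * (abs_L2 g \<bullet> affine_L2 1 (s * t) (abs_L2 g)))"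
    by (simp only: of_real_eq_iff)
qed

text \<open>Let \<open>s\<close> tend to 0 in the Gaussian identity. The right-hand side converges
  by dominated convergence, as the autocorrelation is continuous at 0. On the left the integrands
  increase to the squared transform, so monotone convergence gives its integrability and its
  integral together.\<close>

lemma plancherel_integrable:
  assumes g1: "integrable lborel g" and g2: "square_integrable g"
  shows "square_integrable (fourier_integral g)"
    and "norm (abs_L2 (fourier_integral g)) = norm (abs_L2 g)"
proof -
  define s where "s n = 1 / real (Suc n)" for n
  have s: "0 < s n" for n by (simp add: s_def)
  have s0: "s \<longlonglongrightarrow> 0" unfolding s_def by (rule LIMSEQ_Suc[OF lim_1_over_n])
  let ?h = "\<lambda>z. abs_L2 g \<bullet> affine_L2 1 z (abs_L2 g)"
  let ?f = "\<lambda>n \<xi>. exp (- (s n * \<xi>)\<^sup>2 / 2) * (cmod (fourier_integral g \<xi>))\<^sup>2"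
  have h0: "?h 0 = (norm (abs_L2 g))\<^sup>2"
    by (simp add: affine_L2_abs[OF _ g2] power2_norm_eq_inner)
  have hcont: "isCont ?h 0"
    unfolding isCont_def h0 power2_norm_eq_inner by (intro tendsto_intros tendsto_translation)
  have "(\<lambda>n. LINT t|lborel. std_normal_density t * ?h (s n * t))
      \<longlonglongrightarrow> (LINT t|lborel. std_normal_density t * (norm (abs_L2 g))\<^sup>2)"
  proof (rule integral_dominated_convergence)
    show "integrable lborel (\<lambda>t. std_normal_density t * (norm (abs_L2 g))\<^sup>2)" by simp
    show "(\<lambda>t. std_normal_density t * ?h (s n * t)) \<in> borel_measurable lborel" for n
      using integrable_smear(4)[OF g2, of "s n"] unfolding integrable_smear(3)[OF g2] by measurable
    show "AE t in lborel. (\<lambda>n. std_normal_density t * ?h (s n * t))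
        \<longlonglongrightarrow> std_normal_density t * (norm (abs_L2 g))\<^sup>2"
    proof (rule AE_I2)
      fix t
      have "(\<lambda>n. s n * t) \<longlonglongrightarrow> 0 * t" by (intro tendsto_intros s0)
      then have "(\<lambda>n. ?h (s n * t)) \<longlonglongrightarrow> ?h 0"
        using isCont_tendsto_compose[OF hcont] by simp
      then show "(\<lambda>n. std_normal_density t * ?h (s n * t))
          \<longlonglongrightarrow> std_normal_density t * (norm (abs_L2 g))\<^sup>2"
        unfolding h0 by (intro tendsto_intros)
    qed
    show "AE t in lborel. norm (std_normal_density t * ?h (s n * t))
        \<le> std_normal_density t * (norm (abs_L2 g))\<^sup>2" for n
    proof (rule AE_I2)
      fix t
      have "\<bar>?h (s n * t)\<bar> \<le> (norm (abs_L2 g))\<^sup>2"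
        using Cauchy_Schwarz_ineq2[of "abs_L2 g" "affine_L2 1 (s n * t) (abs_L2 g)"]
        by (simp add: norm_affine_L2 power2_eq_square)
      then show "norm (std_normal_density t * ?h (s n * t)) \<le> std_normal_density t * (norm (abs_L2 g))\<^sup>2"
        by (simp add: abs_mult mult_left_mono)
    qed
  qed measurable
  then have lim: "(\<lambda>n. integral\<^sup>L lborel (?f n)) \<longlonglongrightarrow> (norm (abs_L2 g))\<^sup>2"
    unfolding fourier_integral_gaussian(2)[OF g1 g2 s] by simp
  have mono: "mono (\<lambda>n. ?f n \<xi>)" for \<xi>
  proof (rule monoI)
    fix m n :: nat assume "m \<le> n"
    then have "s n \<le> s m" by (simp add: s_def frac_le)
    then have "(s n)\<^sup>2 \<le> (s m)\<^sup>2" using s[of n] by (intro power_mono) auto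
    then have "(s n * \<xi>)\<^sup>2 \<le> (s m * \<xi>)\<^sup>2"
      unfolding power_mult_distrib by (rule mult_right_mono) simp
    then show "?f m \<xi> \<le> ?f n \<xi>" by (intro mult_right_mono) auto
  qed
  have ptw: "(\<lambda>n. ?f n \<xi>) \<longlonglongrightarrow> (cmod (fourier_integral g \<xi>))\<^sup>2" for \<xi>
  proof -
    have "(\<lambda>n. ?f n \<xi>) \<longlonglongrightarrow> exp (- (0 * \<xi>)\<^sup>2 / 2) * (cmod (fourier_integral g \<xi>))\<^sup>2"
      by (intro tendsto_intros s0) simp
    then show ?thesis by simp
  qed
  note conv = integral_monotone_convergence_nonneg[OF fourier_integral_gaussian(1)[OF g1 g2 s] _ _ _ lim,
      of "\<lambda>\<xi>. (cmod (fourier_integral g \<xi>))\<^sup>2"]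
  show sq: "square_integrable (fourier_integral g)"
    unfolding square_integrable_def using conv(1) mono ptw by simp
  have "(norm (abs_L2 (fourier_integral g)))\<^sup>2 = (norm (abs_L2 g))\<^sup>2"
    using norm_abs_L2_power2[OF sq] conv(2) mono ptw by simp
  then show "norm (abs_L2 (fourier_integral g)) = norm (abs_L2 g)" by simp
qed

section \<open>Unitarity and inversion of the Fourier transform\<close>

definition L12 :: "(real \<Rightarrow> real) \<Rightarrow> bool" where
  "L12 g \<longleftrightarrow> integrable lborel g \<and> square_integrable g"

lemma L12_add: "L12 f \<Longrightarrow> L12 g \<Longrightarrow> L12 (\<lambda>x. f x + g x)"
  by (simp add: L12_def square_integrable_add)

lemma L12_scale: "L12 f \<Longrightarrow> L12 (\<lambda>x. c * f x)"
  using square_integrable_scaleR[of f c] by (simp add: L12_def)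

lemma integrable_fourier_integrand:
  assumes "integrable lborel g"
  shows "integrable lborel (\<lambda>x. g x *\<^sub>R cis (- (x * \<xi>)))"
proof -
  have [measurable]: "cis \<in> borel_measurable borel"
    by (intro borel_measurable_continuous_onI continuous_intros)
  have "integrable lborel (\<lambda>x. complex_of_real (g x) * cis (- (x * \<xi>)))"
    using assms by (intro integrable_mult_bounded[where C = 1]) auto
  then show ?thesis by (simp add: scaleR_conv_of_real)
qed

lemma fourier_integral_add:
  assumes "integrable lborel f" "integrable lborel g"
  shows "fourier_integral (\<lambda>x. f x + g x) \<xi> = fourier_integral f \<xi> + fourier_integral g \<xi>"
  unfolding fourier_integral_def scaleR_add_left
  using assms by (simp add: integrable_fourier_integrand scaleR_add_right)

lemma fourier_integral_scale:
  "fourier_integral (\<lambda>x. c * f x) \<xi> = c *\<^sub>R fourier_integral f \<xi>"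
proof -
  have "(LINT x|lborel. (c * f x) *\<^sub>R cis (- (x * \<xi>))) = (LINT x|lborel. c *\<^sub>R (f x *\<^sub>R cis (- (x * \<xi>))))"
    by simp
  also have "\<dots> = c *\<^sub>R (LINT x|lborel. f x *\<^sub>R cis (- (x * \<xi>)))"
    by (rule integral_scaleR_right)
  finally show ?thesis by (simp add: fourier_integral_def)
qed

lemma fourier_integral_cong_AE:
  assumes "AE x in lborel. f x = g x"
    and [measurable]: "f \<in> borel_measurable borel" "g \<in> borel_measurable borel"
  shows "fourier_integral f \<xi> = fourier_integral g \<xi>"
proof -
  have [measurable]: "cis \<in> borel_measurable borel"
    by (intro borel_measurable_continuous_onI continuous_intros)
  have "(LINT x|lborel. f x *\<^sub>R cis (- (x * \<xi>))) = (LINT x|lborel. g x *\<^sub>R cis (- (x * \<xi>)))"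
    using assms(1) by (intro integral_cong_AE) auto
  then show ?thesis by (simp add: fourier_integral_def)
qed

lemma square_integrable_fourier_integral: "L12 g \<Longrightarrow> square_integrable (fourier_integral g)"
  by (simp add: L12_def plancherel_integrable)

lemma norm_fourier_integral_diff:
  assumes f: "L12 f" and g: "L12 g"
  shows "norm (abs_L2 (fourier_integral f) - abs_L2 (fourier_integral g)) = norm (abs_L2 f - abs_L2 g)"
proof -
  \<comment> \<open>The difference is written as a sum with factor \<open>- 1\<close> so that the
    closure rules of \<open>L12\<close> apply.\<close>
  let ?d = "\<lambda>x. f x + (-1) * g x"
  have d: "L12 ?d" by (intro L12_add L12_scale f g)
  have "fourier_integral ?d = (\<lambda>\<xi>. fourier_integral f \<xi> - fourier_integral g \<xi>)"
  proof
    fix \<xi>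
    have "fourier_integral ?d \<xi> = fourier_integral f \<xi> + fourier_integral (\<lambda>x. (-1) * g x) \<xi>"
      using f L12_scale[OF g, of "-1"] by (intro fourier_integral_add) (simp_all add: L12_def)
    then show "fourier_integral ?d \<xi> = fourier_integral f \<xi> - fourier_integral g \<xi>"
      unfolding fourier_integral_scale by simp
  qed
  then have "abs_L2 (fourier_integral f) - abs_L2 (fourier_integral g) = abs_L2 (fourier_integral ?d)"
    by (simp add: abs_L2_diff square_integrable_fourier_integral f g)
  moreover have "abs_L2 f - abs_L2 g = abs_L2 ?d"
    using f g by (simp add: abs_L2_diff L12_def)
  ultimately show ?thesis
    using plancherel_integrable(2) d by (simp add: L12_def)
qed

section \<open>Extension of the transform to all square integrable functions\<close>

definition cutoff :: "nat \<Rightarrow> real L2 \<Rightarrow> real \<Rightarrow> real" where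
  "cutoff n u x = indicator {-real n..real n} x * rep_L2 u x"

lemma cutoff_measurable [measurable]: "cutoff n u \<in> borel_measurable borel"
  unfolding cutoff_def using rep_L2_measurable[of u] by measurable

lemma L12_cutoff: "L12 (cutoff n u)"
proof -
  have int: "integrable lborel (\<lambda>x. (rep_L2 u x)\<^sup>2)"
    using square_integrable_rep[of u] by (simp add: square_integrable_def)
  have "integrable lborel (cutoff n u)"
  proof (rule Bochner_Integration.integrable_bound)
    show "integrable lborel (\<lambda>x. indicat_real {-real n..real n} x + (rep_L2 u x)\<^sup>2)"
      using int by simp
    have "\<bar>cutoff n u x\<bar> \<le> indicat_real {-real n..real n} x + (rep_L2 u x)\<^sup>2" for x
    proof -
      have "2 * \<bar>rep_L2 u x\<bar> \<le> 1 + (rep_L2 u x)\<^sup>2"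
        using sum_squares_bound[of 1 "\<bar>rep_L2 u x\<bar>"] by simp
      moreover have "0 \<le> \<bar>rep_L2 u x\<bar>" "0 \<le> (rep_L2 u x)\<^sup>2" by auto
      ultimately show ?thesis unfolding cutoff_def indicator_def by auto
    qed
    then show "AE x in lborel. norm (cutoff n u x)
        \<le> norm (indicat_real {-real n..real n} x + (rep_L2 u x)\<^sup>2)"
      by (auto intro: order_trans[OF _ abs_ge_self])
  qed measurable
  moreover have "square_integrable (cutoff n u)"
    using int by (intro square_integrable_bound[where w = "\<lambda>x. (rep_L2 u x)\<^sup>2"])
      (auto simp: cutoff_def indicator_def)
  ultimately show ?thesis by (simp add: L12_def)
qed

lemma cutoff_tendsto: "(\<lambda>n. abs_L2 (cutoff n u)) \<longlonglongrightarrow> u"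
proof -
  have "(\<lambda>n. abs_L2 (cutoff n u)) \<longlonglongrightarrow> abs_L2 (rep_L2 u)"
  proof (rule L2_dominated_convergence[OF _ square_integrable_rep square_integrable_rep[of u]])
    show "square_integrable (cutoff n u)" for n using L12_cutoff by (simp add: L12_def)
    show "norm (cutoff n u x) \<le> norm (rep_L2 u x)" for n x by (simp add: cutoff_def indicator_def)
    have "(\<lambda>n. cutoff n u x) \<longlonglongrightarrow> rep_L2 u x" for x
    proof (rule tendsto_eventually)
      show "\<forall>\<^sub>F n in sequentially. cutoff n u x = rep_L2 u x"
        using eventually_ge_at_top[of "nat \<lceil>\<bar>x\<bar>\<rceil>"]
      proof eventually_elim
        case (elim n)
        then have "\<bar>x\<bar> \<le> real n" by linarith
        then show ?case by (auto simp: cutoff_def indicator_def)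
      qed
    qed
    then show "AE x in lborel. (\<lambda>n. cutoff n u x) \<longlonglongrightarrow> rep_L2 u x" by simp
  qed
  then show ?thesis by simp
qed

text \<open>The truncations converge in mean square, hence form a Cauchy sequence, and by Plancherel
  so do their transforms. Completeness then shows that \<open>lim\<close> in the definition of
  \<open>fourier_L2\<close> is a genuine limit.\<close>

lemma fourier_L2_cutoff: "(\<lambda>n. abs_L2 (fourier_integral (cutoff n u))) \<longlonglongrightarrow> fourier_L2 u"
proof -
  have "Cauchy (\<lambda>n. abs_L2 (fourier_integral (cutoff n u)))"
    using LIMSEQ_imp_Cauchy[OF cutoff_tendsto[of u]]
    unfolding Cauchy_def dist_norm norm_fourier_integral_diff[OF L12_cutoff L12_cutoff] .
  then have "convergent (\<lambda>n. abs_L2 (fourier_integral (cutoff n u)))"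
    by (rule Cauchy_convergent)
  moreover have "fourier_L2 u = lim (\<lambda>n. abs_L2 (fourier_integral (cutoff n u)))"
    unfolding fourier_L2_def cutoff_def ..
  ultimately show ?thesis by (simp add: convergent_LIMSEQ_iff)
qed

text \<open>The truncations may be replaced by any other approximating sequence: the transforms of
  two sequences with the same limit differ by a null sequence. Through this lemma identities for
  Fourier integrals pass to \<open>fourier_L2\<close>.\<close>

lemma fourier_L2_limit:
  assumes "\<And>n. L12 (g n)" "(\<lambda>n. abs_L2 (g n)) \<longlonglongrightarrow> u"
  shows "(\<lambda>n. abs_L2 (fourier_integral (g n))) \<longlonglongrightarrow> fourier_L2 u"
proof -
  have "(\<lambda>n. norm (abs_L2 (g n) - abs_L2 (cutoff n u))) \<longlonglongrightarrow> norm (u - u)"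
    by (intro tendsto_intros assms cutoff_tendsto)
  then have "(\<lambda>n. norm (abs_L2 (fourier_integral (g n)) - abs_L2 (fourier_integral (cutoff n u)))) \<longlonglongrightarrow> 0"
    by (simp add: norm_fourier_integral_diff assms L12_cutoff)
  from tendsto_add[OF tendsto_norm_zero_cancel[OF this] fourier_L2_cutoff[of u]]
  show ?thesis by simp
qed

lemma norm_fourier_L2: "norm (fourier_L2 u) = norm u"
proof (rule LIMSEQ_unique)
  show "(\<lambda>n. norm (abs_L2 (fourier_integral (cutoff n u)))) \<longlonglongrightarrow> norm (fourier_L2 u)"
    by (intro tendsto_intros fourier_L2_cutoff)
  show "(\<lambda>n. norm (abs_L2 (fourier_integral (cutoff n u)))) \<longlonglongrightarrow> norm u"
    using plancherel_integrable(2) L12_cutoff tendsto_norm[OF cutoff_tendsto[of u]]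
    by (simp add: L12_def)
qed

lemma fourier_L2_add: "fourier_L2 (u + v) = fourier_L2 u + fourier_L2 v"
proof (rule LIMSEQ_unique)
  let ?g = "\<lambda>n x. cutoff n u x + cutoff n v x"
  have "abs_L2 (?g n) = abs_L2 (cutoff n u) + abs_L2 (cutoff n v)" for n
    using L12_cutoff by (simp add: abs_L2_add L12_def)
  then have "(\<lambda>n. abs_L2 (?g n)) \<longlonglongrightarrow> u + v"
    using tendsto_add[OF cutoff_tendsto[of u] cutoff_tendsto[of v]] by simp
  then show "(\<lambda>n. abs_L2 (fourier_integral (?g n))) \<longlonglongrightarrow> fourier_L2 (u + v)"
    by (intro fourier_L2_limit L12_add L12_cutoff)
  have "abs_L2 (fourier_integral (?g n))
      = abs_L2 (fourier_integral (cutoff n u)) + abs_L2 (fourier_integral (cutoff n v))" for n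
  proof -
    have "fourier_integral (?g n) = (\<lambda>\<xi>. fourier_integral (cutoff n u) \<xi> + fourier_integral (cutoff n v) \<xi>)"
      using L12_cutoff by (intro ext fourier_integral_add) (auto simp: L12_def)
    then show ?thesis
      by (simp add: abs_L2_add square_integrable_fourier_integral L12_cutoff)
  qed
  then show "(\<lambda>n. abs_L2 (fourier_integral (?g n))) \<longlonglongrightarrow> fourier_L2 u + fourier_L2 v"
    using tendsto_add[OF fourier_L2_cutoff[of u] fourier_L2_cutoff[of v]] by simp
qed

lemma fourier_L2_scaleR: "fourier_L2 (c *\<^sub>R u) = c *\<^sub>R fourier_L2 u"
proof (rule LIMSEQ_unique)
  let ?g = "\<lambda>n x. c * cutoff n u x"
  have "abs_L2 (?g n) = c *\<^sub>R abs_L2 (cutoff n u)" for n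
    using L12_cutoff by (simp add: abs_L2_scaleR L12_def)
  then have "(\<lambda>n. abs_L2 (?g n)) \<longlonglongrightarrow> c *\<^sub>R u"
    using tendsto_scaleR[OF tendsto_const cutoff_tendsto[of u]] by simp
  then show "(\<lambda>n. abs_L2 (fourier_integral (?g n))) \<longlonglongrightarrow> fourier_L2 (c *\<^sub>R u)"
    by (intro fourier_L2_limit L12_scale L12_cutoff)
  have "abs_L2 (fourier_integral (?g n)) = c *\<^sub>R abs_L2 (fourier_integral (cutoff n u))" for n
    by (simp add: abs_L2_scaleR square_integrable_fourier_integral L12_cutoff fourier_integral_scale[abs_def])
  then show "(\<lambda>n. abs_L2 (fourier_integral (?g n))) \<longlonglongrightarrow> c *\<^sub>R fourier_L2 u"
    using tendsto_scaleR[OF tendsto_const fourier_L2_cutoff[of u]] by simp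
qed

lemma bounded_linear_fourier_L2: "bounded_linear fourier_L2"
  by (rule bounded_linear_intro[of _ 1])
     (simp_all add: fourier_L2_add fourier_L2_scaleR norm_fourier_L2)

lemmas fourier_L2_diff = linear_diff[OF bounded_linear.linear[OF bounded_linear_fourier_L2]]
lemmas fourier_L2_minus = linear_neg[OF bounded_linear.linear[OF bounded_linear_fourier_L2]]

text \<open>Polarisation of the isometry. On the complex side the inner product is the real part of
  the Hermitian one.\<close>

lemma inner_fourier_L2: "fourier_L2 u \<bullet> fourier_L2 v = u \<bullet> v"
proof -
  have "(norm (fourier_L2 u + fourier_L2 v))\<^sup>2 = (norm (u + v))\<^sup>2"
    by (simp add: norm_fourier_L2 flip: fourier_L2_add)
  then show ?thesis
    unfolding power2_norm_eq_inner inner_add_left inner_add_right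
    using norm_fourier_L2[of u] norm_fourier_L2[of v]
    by (simp add: norm_eq_sqrt_inner inner_commute)
qed

lemma fourier_L2_inj: "fourier_L2 u = fourier_L2 v \<Longrightarrow> u = v"
  using norm_fourier_L2[of "u - v"] by (simp add: fourier_L2_diff)

section \<open>Symmetries, adjoint and range of the transform\<close>

abbreviation "Re_L2 \<equiv> pw_L2 (\<lambda>_. Re)"
abbreviation "Im_L2 \<equiv> pw_L2 (\<lambda>_. Im)"
abbreviation "cnj_L2 \<equiv> pw_L2 (\<lambda>_. cnj)"
abbreviation "reflect_L2 \<equiv> affine_L2 (- 1) 0"

lemma pw_op_Re: "pw_op 1 (\<lambda>_. Re)"
  unfolding pw_op_def by (auto simp: bounded_linear.linear bounded_linear_Re abs_Re_le_cmod)

lemma pw_op_Im: "pw_op 1 (\<lambda>_. Im)"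
  unfolding pw_op_def by (auto simp: bounded_linear.linear bounded_linear_Im abs_Im_le_cmod)

lemma pw_op_cnj: "pw_op 1 (\<lambda>_. cnj)"
proof -
  have "(\<lambda>p. cnj (snd p)) \<in> borel_measurable (borel \<Otimes>\<^sub>M (borel :: complex measure))"
    by (intro measurable_compose[OF measurable_snd] borel_measurable_continuous_onI continuous_intros)
  then show ?thesis
    unfolding pw_op_def by (auto simp: bounded_linear.linear bounded_linear_cnj case_prod_beta')
qed

lemma bounded_linear_Re_L2: "bounded_linear Re_L2"
  by (rule bounded_linear_pw_L2[OF pw_op_Re]) simp

lemma bounded_linear_Im_L2: "bounded_linear Im_L2"
  by (rule bounded_linear_pw_L2[OF pw_op_Im]) simp

lemma bounded_linear_cnj_L2: "bounded_linear cnj_L2"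
  by (rule bounded_linear_pw_L2[OF pw_op_cnj]) simp

lemma bounded_linear_reflect_L2: "bounded_linear reflect_L2"
  by (rule bounded_linear_affine_L2) simp

lemma Re_cnj_L2: "Re_L2 (cnj_L2 u) = Re_L2 u"
proof (rule L2_eqI)
  show "AE x in lborel. rep_L2 (Re_L2 (cnj_L2 u)) x = rep_L2 (Re_L2 u) x"
    using rep_pw_L2[OF pw_op_Re, of "cnj_L2 u"] rep_pw_L2[OF pw_op_Re, of u]
      rep_pw_L2[OF pw_op_cnj, of u]
    by eventually_elim simp
qed

lemma Im_cnj_L2: "Im_L2 (cnj_L2 u) = - Im_L2 u"
proof -
  have "Im_L2 (cnj_L2 u) = (- 1) *\<^sub>R Im_L2 u"
  proof (rule L2_eqI)
    show "AE x in lborel. rep_L2 (Im_L2 (cnj_L2 u)) x = rep_L2 ((- 1) *\<^sub>R Im_L2 u) x"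
      using rep_pw_L2[OF pw_op_Im, of "cnj_L2 u"] rep_pw_L2[OF pw_op_Im, of u]
        rep_pw_L2[OF pw_op_cnj, of u] rep_L2_scaleR[of "- 1" "Im_L2 u"]
      by eventually_elim simp
  qed
  then show ?thesis by simp
qed

lemma inner_complex_L2: "u \<bullet> v = Re_L2 u \<bullet> Re_L2 v + Im_L2 u \<bullet> Im_L2 v"
proof -
  have re: "square_integrable (\<lambda>x. Re (rep_L2 u x))" for u :: "complex L2"
    by (rule square_integrable_pw_L2[OF pw_op_Re]) simp
  have im: "square_integrable (\<lambda>x. Im (rep_L2 u x))" for u :: "complex L2"
    by (rule square_integrable_pw_L2[OF pw_op_Im]) simp
  have "Re_L2 u \<bullet> Re_L2 v + Im_L2 u \<bullet> Im_L2 v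
      = (LINT x|lborel. Re (rep_L2 u x) \<bullet> Re (rep_L2 v x)) + (LINT x|lborel. Im (rep_L2 u x) \<bullet> Im (rep_L2 v x))"
    unfolding pw_L2_def by (simp only: inner_abs_L2 re im)
  also have "\<dots> = (LINT x|lborel. Re (rep_L2 u x) \<bullet> Re (rep_L2 v x) + Im (rep_L2 u x) \<bullet> Im (rep_L2 v x))"
    by (rule Bochner_Integration.integral_add[symmetric]; rule square_integrable_inner) (simp_all add: re im)
  finally show ?thesis by (simp add: inner_L2_eq inner_complex_def)
qed

lemma fourier_integral_reflect:
  assumes g: "L12 g"
  shows "L12 (\<lambda>x. g (0 + - 1 * x))"
    and "fourier_integral (\<lambda>x. g (0 + - 1 * x)) \<xi> = fourier_integral g (- \<xi>)"
proof -
  show "L12 (\<lambda>x. g (0 + - 1 * x))"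
    using g lborel_integrable_real_affine[of g "- 1" 0] square_integrable_affine[of "- 1" g 0]
    by (simp add: L12_def)
  have "(LINT x|lborel. g (0 + - 1 * x) *\<^sub>R cis (- ((0 + - 1 * x) * (- \<xi>))))
      = (LINT x|lborel. g x *\<^sub>R cis (- (x * (- \<xi>))))"
    by (rule integral_affine[where f = "\<lambda>x. g x *\<^sub>R cis (- (x * (- \<xi>)))"]) simp
  then show "fourier_integral (\<lambda>x. g (0 + - 1 * x)) \<xi> = fourier_integral g (- \<xi>)"
    by (simp add: fourier_integral_def)
qed

lemma fourier_reflect: "fourier_L2 (reflect_L2 u) = reflect_L2 (fourier_L2 u)"
proof (rule LIMSEQ_unique)
  let ?g = "\<lambda>n x. cutoff n u (0 + - 1 * x)"
  have "abs_L2 (?g n) = reflect_L2 (abs_L2 (cutoff n u))" for n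
    by (rule affine_L2_abs[symmetric]) (use L12_cutoff in \<open>simp_all add: L12_def\<close>)
  then have "(\<lambda>n. abs_L2 (?g n)) \<longlonglongrightarrow> reflect_L2 u"
    using bounded_linear.tendsto[OF bounded_linear_reflect_L2 cutoff_tendsto[of u]] by (simp only:)
  then show "(\<lambda>n. abs_L2 (fourier_integral (?g n))) \<longlonglongrightarrow> fourier_L2 (reflect_L2 u)"
    by (intro fourier_L2_limit fourier_integral_reflect L12_cutoff)
  have "abs_L2 (fourier_integral (?g n)) = reflect_L2 (abs_L2 (fourier_integral (cutoff n u)))" for n
  proof -
    have "fourier_integral (?g n) = (\<lambda>\<xi>. fourier_integral (cutoff n u) (0 + - 1 * \<xi>))"
      using fourier_integral_reflect(2)[OF L12_cutoff] by (simp add: fun_eq_iff)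
    then show ?thesis
      by (simp only:) (rule affine_L2_abs[symmetric], simp_all add: square_integrable_fourier_integral L12_cutoff)
  qed
  then show "(\<lambda>n. abs_L2 (fourier_integral (?g n))) \<longlonglongrightarrow> reflect_L2 (fourier_L2 u)"
    using bounded_linear.tendsto[OF bounded_linear_reflect_L2 fourier_L2_cutoff[of u]] by (simp only:)
qed

text \<open>Hermitian symmetry of the transforms of real functions, inherited in the limit from the
  Fourier integrals.\<close>

lemma cnj_fourier_L2: "cnj_L2 (fourier_L2 u) = reflect_L2 (fourier_L2 u)"
proof (rule LIMSEQ_unique)
  let ?F = "\<lambda>n. abs_L2 (fourier_integral (cutoff n u))"
  show "(\<lambda>n. cnj_L2 (?F n)) \<longlonglongrightarrow> cnj_L2 (fourier_L2 u)"
    by (rule bounded_linear.tendsto[OF bounded_linear_cnj_L2 fourier_L2_cutoff])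
  have "cnj_L2 (?F n) = reflect_L2 (?F n)" for n
  proof -
    have sq: "square_integrable (fourier_integral (cutoff n u))"
      by (intro square_integrable_fourier_integral L12_cutoff)
    have "reflect_L2 (?F n) = abs_L2 (\<lambda>\<xi>. fourier_integral (cutoff n u) (0 + - 1 * \<xi>))"
      by (rule affine_L2_abs[OF _ sq]) simp
    moreover have "cnj_L2 (?F n) = abs_L2 (\<lambda>\<xi>. cnj (fourier_integral (cutoff n u) \<xi>))"
      by (rule pw_L2_abs[OF pw_op_cnj sq])
    ultimately show ?thesis by (simp add: cnj_fourier_integral)
  qed
  then show "(\<lambda>n. cnj_L2 (?F n)) \<longlonglongrightarrow> reflect_L2 (fourier_L2 u)"
    using bounded_linear.tendsto[OF bounded_linear_reflect_L2 fourier_L2_cutoff[of u]] by simp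
qed

text \<open>The kernel is symmetric in \<open>x\<close> and \<open>\<xi>\<close>, so Fubini's
  theorem exchanges the roles of the two functions.\<close>

lemma fourier_integral_adjoint:
  assumes a: "L12 a" and b: "L12 b"
  shows "(LINT \<xi>|lborel. complex_of_real (b \<xi>) * fourier_integral a \<xi>)
       = (LINT x|lborel. complex_of_real (a x) * fourier_integral b x)"
proof -
  let ?c = "complex_of_real (1 / sqrt (2 * pi))"
  have [measurable]: "cis \<in> borel_measurable borel"
    by (intro borel_measurable_continuous_onI continuous_intros)
  have fi: "fourier_integral g \<xi> = (LINT x|lborel. complex_of_real (g x) * (?c * cis (- (\<xi> * x))))" for g \<xi>
  proof -
    have "fourier_integral g \<xi> = ?c * (LINT x|lborel. complex_of_real (g x) * cis (- (x * \<xi>)))"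
      by (simp add: fourier_integral_def scaleR_conv_of_real inverse_eq_divide)
    also have "\<dots> = (LINT x|lborel. ?c * (complex_of_real (g x) * cis (- (x * \<xi>))))" by simp
    finally show ?thesis by (simp add: mult.left_commute mult.commute)
  qed
  have "(LINT \<xi>|lborel. complex_of_real (b \<xi>) * fourier_integral a \<xi>)
      = (LINT x|lborel. complex_of_real (a x) * (LINT \<xi>|lborel. complex_of_real (b \<xi>) * (?c * cis (- (\<xi> * x)))))"
    unfolding fi
    using a b by (intro swap_integrals[where C = "1 / sqrt (2 * pi)"])
      (auto simp: L12_def norm_mult norm_divide)
  then show ?thesis by (simp add: fi mult.commute)
qed

text \<open>The transform maps real to complex functions, so the symmetry of its kernel appears as
  self-adjointness of its real and imaginary parts. Hence its adjoint sends \<open>M\<close> to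
  \<open>Re_L2 (fourier_L2 (Re_L2 M)) + Im_L2 (fourier_L2 (Im_L2 M))\<close>.\<close>

lemma Re_Im_fourier_adjoint:
  "Re_L2 (fourier_L2 u) \<bullet> v = u \<bullet> Re_L2 (fourier_L2 v)" (is ?re)
  "Im_L2 (fourier_L2 u) \<bullet> v = u \<bullet> Im_L2 (fourier_L2 v)" (is ?im)
proof -
  have eq: "pw_L2 (\<lambda>_. A) (abs_L2 (fourier_integral (cutoff n u))) \<bullet> abs_L2 (cutoff n v)
      = A (LINT \<xi>|lborel. complex_of_real (cutoff n v \<xi>) * fourier_integral (cutoff n u) \<xi>)"
    if A: "pw_op 1 (\<lambda>_. A)" "bounded_linear A" "\<And>r z. A (complex_of_real r * z) = r * A z"
    for A :: "complex \<Rightarrow> real" and n u v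
  proof -
    have sq: "square_integrable (fourier_integral (cutoff n u))"
      by (intro square_integrable_fourier_integral L12_cutoff)
    have "integrable lborel (\<lambda>\<xi>. complex_of_real (cutoff n v \<xi>) * fourier_integral (cutoff n u) \<xi>)"
      using L12_cutoff[of n v]
      by (intro integrable_mult_bounded[OF _ _ norm_fourier_integral_le]) (auto simp: L12_def)
    from integral_bounded_linear[OF A(2) this]
    have "A (LINT \<xi>|lborel. complex_of_real (cutoff n v \<xi>) * fourier_integral (cutoff n u) \<xi>)
       = (LINT \<xi>|lborel. cutoff n v \<xi> * A (fourier_integral (cutoff n u) \<xi>))"
      by (simp add: A(3))
    moreover have "square_integrable (\<lambda>\<xi>. A (fourier_integral (cutoff n u) \<xi>))"
      by (rule square_integrable_pw_L2[OF A(1) sq])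
    ultimately show ?thesis
      using L12_cutoff[of n v]
      by (simp add: pw_L2_abs[OF A(1) sq] inner_abs_L2 L12_def mult.commute)
  qed
  have lim: "(\<lambda>n. pw_L2 (\<lambda>_. A) (abs_L2 (fourier_integral (cutoff n u))) \<bullet> abs_L2 (cutoff n v))
      \<longlonglongrightarrow> pw_L2 (\<lambda>_. A) (fourier_L2 u) \<bullet> v"
    if A: "pw_op 1 (\<lambda>_. A)" for A :: "complex \<Rightarrow> real" and u v
    by (intro tendsto_inner cutoff_tendsto bounded_linear.tendsto[OF bounded_linear_pw_L2[OF A]]
        fourier_L2_cutoff) simp
  have *: "pw_L2 (\<lambda>_. A) (fourier_L2 u) \<bullet> v = u \<bullet> pw_L2 (\<lambda>_. A) (fourier_L2 v)"
    if A: "pw_op 1 (\<lambda>_. A)" "bounded_linear A" "\<And>r z. A (complex_of_real r * z) = r * A z"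
    for A :: "complex \<Rightarrow> real"
  proof (rule LIMSEQ_unique[OF lim[OF A(1)]])
    have sw: "pw_L2 (\<lambda>_. A) (abs_L2 (fourier_integral (cutoff n u))) \<bullet> abs_L2 (cutoff n v)
        = abs_L2 (cutoff n u) \<bullet> pw_L2 (\<lambda>_. A) (abs_L2 (fourier_integral (cutoff n v)))" for n
      using eq[OF A, of n u v] eq[OF A, of n v u]
      by (simp add: fourier_integral_adjoint[OF L12_cutoff L12_cutoff, of n v n u] inner_commute)
    show "(\<lambda>n. pw_L2 (\<lambda>_. A) (abs_L2 (fourier_integral (cutoff n u))) \<bullet> abs_L2 (cutoff n v))
        \<longlonglongrightarrow> u \<bullet> pw_L2 (\<lambda>_. A) (fourier_L2 v)"
      unfolding sw inner_commute[of u] inner_commute[of "abs_L2 (cutoff n u)" for n]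
      by (rule lim[OF A(1)])
  qed
  show ?re by (rule *[OF pw_op_Re bounded_linear_Re]) simp
  show ?im by (rule *[OF pw_op_Im bounded_linear_Im]) simp
qed

text \<open>The witness \<open>e + d\<close> is the adjoint applied to \<open>M\<close>. Its norm is
  that of \<open>M\<close> by parity: the real part \<open>a\<close> is even, so its transform is
  real; the imaginary part \<open>b\<close> is odd, so its transform is imaginary. Therefore
  \<open>e\<close> and \<open>d\<close> have the norms of \<open>a\<close> and
  \<open>b\<close>.\<close>

lemma fourier_L2_surj:
  assumes M: "reflect_L2 M = cnj_L2 M"
  shows "\<exists>w. fourier_L2 w = M"
proof -
  define a where "a = Re_L2 M"
  define b where "b = Im_L2 M"
  define e where "e = Re_L2 (fourier_L2 a)"
  define d where "d = Im_L2 (fourier_L2 b)"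
  have re: "reflect_L2 (Re_L2 u) = Re_L2 (reflect_L2 u)" for u
    by (rule affine_L2_pw_L2[OF _ pw_op_Re]) simp_all
  have im: "reflect_L2 (Im_L2 u) = Im_L2 (reflect_L2 u)" for u
    by (rule affine_L2_pw_L2[OF _ pw_op_Im]) simp_all
  have neg: "A (- u) = - A u" if "bounded_linear A" for A :: "'x::real_normed_vector \<Rightarrow> 'y::real_normed_vector" and u
    by (rule linear_neg[OF bounded_linear.linear[OF that]])
  have zero: "x = 0" if "x = - x" for x :: "real L2"
  proof -
    have "2 *\<^sub>R x = 0" using that by (simp add: scaleR_2 eq_neg_iff_add_eq_0)
    then show ?thesis by simp
  qed
  have "reflect_L2 a = a" by (simp add: a_def re M Re_cnj_L2)
  then have Fa: "reflect_L2 (fourier_L2 a) = fourier_L2 a" by (simp flip: fourier_reflect)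
  then have "cnj_L2 (fourier_L2 a) = fourier_L2 a" by (simp add: cnj_fourier_L2)
  then have Ia: "Im_L2 (fourier_L2 a) = 0"
    using Im_cnj_L2[of "fourier_L2 a"] by (intro zero) simp
  have "reflect_L2 b = - b" by (simp add: b_def im M Im_cnj_L2)
  then have Fb: "reflect_L2 (fourier_L2 b) = - fourier_L2 b"
    by (simp add: fourier_L2_minus flip: fourier_reflect)
  then have "cnj_L2 (fourier_L2 b) = - fourier_L2 b" by (simp add: cnj_fourier_L2)
  then have Rb: "Re_L2 (fourier_L2 b) = 0"
    using Re_cnj_L2[of "fourier_L2 b"] by (intro zero) (simp add: neg[OF bounded_linear_Re_L2])
  \<comment> \<open>An even and an odd function are orthogonal, because reflection preserves the
    inner product.\<close>
  have "reflect_L2 e = e" by (simp add: e_def re Fa)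
  moreover have "reflect_L2 d = - d" by (simp add: d_def im Fb neg[OF bounded_linear_Im_L2])
  ultimately have ed: "e \<bullet> d = 0"
    using inner_affine_L2[of "- 1" 0 e d] by simp
  have "e \<bullet> e = a \<bullet> a"
    using inner_complex_L2[of "fourier_L2 a" "fourier_L2 a"] by (simp add: e_def Ia inner_fourier_L2)
  moreover have "d \<bullet> d = b \<bullet> b"
    using inner_complex_L2[of "fourier_L2 b" "fourier_L2 b"] by (simp add: d_def Rb inner_fourier_L2)
  moreover have "M \<bullet> M = a \<bullet> a + b \<bullet> b"
    using inner_complex_L2[of M M] by (simp add: a_def b_def)
  ultimately have ww: "(e + d) \<bullet> (e + d) = M \<bullet> M"
    using ed by (simp add: inner_add_left inner_add_right inner_commute)
  have "fourier_L2 (e + d) \<bullet> M = (e + d) \<bullet> (e + d)"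
    using inner_complex_L2[of "fourier_L2 (e + d)" M]
    by (simp add: Re_Im_fourier_adjoint inner_add_right flip: a_def b_def e_def d_def)
  then have "(fourier_L2 (e + d) - M) \<bullet> (fourier_L2 (e + d) - M) = 0"
    using ww by (simp add: inner_diff_left inner_diff_right inner_fourier_L2 inner_commute)
  then show ?thesis by auto
qed

section \<open>Hermitian functions and the inverse transform\<close>

definition hermitian :: "(real \<Rightarrow> complex) \<Rightarrow> bool" where
  "hermitian m \<longleftrightarrow> (AE \<xi> in lborel. m (- \<xi>) = cnj (m \<xi>))"

text \<open>Has the same shape as the description in \<open>helmholtz_inverse\<close>, which thereby
  becomes an instance.\<close>

definition fourier_inv :: "(real \<Rightarrow> complex) \<Rightarrow> real L2" where
  "fourier_inv m = (THE w. AE \<xi> in lborel. rep_L2 (fourier_L2 w) \<xi> = m \<xi>)"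

lemma fourier_inv_eqI:
  assumes "AE \<xi> in lborel. rep_L2 (fourier_L2 w) \<xi> = m \<xi>"
  shows "fourier_inv m = w"
  unfolding fourier_inv_def
proof (rule the_equality[where P = "\<lambda>w. AE \<xi> in lborel. rep_L2 (fourier_L2 w) \<xi> = m \<xi>", OF assms])
  fix v assume "AE \<xi> in lborel. rep_L2 (fourier_L2 v) \<xi> = m \<xi>"
  then have "AE \<xi> in lborel. rep_L2 (fourier_L2 v) \<xi> = rep_L2 (fourier_L2 w) \<xi>"
    using assms by eventually_elim simp
  then have "fourier_L2 v = fourier_L2 w" by (rule L2_eqI)
  then show "v = w" by (rule fourier_L2_inj)
qed

lemma hermitian_fourier_L2: "hermitian (rep_L2 (fourier_L2 u))"
  using rep_affine_L2[of "- 1" 0 "fourier_L2 u"] rep_pw_L2[OF pw_op_cnj, of "fourier_L2 u"]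
  unfolding hermitian_def cnj_fourier_L2 by (auto elim: eventually_elim2)

lemma rep_fourier_inv:
  assumes m: "square_integrable m" "hermitian m"
  shows "AE \<xi> in lborel. rep_L2 (fourier_L2 (fourier_inv m)) \<xi> = m \<xi>"
proof -
  have "reflect_L2 (abs_L2 m) = abs_L2 (\<lambda>\<xi>. m (0 + - 1 * \<xi>))"
    by (rule affine_L2_abs[OF _ m(1)]) simp
  also have "\<dots> = abs_L2 (\<lambda>\<xi>. cnj (m \<xi>))"
    using m square_integrable_affine[OF _ m(1), of "- 1" 0] square_integrable_pw_L2[OF pw_op_cnj m(1)]
    by (subst abs_L2_eq_iff) (auto simp: hermitian_def)
  also have "\<dots> = cnj_L2 (abs_L2 m)"
    by (rule pw_L2_abs[OF pw_op_cnj m(1), symmetric])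
  finally obtain w where w: "fourier_L2 w = abs_L2 m"
    using fourier_L2_surj by blast
  then have "AE \<xi> in lborel. rep_L2 (fourier_L2 w) \<xi> = m \<xi>"
    using rep_abs_L2[OF m(1)] by simp
  then show ?thesis using fourier_inv_eqI by blast
qed

lemma norm_fourier_inv:
  assumes m: "square_integrable m" "hermitian m"
  shows "(norm (fourier_inv m))\<^sup>2 = (LINT \<xi>|lborel. (cmod (m \<xi>))\<^sup>2)"
proof -
  have "fourier_L2 (fourier_inv m) = abs_L2 m"
    using rep_fourier_inv[OF m] by (rule abs_L2_eqI[OF m(1)])
  then have "norm (fourier_inv m) = norm (abs_L2 m)"
    using norm_fourier_L2[of "fourier_inv m"] by simp
  then show ?thesis using norm_abs_L2_power2[OF m(1)] by simp
qed

section \<open>Bessel potentials and the quadratic term\<close>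

lemma rep_fourier_L2_add:
  "AE \<xi> in lborel. rep_L2 (fourier_L2 (u + v)) \<xi> = rep_L2 (fourier_L2 u) \<xi> + rep_L2 (fourier_L2 v) \<xi>"
  unfolding fourier_L2_add by (rule rep_L2_add)

lemma rep_fourier_L2_scaleR:
  "AE \<xi> in lborel. rep_L2 (fourier_L2 (c *\<^sub>R u)) \<xi> = c *\<^sub>R rep_L2 (fourier_L2 u) \<xi>"
  unfolding fourier_L2_scaleR by (rule rep_L2_scaleR)

section \<open>Fourier multipliers\<close>

definition multiplier :: "(real \<Rightarrow> real) \<Rightarrow> real L2 \<Rightarrow> real L2" where
  "multiplier k u = fourier_inv (\<lambda>\<xi>. k \<xi> *\<^sub>R rep_L2 (fourier_L2 u) \<xi>)"

lemma pw_op_scaleR: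
  fixes k :: "real \<Rightarrow> real"
  assumes [measurable]: "k \<in> borel_measurable borel" and "\<And>\<xi>. \<bar>k \<xi>\<bar> \<le> C"
  shows "pw_op C (\<lambda>\<xi> v :: 'a::euclidean_space. k \<xi> *\<^sub>R v)"
  unfolding pw_op_def
  using assms(2) by (auto intro: mult_right_mono simp: linear_iff scaleR_add_right)

lemma hermitian_scaleR:
  assumes "hermitian m" "\<And>\<xi>. k (- \<xi>) = k \<xi>"
  shows "hermitian (\<lambda>\<xi>. k \<xi> *\<^sub>R m \<xi>)"
  using assms unfolding hermitian_def by (auto elim: eventually_mono)

context
  fixes k :: "real \<Rightarrow> real" and C :: real
  assumes k: "k \<in> borel_measurable borel" "\<And>\<xi>. \<bar>k \<xi>\<bar> \<le> C" and even: "\<And>\<xi>. k (- \<xi>) = k \<xi>"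
begin

text \<open>A bounded symbol preserves square integrability, and a real even one preserves Hermitian
  symmetry. The product is therefore again the transform of a real function.\<close>

lemma rep_multiplier:
  "AE \<xi> in lborel. rep_L2 (fourier_L2 (multiplier k u)) \<xi> = k \<xi> *\<^sub>R rep_L2 (fourier_L2 u) \<xi>"
  unfolding multiplier_def
  by (intro rep_fourier_inv square_integrable_pw_L2[OF pw_op_scaleR[OF k]]
      hermitian_scaleR hermitian_fourier_L2 even) simp

lemma fourier_multiplier: "fourier_L2 (multiplier k u) = pw_L2 (\<lambda>\<xi> v. k \<xi> *\<^sub>R v) (fourier_L2 u)"
  by (rule pw_L2_eqI[OF pw_op_scaleR[OF k] rep_multiplier])

lemma bounded_linear_multiplier: "bounded_linear (multiplier k)"
  and norm_multiplier_le: "norm (multiplier k u) \<le> C * norm u"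
proof -
  have C: "0 \<le> C" using order_trans[OF abs_ge_zero k(2)] .
  show norm: "norm (multiplier k u) \<le> C * norm u" for u
    using norm_pw_L2[OF pw_op_scaleR[OF k] C, of "fourier_L2 u"]
    by (simp add: norm_fourier_L2 flip: fourier_multiplier)
  show "bounded_linear (multiplier k)"
  proof (rule bounded_linear_intro[of _ C])
    show "multiplier k (u + v) = multiplier k u + multiplier k v" for u v
      by (rule fourier_L2_inj)
         (simp add: fourier_multiplier fourier_L2_add pw_L2_add[OF pw_op_scaleR[OF k]])
    show "multiplier k (c *\<^sub>R u) = c *\<^sub>R multiplier k u" for c u
      by (rule fourier_L2_inj)
         (simp add: fourier_multiplier fourier_L2_scaleR pw_L2_scaleR[OF pw_op_scaleR[OF k]])
  qed (use norm in \<open>simp add: mult.commute\<close>)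
qed

end

section \<open>Weights and the Bessel potential\<close>

definition weight :: "real \<Rightarrow> real \<Rightarrow> real" where
  "weight s \<xi> = (1 + \<xi>\<^sup>2) powr s"

lemma weight_measurable [measurable]: "weight s \<in> borel_measurable borel"
  unfolding weight_def by measurable

lemma weight_pos [simp]: "0 < weight s \<xi>"
proof -
  have "1 + \<xi>\<^sup>2 \<noteq> 0" using zero_le_power2[of \<xi>] by linarith
  then show ?thesis by (simp add: weight_def)
qed

lemma weight_nonneg [simp]: "0 \<le> weight s \<xi>" by (simp add: less_imp_le)

lemma weight_minus [simp]: "weight s (- \<xi>) = weight s \<xi>" by (simp add: weight_def)

lemma weight_add: "weight (s + r) \<xi> = weight s \<xi> * weight r \<xi>"
  by (simp add: weight_def powr_add)

lemma weight_0 [simp]: "weight 0 \<xi> = 1"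
proof -
  have "1 + \<xi>\<^sup>2 \<noteq> 0" using zero_le_power2[of \<xi>] by linarith
  then show ?thesis by (simp add: weight_def)
qed

lemma weight_1 [simp]: "weight 1 \<xi> = 1 + \<xi>\<^sup>2" by (simp add: weight_def)

lemma weight_power2: "(weight s \<xi>)\<^sup>2 = weight (2 * s) \<xi>"
  by (simp add: power2_eq_square flip: weight_add)

lemma weight_le_1:
  assumes "s \<le> 0"
  shows "\<bar>weight s \<xi>\<bar> \<le> 1"
proof -
  have "weight s \<xi> \<le> weight 0 \<xi>"
    unfolding weight_def using assms by (intro powr_mono) auto
  then show ?thesis by simp
qed

lemma sobolev_space_iff:
  "u \<in> sobolev_space l \<longleftrightarrow> square_integrable (\<lambda>\<xi>. weight (l / 2) \<xi> *\<^sub>R rep_L2 (fourier_L2 u) \<xi>)"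
  unfolding sobolev_space_def square_integrable_def
  by (simp add: power_mult_distrib weight_power2) (simp add: weight_def)

text \<open>The operator (1 - d^2/dx^2)^(-l/2). The exponent is halved because \<open>weight\<close>
  is a power of \<open>1 + \<xi>\<^sup>2\<close>.\<close>

definition bessel :: "real \<Rightarrow> real L2 \<Rightarrow> real L2" where
  "bessel l = multiplier (weight (- l / 2))"

context
  fixes l :: real
  assumes l: "0 \<le> l"
begin

lemma weight_bound: "\<bar>weight (- l / 2) \<xi>\<bar> \<le> 1"
  using l by (intro weight_le_1) simp

lemma rep_bessel:
  "AE \<xi> in lborel. rep_L2 (fourier_L2 (bessel l U)) \<xi> = weight (- l / 2) \<xi> *\<^sub>R rep_L2 (fourier_L2 U) \<xi>"
  unfolding bessel_def by (rule rep_multiplier[OF weight_measurable weight_bound weight_minus])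

lemma bounded_linear_bessel: "bounded_linear (bessel l)"
  unfolding bessel_def by (rule bounded_linear_multiplier[OF weight_measurable weight_bound weight_minus])

lemma norm_bessel_le: "norm (bessel l U) \<le> norm U"
  unfolding bessel_def
  using norm_multiplier_le[OF weight_measurable weight_bound weight_minus, of U] by simp

lemma weight_rep_bessel:
  "AE \<xi> in lborel. weight (l / 2) \<xi> *\<^sub>R rep_L2 (fourier_L2 (bessel l U)) \<xi> = rep_L2 (fourier_L2 U) \<xi>"
  using rep_bessel[of U]
proof eventually_elim
  case (elim \<xi>)
  have "weight (l / 2) \<xi> * weight (- l / 2) \<xi> = 1" by (simp flip: weight_add)
  then show ?case by (simp add: elim)
qed

lemma bessel_in_sobolev: "bessel l U \<in> sobolev_space l"
  unfolding sobolev_space_iff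
  by (rule square_integrable_AE_cong[OF square_integrable_rep[of "fourier_L2 U"]])
     (use weight_rep_bessel[of U] in \<open>auto elim: eventually_mono\<close>)

lemma sobolev_norm_bessel: "sobolev_norm l (bessel l U) = norm U"
proof -
  have "(LINT \<xi>|lborel. (1 + \<xi>\<^sup>2) powr l * (cmod (rep_L2 (fourier_L2 (bessel l U)) \<xi>))\<^sup>2)
      = (LINT \<xi>|lborel. (cmod (rep_L2 (fourier_L2 U) \<xi>))\<^sup>2)"
  proof (rule integral_cong_AE)
    show "AE \<xi> in lborel. (1 + \<xi>\<^sup>2) powr l * (cmod (rep_L2 (fourier_L2 (bessel l U)) \<xi>))\<^sup>2
        = (cmod (rep_L2 (fourier_L2 U) \<xi>))\<^sup>2"
      using weight_rep_bessel[of U]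
    proof eventually_elim
      case (elim \<xi>)
      show ?case
        unfolding elim[symmetric]
        by (simp add: power_mult_distrib weight_power2) (simp add: weight_def)
    qed
  qed measurable
  then show ?thesis
    by (simp add: sobolev_norm_def norm_fourier_L2 flip: norm_L2_power2)
qed

text \<open>The preimage is the function with transform \<open>weight (l / 2)\<close> times that of
  \<open>u\<close>; membership in the Sobolev space makes this square integrable.\<close>

lemma bessel_surj:
  assumes "u \<in> sobolev_space l"
  obtains U where "u = bessel l U"
proof -
  define m where "m \<xi> = weight (l / 2) \<xi> *\<^sub>R rep_L2 (fourier_L2 u) \<xi>" for \<xi>
  have "square_integrable m" "hermitian m"
    unfolding m_def using assms
    by (auto simp: sobolev_space_iff intro: hermitian_scaleR hermitian_fourier_L2)
  note m = rep_fourier_inv[OF this]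
  have "AE \<xi> in lborel. rep_L2 (fourier_L2 (bessel l (fourier_inv m))) \<xi> = rep_L2 (fourier_L2 u) \<xi>"
    using rep_bessel[of "fourier_inv m"] m
  proof eventually_elim
    case (elim \<xi>)
    have "weight (- l / 2) \<xi> * weight (l / 2) \<xi> = 1" by (simp flip: weight_add)
    then show ?case by (simp add: elim m_def)
  qed
  then have "u = bessel l (fourier_inv m)"
    by (intro fourier_L2_inj L2_eqI) (auto elim: eventually_mono)
  then show thesis by (rule that)
qed

lemma bessel_inj: "bessel l U = bessel l V \<Longrightarrow> U = V"
  using sobolev_norm_bessel[of "U - V"] sobolev_norm_bessel[of 0]
  by (simp add: linear_diff[OF bounded_linear.linear[OF bounded_linear_bessel]]
      linear_0[OF bounded_linear.linear[OF bounded_linear_bessel]])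

end

section \<open>Modulation and the transform of a product\<close>

lemma pw_op_mult:
  fixes \<alpha> :: complex
  shows "pw_op (cmod \<alpha>) (\<lambda>_ z. \<alpha> * z)"
  unfolding pw_op_def by (auto simp: norm_mult linear_iff algebra_simps)

text \<open>The real wave is the cosine for \<open>\<alpha> = 1\<close> and the sine for
  \<open>\<alpha> = - \<i>\<close>.\<close>

lemma pw_op_wave:
  assumes "cmod \<alpha> = 1"
  shows "pw_op 1 (\<lambda>x r. Re (\<alpha> * cis (x * \<xi>)) * r)"
proof -
  have [measurable]: "cis \<in> borel_measurable borel"
    by (intro borel_measurable_continuous_onI continuous_intros)
  have "\<bar>Re (\<alpha> * cis (x * \<xi>))\<bar> \<le> 1" for x
    using abs_Re_le_cmod[of "\<alpha> * cis (x * \<xi>)"] assms by (simp add: norm_mult)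
  then show ?thesis
    using pw_op_scaleR[where 'a = real, of "\<lambda>x. Re (\<alpha> * cis (x * \<xi>))" 1] by simp
qed

text \<open>The wave is half the sum of \<open>\<alpha> * cis (x * \<xi>)\<close> and its conjugate,
  and each exponential translates the transform. Real waves keep the modulated function in the
  domain of \<open>fourier_L2\<close>.\<close>

lemma fourier_modulation:
  assumes \<alpha>: "cmod \<alpha> = 1"
  shows "fourier_L2 (pw_L2 (\<lambda>x r. Re (\<alpha> * cis (x * \<xi>)) * r) v)
    = pw_L2 (\<lambda>_ z. \<alpha> / 2 * z) (affine_L2 1 (- \<xi>) (fourier_L2 v))
      + pw_L2 (\<lambda>_ z. cnj \<alpha> / 2 * z) (affine_L2 1 \<xi> (fourier_L2 v))"
proof (rule LIMSEQ_unique)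
  let ?W = "pw_L2 (\<lambda>x r. Re (\<alpha> * cis (x * \<xi>)) * r)" and ?S = "affine_L2 1"
  let ?A = "pw_L2 (\<lambda>_ z. \<alpha> / 2 * z)" and ?A' = "pw_L2 (\<lambda>_ z. cnj \<alpha> / 2 * z)"
  let ?w = "\<lambda>x. Re (\<alpha> * cis (x * \<xi>))"
  let ?g = "\<lambda>n x. ?w x * cutoff n v x"
  have [measurable]: "cis \<in> borel_measurable borel"
    by (intro borel_measurable_continuous_onI continuous_intros)
  have w1: "\<bar>?w x\<bar> \<le> 1" for x
    using abs_Re_le_cmod[of "\<alpha> * cis (x * \<xi>)"] \<alpha> by (simp add: norm_mult)
  have cut: "integrable lborel (cutoff n v)" "square_integrable (cutoff n v)" for n
    using L12_cutoff by (auto simp: L12_def)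
  have g: "L12 (?g n)" for n
    unfolding L12_def
  proof
    show "integrable lborel (?g n)"
      by (rule Bochner_Integration.integrable_bound[OF cut(1)[of n]])
         (use w1 in \<open>auto simp: abs_mult intro!: mult_left_le_one_le\<close>)
    show "square_integrable (?g n)"
      by (rule square_integrable_pw_L2[OF pw_op_wave[OF \<alpha>] cut(2)])
  qed
  have "abs_L2 (?g n) = ?W (abs_L2 (cutoff n v))" for n
    by (rule pw_L2_abs[OF pw_op_wave[OF \<alpha>] cut(2), symmetric])
  moreover have "(\<lambda>n. ?W (abs_L2 (cutoff n v))) \<longlonglongrightarrow> ?W v"
    by (intro bounded_linear.tendsto[OF bounded_linear_pw_L2[OF pw_op_wave[OF \<alpha>]]] cutoff_tendsto) simp
  ultimately show "(\<lambda>n. abs_L2 (fourier_integral (?g n))) \<longlonglongrightarrow> fourier_L2 (?W v)"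
    by (intro fourier_L2_limit g) simp
  let ?F = "\<lambda>n. fourier_integral (cutoff n v)"
  have "abs_L2 (fourier_integral (?g n)) = ?A (?S (- \<xi>) (abs_L2 (?F n))) + ?A' (?S \<xi> (abs_L2 (?F n)))" for n
  proof -
    have sq: "square_integrable (?F n)"
      by (intro square_integrable_fourier_integral L12_cutoff)
    have sqz: "square_integrable (\<lambda>\<eta>. ?F n (z + 1 * \<eta>))" for z
      by (rule square_integrable_affine[OF abs_one sq])
    have sqA: "square_integrable (\<lambda>\<eta>. \<beta> / 2 * ?F n (z + 1 * \<eta>))" for z \<beta>
      by (rule square_integrable_pw_L2[OF pw_op_mult sqz])
    have A: "pw_L2 (\<lambda>_ z. \<beta> / 2 * z) (?S z (abs_L2 (?F n))) = abs_L2 (\<lambda>\<eta>. \<beta> / 2 * ?F n (z + 1 * \<eta>))" for z \<beta>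
      unfolding affine_L2_abs[OF abs_one sq] by (rule pw_L2_abs[OF pw_op_mult[of "\<beta> / 2"] sqz[of z]])
    have "fourier_integral (?g n) = (\<lambda>\<eta>. \<alpha> / 2 * ?F n (- \<xi> + 1 * \<eta>) + cnj \<alpha> / 2 * ?F n (\<xi> + 1 * \<eta>))"
    proof
      fix \<eta>
      let ?e = "\<lambda>\<eta> x. cutoff n v x *\<^sub>R cis (- (x * \<eta>))"
      have int: "integrable lborel (?e \<eta>)" for \<eta>
        by (rule integrable_fourier_integrand[OF cut(1)])
      have "(LINT x|lborel. ?g n x *\<^sub>R cis (- (x * \<eta>)))
          = (LINT x|lborel. \<alpha> / 2 * ?e (- \<xi> + 1 * \<eta>) x + cnj \<alpha> / 2 * ?e (\<xi> + 1 * \<eta>) x)"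
      proof (rule Bochner_Integration.integral_cong[OF refl])
        fix x
        have "complex_of_real (?w x) = (\<alpha> * cis (x * \<xi>) + cnj \<alpha> * cis (- (x * \<xi>))) / 2"
          using complex_add_cnj[of "\<alpha> * cis (x * \<xi>)"] by (simp add: cis_cnj)
        moreover have "cis (- (x * (- \<xi> + 1 * \<eta>))) = cis (x * \<xi>) * cis (- (x * \<eta>))"
          "cis (- (x * (\<xi> + 1 * \<eta>))) = cis (- (x * \<xi>)) * cis (- (x * \<eta>))"
          by (simp_all add: cis_mult algebra_simps)
        ultimately show "?g n x *\<^sub>R cis (- (x * \<eta>))
            = \<alpha> / 2 * ?e (- \<xi> + 1 * \<eta>) x + cnj \<alpha> / 2 * ?e (\<xi> + 1 * \<eta>) x"
          unfolding scaleR_conv_of_real of_real_mult by (simp only:) (simp add: field_simps)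
      qed
      also have "\<dots> = \<alpha> / 2 * (LINT x|lborel. ?e (- \<xi> + 1 * \<eta>) x) + cnj \<alpha> / 2 * (LINT x|lborel. ?e (\<xi> + 1 * \<eta>) x)"
        by (simp only: Bochner_Integration.integral_add integrable_mult_right int integral_mult_right_zero)
      finally show "fourier_integral (?g n) \<eta> = \<alpha> / 2 * ?F n (- \<xi> + 1 * \<eta>) + cnj \<alpha> / 2 * ?F n (\<xi> + 1 * \<eta>)"
        unfolding fourier_integral_def by (simp add: scaleR_add_right)
    qed
    then show ?thesis
      by (simp only: A abs_L2_add sqA)
  qed
  moreover have "(\<lambda>n. ?A (?S (- \<xi>) (abs_L2 (?F n))) + ?A' (?S \<xi> (abs_L2 (?F n))))
      \<longlonglongrightarrow> ?A (?S (- \<xi>) (fourier_L2 v)) + ?A' (?S \<xi> (fourier_L2 v))"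
    by (intro tendsto_add bounded_linear.tendsto[OF bounded_linear_pw_L2[OF pw_op_mult]]
        bounded_linear.tendsto[OF bounded_linear_affine_L2] fourier_L2_cutoff) simp_all
  ultimately show "(\<lambda>n. abs_L2 (fourier_integral (?g n)))
      \<longlonglongrightarrow> ?A (?S (- \<xi>) (fourier_L2 v)) + ?A' (?S \<xi> (fourier_L2 v))"
    by simp
qed

text \<open>
  The square of \<open>shift_norm l v \<xi>\<close> is the integral over \<open>\<eta>\<close> of \<open>(1 + \<eta>\<^sup>2) powr (- l)\<close> against the squared
  transform of \<open>v\<close> at \<open>\<xi> + \<eta>\<close>.  Only an upper bound for the transform of a product is needed, so
  these terms take the place of the convolution theorem.
\<close>

definition shift_norm :: "real \<Rightarrow> real L2 \<Rightarrow> real \<Rightarrow> real" where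
  "shift_norm l v z = norm (pw_L2 (\<lambda>\<eta> x. weight (- l / 2) \<eta> *\<^sub>R x) (affine_L2 1 z (fourier_L2 v)))"

context
  fixes l :: real
  assumes l: "0 \<le> l"
begin

lemmas weight_op = pw_op_scaleR[OF weight_measurable weight_bound[OF l]]

text \<open>The real weight contained in the transform of \<open>bessel l W\<close> is moved to the
  other factor before Cauchy-Schwarz is applied.\<close>

lemma inner_fourier_bessel:
  "\<bar>pw_L2 (\<lambda>_ z. \<alpha> / 2 * z) (affine_L2 1 z (fourier_L2 v)) \<bullet> fourier_L2 (bessel l W)\<bar>
    \<le> cmod \<alpha> / 2 * shift_norm l v z * norm W"
proof -
  let ?D = "pw_L2 (\<lambda>\<eta> x :: complex. weight (- l / 2) \<eta> *\<^sub>R x)"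
  let ?A = "pw_L2 (\<lambda>_ z. \<alpha> / 2 * z)"
  let ?X = "affine_L2 1 z (fourier_L2 v)"
  have "?A ?X \<bullet> fourier_L2 (bessel l W) = ?A (?D ?X) \<bullet> fourier_L2 W"
    unfolding inner_L2_eq
  proof (rule integral_cong_AE)
    show "AE \<eta> in lborel. rep_L2 (?A ?X) \<eta> \<bullet> rep_L2 (fourier_L2 (bessel l W)) \<eta>
        = rep_L2 (?A (?D ?X)) \<eta> \<bullet> rep_L2 (fourier_L2 W) \<eta>"
      using rep_pw_L2[OF pw_op_mult, of "\<alpha> / 2" ?X] rep_pw_L2[OF pw_op_mult, of "\<alpha> / 2" "?D ?X"]
        rep_pw_L2[OF weight_op, of ?X] rep_bessel[OF l, of W]
      by eventually_elim (simp only: inner_scaleR_right inner_scaleR_left mult_scaleR_right)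
  qed (use rep_L2_measurable in \<open>auto intro!: borel_measurable_inner\<close>)
  also have "\<bar>\<dots>\<bar> \<le> norm (?A (?D ?X)) * norm (fourier_L2 W)" by (rule Cauchy_Schwarz_ineq2)
  also have "\<dots> \<le> (cmod (\<alpha> / 2) * norm (?D ?X)) * norm W"
    unfolding norm_fourier_L2 by (intro mult_right_mono norm_pw_L2[OF pw_op_mult]) auto
  finally show ?thesis by (simp add: shift_norm_def norm_divide)
qed

text \<open>The integral is the inner product of a modulation of \<open>v\<close> with
  \<open>bessel l W\<close>. The transform preserves it and turns the modulation into two
  translations, each bounded by \<open>inner_fourier_bessel\<close>.\<close>

lemma wave_integral_le:
  assumes \<alpha>: "cmod \<alpha> = 1"
  shows "\<bar>LINT x|lborel. Re (\<alpha> * cis (x * \<xi>)) * (rep_L2 v x * rep_L2 (bessel l W) x)\<bar>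
    \<le> (shift_norm l v (- \<xi>) + shift_norm l v \<xi>) / 2 * norm W"
proof -
  let ?W = "pw_L2 (\<lambda>x r. Re (\<alpha> * cis (x * \<xi>)) * r)"
  have [measurable]: "cis \<in> borel_measurable borel"
    by (intro borel_measurable_continuous_onI continuous_intros)
  have [measurable]: "rep_L2 u \<in> borel_measurable borel" for u :: "real L2"
    using rep_L2_measurable[of u] by simp
  have "(LINT x|lborel. Re (\<alpha> * cis (x * \<xi>)) * (rep_L2 v x * rep_L2 (bessel l W) x))
      = ?W v \<bullet> bessel l W"
    unfolding inner_L2_eq
  proof (rule integral_cong_AE)
    show "AE x in lborel. Re (\<alpha> * cis (x * \<xi>)) * (rep_L2 v x * rep_L2 (bessel l W) x)
        = rep_L2 (?W v) x \<bullet> rep_L2 (bessel l W) x"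
      using rep_pw_L2[OF pw_op_wave[OF \<alpha>], of \<xi> v] by eventually_elim (simp del: times_complex.sel)
  qed measurable
  also have "\<dots> = fourier_L2 (?W v) \<bullet> fourier_L2 (bessel l W)" by (simp add: inner_fourier_L2)
  also have "\<bar>\<dots>\<bar> \<le> cmod \<alpha> / 2 * shift_norm l v (- \<xi>) * norm W
      + cmod (cnj \<alpha>) / 2 * shift_norm l v \<xi> * norm W"
    unfolding fourier_modulation[OF \<alpha>] inner_add_left
    by (intro order_trans[OF abs_triangle_ineq] add_mono inner_fourier_bessel)
  finally show ?thesis using \<alpha> by (simp add: algebra_simps)
qed

text \<open>Up to sign, the real and imaginary parts of the integral are integrals against a cosine
  and a sine wave, both covered by \<open>wave_integral_le\<close>.\<close>

lemma fourier_integral_product_le: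
  "(cmod (fourier_integral (\<lambda>x. rep_L2 v x * rep_L2 (bessel l W) x) \<xi>))\<^sup>2
    \<le> ((shift_norm l v (- \<xi>))\<^sup>2 + (shift_norm l v \<xi>)\<^sup>2) * (norm W)\<^sup>2"
proof -
  let ?p = "\<lambda>x. rep_L2 v x * rep_L2 (bessel l W) x"
  let ?s = "shift_norm l v (- \<xi>) + shift_norm l v \<xi>"
  have "integrable lborel ?p"
    using square_integrable_inner[OF square_integrable_rep square_integrable_rep, of v "bessel l W"] by simp
  note int = integrable_fourier_integrand[OF this, of \<xi>]
  let ?I = "LINT x|lborel. ?p x *\<^sub>R cis (- (x * \<xi>))"
  have "Re ?I = (LINT x|lborel. Re (1 * cis (x * \<xi>)) * ?p x)"
    using integral_Re[OF int] by (simp add: mult.commute)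
  then have "\<bar>Re ?I\<bar> \<le> ?s / 2 * norm W" using wave_integral_le[of 1] by simp
  moreover have "Im ?I = - (LINT x|lborel. Re (- \<i> * cis (x * \<xi>)) * ?p x)"
    using integral_Im[OF int] by (simp add: mult.commute)
  then have "\<bar>Im ?I\<bar> \<le> ?s / 2 * norm W" using wave_integral_le[of "- \<i>"] by simp
  ultimately have I: "cmod ?I \<le> ?s * norm W"
    using cmod_le[of ?I] by simp
  have "(cmod (fourier_integral ?p \<xi>))\<^sup>2 = (cmod ?I)\<^sup>2 / (2 * pi)"
    by (simp add: fourier_integral_def power_mult_distrib power_divide divide_simps)
  also have "\<dots> \<le> (?s * norm W)\<^sup>2 / (2 * pi)"
    using I by (intro divide_right_mono power_mono) auto
  \<comment> \<open>The normalisation is only used through \<open>1 / (2 * pi) \<le> 1 / 2\<close>;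
    this factor compensates the 2 from squaring the sum \<open>?s\<close>.\<close>
  also have "\<dots> \<le> (?s * norm W)\<^sup>2 / 2"
    using pi_gt3 by (intro divide_left_mono) auto
  also have "\<dots> \<le> ((shift_norm l v (- \<xi>))\<^sup>2 + (shift_norm l v \<xi>)\<^sup>2) * (norm W)\<^sup>2"
  proof -
    have "?s\<^sup>2 \<le> 2 * ((shift_norm l v (- \<xi>))\<^sup>2 + (shift_norm l v \<xi>)\<^sup>2)"
      using sum_squares_bound[of "shift_norm l v (- \<xi>)" "shift_norm l v \<xi>"] by (simp add: power2_sum)
    from mult_right_mono[OF this zero_le_power2[of "norm W"]] show ?thesis
      unfolding power_mult_distrib[of ?s] mult.assoc by linarith
  qed
  finally show ?thesis .
qed

end

text \<open>A product \<open>a powr (1 - l) * b powr l\<close> is at most \<open>max a b\<close>.\<close>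

lemma weight_interpolation:
  assumes "0 \<le> l" "l \<le> 1"
  shows "weight (l - 1) \<xi> * weight (- l) \<eta> \<le> weight (- 1) \<xi> + weight (- 1) \<eta>"
proof -
  define M where "M = max (weight (- 1) \<xi>) (weight (- 1) \<eta>)"
  have M: "0 < M" by (simp add: M_def less_max_iff_disj)
  have "weight (l - 1) \<xi> = weight (- 1) \<xi> powr (1 - l)" "weight (- l) \<eta> = weight (- 1) \<eta> powr l"
    unfolding weight_def powr_powr by simp_all
  then have "weight (l - 1) \<xi> * weight (- l) \<eta> \<le> M powr (1 - l) * M powr l"
    using assms by (auto intro!: mult_mono powr_mono2 simp: M_def)
  also have "\<dots> = M" using M by (simp flip: powr_add)
  also have "\<dots> \<le> weight (- 1) \<xi> + weight (- 1) \<eta>" by (simp add: M_def)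
  finally show ?thesis .
qed

lemma nn_integral_weight: "(\<integral>\<^sup>+\<xi>. ennreal (weight (- 1) \<xi>) \<partial>lborel) = ennreal pi"
proof -
  have w: "weight (- 1) = (\<lambda>\<xi>. inverse (1 + \<xi>\<^sup>2))"
    by (simp add: weight_def fun_eq_iff powr_minus)
  have "integrable lborel (weight (- 1))"
    using integrable_inverse_1_plus_square by (simp add: w set_integrable_def)
  moreover have "(LINT \<xi>|lborel. weight (- 1) \<xi>) = pi"
    using LBINT_inverse_1_plus_square
    by (simp add: w interval_lebesgue_integral_def set_lebesgue_integral_def)
  ultimately show ?thesis by (simp add: nn_integral_eq_integral)
qed

lemma shift_norm_power2:
  assumes l: "0 \<le> l"
  shows "ennreal ((shift_norm l v z)\<^sup>2)
    = (\<integral>\<^sup>+\<eta>. ennreal (weight (- l) \<eta> * (cmod (rep_L2 (fourier_L2 v) (z + 1 * \<eta>)))\<^sup>2) \<partial>lborel)"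
  unfolding shift_norm_def nn_integral_norm_L2[symmetric]
proof (rule nn_integral_cong_AE)
  let ?X = "affine_L2 1 z (fourier_L2 v)"
  show "AE \<eta> in lborel. ennreal ((cmod (rep_L2 (pw_L2 (\<lambda>\<eta> x. weight (- l / 2) \<eta> *\<^sub>R x) ?X) \<eta>))\<^sup>2)
      = ennreal (weight (- l) \<eta> * (cmod (rep_L2 (fourier_L2 v) (z + 1 * \<eta>)))\<^sup>2)"
    using rep_pw_L2[OF weight_op[OF l], of ?X] rep_affine_L2[OF abs_one, of z "fourier_L2 v"]
    by eventually_elim (simp add: power_mult_distrib weight_power2)
qed

text \<open>\<open>weight_interpolation\<close> splits the double integral in two, each with a
  weight in a single variable. Integrating over the other variable first, after Fubini in the second
  term, gives the squared norm of \<open>v\<close>; the weight then contributes \<open>pi\<close>.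
  Both signs of \<open>c\<close> are needed for the shifts by \<open>\<xi>\<close> and
  \<open>- \<xi>\<close>.\<close>

lemma nn_integral_shift_norm:
  assumes l: "0 \<le> l" "l \<le> 1" and c: "\<bar>c\<bar> = 1"
  shows "(\<integral>\<^sup>+\<xi>. ennreal (weight (l - 1) \<xi>) * ennreal ((shift_norm l v (c * \<xi>))\<^sup>2) \<partial>lborel)
    \<le> ennreal (2 * pi * (norm v)\<^sup>2)"
proof -
  define G where "G \<xi> = ennreal ((cmod (rep_L2 (fourier_L2 v) \<xi>))\<^sup>2)" for \<xi>
  have [measurable]: "G \<in> borel_measurable borel"
    unfolding G_def using rep_L2_measurable[of "fourier_L2 v"] by measurable
  have G: "(\<integral>\<^sup>+\<xi>. G (a + b * \<xi>) \<partial>lborel) = ennreal ((norm v)\<^sup>2)" if "\<bar>b\<bar> = 1" for a b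
  proof -
    have "(\<integral>\<^sup>+\<xi>. G \<xi> \<partial>lborel) = \<bar>b\<bar> * (\<integral>\<^sup>+\<xi>. G (a + b * \<xi>) \<partial>lborel)"
      using that by (intro nn_integral_real_affine) auto
    then show ?thesis
      using that nn_integral_norm_L2[of "fourier_L2 v"] by (simp add: G_def norm_fourier_L2)
  qed
  let ?w = "\<lambda>\<xi>. ennreal (weight (- 1) \<xi>)"
  have "(\<integral>\<^sup>+\<xi>. ennreal (weight (l - 1) \<xi>) * ennreal ((shift_norm l v (c * \<xi>))\<^sup>2) \<partial>lborel)
      = (\<integral>\<^sup>+\<xi>. (\<integral>\<^sup>+\<eta>. ennreal (weight (l - 1) \<xi> * weight (- l) \<eta>) * G (c * \<xi> + 1 * \<eta>) \<partial>lborel) \<partial>lborel)"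
    unfolding shift_norm_power2[OF l(1)]
    using rep_L2_measurable[of "fourier_L2 v"]
    by (subst nn_integral_cmult[symmetric]) (auto simp: G_def ennreal_mult mult.assoc)
  also have "\<dots> \<le> (\<integral>\<^sup>+\<xi>. (\<integral>\<^sup>+\<eta>. ?w \<xi> * G (c * \<xi> + 1 * \<eta>) + ?w \<eta> * G (c * \<xi> + 1 * \<eta>) \<partial>lborel) \<partial>lborel)"
  proof (intro nn_integral_mono)
    fix \<xi> \<eta>
    have "ennreal (weight (l - 1) \<xi> * weight (- l) \<eta>) \<le> ?w \<xi> + ?w \<eta>"
      using weight_interpolation[OF l] by (simp flip: ennreal_plus)
    from mult_right_mono[OF this, of "G (c * \<xi> + 1 * \<eta>)"]
    show "ennreal (weight (l - 1) \<xi> * weight (- l) \<eta>) * G (c * \<xi> + 1 * \<eta>)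
        \<le> ?w \<xi> * G (c * \<xi> + 1 * \<eta>) + ?w \<eta> * G (c * \<xi> + 1 * \<eta>)"
      by (simp add: distrib_right)
  qed
  also have "\<dots> = (\<integral>\<^sup>+\<xi>. (\<integral>\<^sup>+\<eta>. ?w \<xi> * G (c * \<xi> + 1 * \<eta>) \<partial>lborel) \<partial>lborel)
      + (\<integral>\<^sup>+\<xi>. (\<integral>\<^sup>+\<eta>. ?w \<eta> * G (c * \<xi> + 1 * \<eta>) \<partial>lborel) \<partial>lborel)"
    by (simp add: nn_integral_add)
  also have "(\<integral>\<^sup>+\<xi>. (\<integral>\<^sup>+\<eta>. ?w \<eta> * G (c * \<xi> + 1 * \<eta>) \<partial>lborel) \<partial>lborel)
      = (\<integral>\<^sup>+\<eta>. (\<integral>\<^sup>+\<xi>. ?w \<eta> * G (\<eta> + c * \<xi>) \<partial>lborel) \<partial>lborel)"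
    by (subst lborel_pair.Fubini') (simp_all add: add.commute)
  also have "\<dots> = (\<integral>\<^sup>+\<eta>. ?w \<eta> * ennreal ((norm v)\<^sup>2) \<partial>lborel)"
    by (intro nn_integral_cong) (simp add: nn_integral_cmult G[OF c])
  also have "(\<integral>\<^sup>+\<xi>. (\<integral>\<^sup>+\<eta>. ?w \<xi> * G (c * \<xi> + 1 * \<eta>) \<partial>lborel) \<partial>lborel)
      = (\<integral>\<^sup>+\<xi>. ?w \<xi> * ennreal ((norm v)\<^sup>2) \<partial>lborel)"
    by (subst nn_integral_cmult, measurable) (simp only: G[OF abs_one])
  also have "\<dots> + \<dots> = ennreal (2 * pi * (norm v)\<^sup>2)"
    by (simp add: nn_integral_multc nn_integral_weight) (simp flip: ennreal_mult ennreal_plus)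
  finally show ?thesis .
qed

section \<open>The bilinear source term\<close>

text \<open>The transform of half the negative derivative of a product of two potentials, with two
  multipliers combined: weight exponent -1 from the Helmholtz inverse and \<open>l / 2\<close> from
  undoing the outer Bessel potential. With \<open>U = V\<close> it comes from the quadratic part of
  \<open>source_hat\<close>.\<close>

definition quad_hat :: "real \<Rightarrow> real L2 \<Rightarrow> real L2 \<Rightarrow> real \<Rightarrow> complex" where
  "quad_hat l U V \<xi> = weight (l / 2 - 1) \<xi> *\<^sub>R
     (- (1/2) * (\<i> * complex_of_real \<xi> *
       fourier_integral (\<lambda>x. rep_L2 (bessel l U) x * rep_L2 (bessel l V) x) \<xi>))"

definition quad :: "real \<Rightarrow> real L2 \<Rightarrow> real L2 \<Rightarrow> real L2" where
  "quad l U V = fourier_inv (quad_hat l U V)"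

lemma hermitian_quad_hat: "hermitian (quad_hat l U V)"
  by (simp add: hermitian_def quad_hat_def cnj_fourier_integral)

lemma quad_hat_commute: "quad_hat l U V = quad_hat l V U"
  by (simp add: quad_hat_def mult.commute fun_eq_iff)

text \<open>Representatives are additive only almost everywhere, but the Fourier integral does not
  see null sets; hence equality at every \<open>\<xi>\<close>.\<close>

lemma quad_hat_add_left:
  assumes l: "0 \<le> l"
  shows "quad_hat l (U + U') V \<xi> = quad_hat l U V \<xi> + quad_hat l U' V \<xi>"
proof -
  let ?p = "\<lambda>U x. rep_L2 (bessel l U) x * rep_L2 (bessel l V) x"
  have int: "integrable lborel (?p U)" for U
    using square_integrable_inner[OF square_integrable_rep square_integrable_rep, of "bessel l U" "bessel l V"]
    by simp
  have [measurable]: "rep_L2 u \<in> borel_measurable borel" for u :: "real L2"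
    using rep_L2_measurable[of u] by simp
  have "bessel l (U + U') = bessel l U + bessel l U'"
    by (rule linear_add[OF bounded_linear.linear[OF bounded_linear_bessel[OF l]]])
  then have "AE x in lborel. ?p (U + U') x = ?p U x + ?p U' x"
    using rep_L2_add[of "bessel l U" "bessel l U'"] by (auto elim!: eventually_mono simp: algebra_simps)
  then have "fourier_integral (?p (U + U')) \<xi> = fourier_integral (\<lambda>x. ?p U x + ?p U' x) \<xi>"
    by (rule fourier_integral_cong_AE) measurable
  also have "\<dots> = fourier_integral (?p U) \<xi> + fourier_integral (?p U') \<xi>"
    by (rule fourier_integral_add[OF int int])
  finally show ?thesis
    by (simp add: quad_hat_def algebra_simps scaleR_add_right)
qed

lemma quad_hat_scaleR_left:
  assumes l: "0 \<le> l"
  shows "quad_hat l (c *\<^sub>R U) V \<xi> = c *\<^sub>R quad_hat l U V \<xi>"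
proof -
  let ?p = "\<lambda>U x. rep_L2 (bessel l U) x * rep_L2 (bessel l V) x"
  have [measurable]: "rep_L2 u \<in> borel_measurable borel" for u :: "real L2"
    using rep_L2_measurable[of u] by simp
  have "bessel l (c *\<^sub>R U) = c *\<^sub>R bessel l U"
    by (rule linear_scale[OF bounded_linear.linear[OF bounded_linear_bessel[OF l]]])
  then have "AE x in lborel. ?p (c *\<^sub>R U) x = c * ?p U x"
    using rep_L2_scaleR[of c "bessel l U"] by (auto elim!: eventually_mono)
  then have "fourier_integral (?p (c *\<^sub>R U)) \<xi> = fourier_integral (\<lambda>x. c * ?p U x) \<xi>"
    by (rule fourier_integral_cong_AE) measurable
  then show ?thesis
    by (simp add: quad_hat_def fourier_integral_scale)
qed

text \<open>After squaring, the weight has exponent \<open>l - 2\<close>, and the factor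
  \<open>\<xi>\<^sup>2\<close> from the derivative raises it to \<open>l - 1\<close>. This is the
  weight for which \<open>nn_integral_shift_norm\<close> bounds the two shifted terms.\<close>

lemma quad_hat_bound:
  assumes l: "0 \<le> l" "l \<le> 1"
  shows "square_integrable (quad_hat l U V)"
    and "(LINT \<xi>|lborel. (cmod (quad_hat l U V \<xi>))\<^sup>2) \<le> (2 * norm U * norm V)\<^sup>2"
proof -
  let ?v = "bessel l U"
  let ?f = "fourier_integral (\<lambda>x. rep_L2 ?v x * rep_L2 (bessel l V) x)"
  have [measurable]: "quad_hat l U V \<in> borel_measurable borel"
    unfolding quad_hat_def by measurable
  have ptw: "ennreal ((cmod (quad_hat l U V \<xi>))\<^sup>2)
      \<le> ennreal ((norm V)\<^sup>2 / 4) * (ennreal (weight (l - 1) \<xi>) * ennreal ((shift_norm l ?v (-1 * \<xi>))\<^sup>2)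
        + ennreal (weight (l - 1) \<xi>) * ennreal ((shift_norm l ?v (1 * \<xi>))\<^sup>2))" for \<xi>
  proof -
    let ?s = "(shift_norm l ?v (- \<xi>))\<^sup>2 + (shift_norm l ?v \<xi>)\<^sup>2"
    have "(cmod (quad_hat l U V \<xi>))\<^sup>2 = weight (l - 2) \<xi> * (\<xi>\<^sup>2 * (cmod (?f \<xi>))\<^sup>2) / 4"
      by (simp add: quad_hat_def norm_mult power_mult_distrib weight_power2 power_divide algebra_simps)
    also have "\<dots> \<le> weight (l - 2) \<xi> * (weight 1 \<xi> * (?s * (norm V)\<^sup>2)) / 4"
      by (intro divide_right_mono mult_left_mono mult_mono fourier_integral_product_le l) auto
    also have "\<dots> = (norm V)\<^sup>2 / 4 * (weight (l - 1) \<xi> * ?s)"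
      using weight_add[of "l - 2" 1 \<xi>] by (simp add: mult_ac del: weight_1)
    finally have "ennreal ((cmod (quad_hat l U V \<xi>))\<^sup>2) \<le> ennreal ((norm V)\<^sup>2 / 4 * (weight (l - 1) \<xi> * ?s))"
      by (rule ennreal_leI)
    also have "(norm V)\<^sup>2 / 4 * (weight (l - 1) \<xi> * ?s) = (norm V)\<^sup>2 / 4 *
        (weight (l - 1) \<xi> * (shift_norm l ?v (-1 * \<xi>))\<^sup>2 + weight (l - 1) \<xi> * (shift_norm l ?v (1 * \<xi>))\<^sup>2)"
      by (simp add: distrib_left)
    finally show ?thesis
      by (simp flip: ennreal_mult ennreal_plus)
  qed
  have [measurable]: "(\<lambda>\<xi>. ennreal ((shift_norm l ?v (c * \<xi>))\<^sup>2)) \<in> borel_measurable borel" for c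
    unfolding shift_norm_power2[OF l(1)] using rep_L2_measurable[of "fourier_L2 ?v"] by measurable
  have "(\<integral>\<^sup>+\<xi>. ennreal ((cmod (quad_hat l U V \<xi>))\<^sup>2) \<partial>lborel)
      \<le> ennreal ((norm V)\<^sup>2 / 4) *
        ((\<integral>\<^sup>+\<xi>. ennreal (weight (l - 1) \<xi>) * ennreal ((shift_norm l ?v (-1 * \<xi>))\<^sup>2) \<partial>lborel)
        + (\<integral>\<^sup>+\<xi>. ennreal (weight (l - 1) \<xi>) * ennreal ((shift_norm l ?v (1 * \<xi>))\<^sup>2) \<partial>lborel))"
    by (subst nn_integral_add[symmetric], measurable, subst nn_integral_cmult[symmetric], measurable)
       (intro nn_integral_mono ptw)
  also have "\<dots> \<le> ennreal ((norm V)\<^sup>2 / 4) * (ennreal (2 * pi * (norm ?v)\<^sup>2) + ennreal (2 * pi * (norm ?v)\<^sup>2))"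
    by (intro mult_left_mono add_mono nn_integral_shift_norm l) auto
  also have "\<dots> = ennreal (pi * ((norm ?v)\<^sup>2 * (norm V)\<^sup>2))"
    by (simp flip: ennreal_plus ennreal_mult)
  also have "\<dots> \<le> ennreal ((2 * norm U * norm V)\<^sup>2)"
  proof (rule ennreal_leI)
    \<comment> \<open>Rounding \<open>pi\<close> up to 4 gives the constant 2 in the bilinear
      bound.\<close>
    have "pi * ((norm ?v)\<^sup>2 * (norm V)\<^sup>2) \<le> 4 * ((norm U)\<^sup>2 * (norm V)\<^sup>2)"
      using pi_less_4 by (intro mult_mono power_mono norm_bessel_le l) auto
    then show "pi * ((norm ?v)\<^sup>2 * (norm V)\<^sup>2) \<le> (2 * norm U * norm V)\<^sup>2"
      by (simp add: power_mult_distrib)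
  qed
  finally have le: "(\<integral>\<^sup>+\<xi>. ennreal ((cmod (quad_hat l U V \<xi>))\<^sup>2) \<partial>lborel) \<le> ennreal ((2 * norm U * norm V)\<^sup>2)" .
  have int: "integrable lborel (\<lambda>\<xi>. (cmod (quad_hat l U V \<xi>))\<^sup>2)"
    by (rule integrableI_nonneg) (use le in \<open>auto simp: le_less_trans\<close>)
  then show "square_integrable (quad_hat l U V)" by (simp add: square_integrable_def)
  show "(LINT \<xi>|lborel. (cmod (quad_hat l U V \<xi>))\<^sup>2) \<le> (2 * norm U * norm V)\<^sup>2"
    using le int by (subst (asm) nn_integral_eq_integral) auto
qed

lemma rep_quad:
  assumes l: "0 \<le> l" "l \<le> 1"
  shows "AE \<xi> in lborel. rep_L2 (fourier_L2 (quad l U V)) \<xi> = quad_hat l U V \<xi>"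
  unfolding quad_def by (rule rep_fourier_inv[OF quad_hat_bound(1)[OF l] hermitian_quad_hat])

lemma norm_quad_le:
  assumes l: "0 \<le> l" "l \<le> 1"
  shows "norm (quad l U V) \<le> 2 * norm U * norm V"
proof (rule power2_le_imp_le)
  show "(norm (quad l U V))\<^sup>2 \<le> (2 * norm U * norm V)\<^sup>2"
    unfolding quad_def norm_fourier_inv[OF quad_hat_bound(1)[OF l] hermitian_quad_hat]
    by (rule quad_hat_bound(2)[OF l])
qed simp

lemma quad_commute: "quad l U V = quad l V U"
  by (simp add: quad_def quad_hat_commute)

lemma bounded_bilinear_quad:
  assumes l: "0 \<le> l" "l \<le> 1"
  shows "bounded_bilinear (quad l)"
proof -
  have add: "quad l (U + U') V = quad l U V + quad l U' V" for U U' V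
    unfolding quad_def[of l "U + U'"]
  proof (rule fourier_inv_eqI)
    show "AE \<xi> in lborel. rep_L2 (fourier_L2 (quad l U V + quad l U' V)) \<xi> = quad_hat l (U + U') V \<xi>"
      using rep_fourier_L2_add[of "quad l U V" "quad l U' V"] rep_quad[OF l, of U V] rep_quad[OF l, of U' V]
      by eventually_elim (simp add: quad_hat_add_left[OF l(1)])
  qed
  have scale: "quad l (c *\<^sub>R U) V = c *\<^sub>R quad l U V" for c U V
    unfolding quad_def[of l "c *\<^sub>R U"]
  proof (rule fourier_inv_eqI)
    show "AE \<xi> in lborel. rep_L2 (fourier_L2 (c *\<^sub>R quad l U V)) \<xi> = quad_hat l (c *\<^sub>R U) V \<xi>"
      using rep_fourier_L2_scaleR[of c "quad l U V"] rep_quad[OF l, of U V]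
      by eventually_elim (simp add: quad_hat_scaleR_left[OF l(1)])
  qed
  show ?thesis
  proof
    show "quad l (U + U') V = quad l U V + quad l U' V" for U U' V by (rule add)
    show "quad l U (V + V') = quad l U V + quad l U V'" for U V V'
      by (simp add: quad_commute[of l U] add)
    show "quad l (c *\<^sub>R U) V = c *\<^sub>R quad l U V" for c U V by (rule scale)
    show "quad l U (c *\<^sub>R V) = c *\<^sub>R quad l U V" for c U V
      by (simp add: quad_commute[of l U] scale)
    show "\<exists>K. \<forall>U V. norm (quad l U V) \<le> norm U * norm V * K"
      by (rule exI[of _ 2]) (use norm_quad_le[OF l] in \<open>simp add: mult_ac\<close>)
  qed
qed

section \<open>The Cauchy problem\<close>

text \<open>The Helmholtz inverse followed by the inverse of the Bessel potential, combined into one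
  bounded multiplier for \<open>l \<le> 2\<close>.\<close>

definition forcing :: "real \<Rightarrow> real L2 \<Rightarrow> real L2" where
  "forcing l = multiplier (weight (l / 2 - 1))"

context
  fixes l :: real
  assumes l: "0 \<le> l" "l \<le> 1"
begin

lemma forcing_weight_bound: "\<bar>weight (l / 2 - 1) \<xi>\<bar> \<le> 1"
  using l by (intro weight_le_1) simp

lemma rep_forcing:
  "AE \<xi> in lborel. rep_L2 (fourier_L2 (forcing l g)) \<xi> = weight (l / 2 - 1) \<xi> *\<^sub>R rep_L2 (fourier_L2 g) \<xi>"
  unfolding forcing_def
  by (rule rep_multiplier[OF weight_measurable forcing_weight_bound weight_minus])

lemma bounded_linear_forcing: "bounded_linear (forcing l)"
  unfolding forcing_def
  by (rule bounded_linear_multiplier[OF weight_measurable forcing_weight_bound weight_minus])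

lemma norm_forcing_le: "norm (forcing l g) \<le> norm g"
  using norm_multiplier_le[OF weight_measurable forcing_weight_bound weight_minus, of g]
  by (simp add: forcing_def)

text \<open>On the transform side the weights with exponents \<open>- l / 2\<close> and
  \<open>l / 2 - 1\<close> multiply to \<open>inverse (1 + \<xi>\<^sup>2)\<close>. This identifies
  the source of the mild equation with the image of the abstract source.\<close>

lemma helmholtz_inverse_source:
  "helmholtz_inverse (source_hat g (bessel l U)) = bessel l (forcing l g + quad l U U)"
proof -
  have "helmholtz_inverse (source_hat g (bessel l U))
      = fourier_inv (\<lambda>\<xi>. source_hat g (bessel l U) \<xi> / complex_of_real (1 + \<xi>\<^sup>2))"
    unfolding helmholtz_inverse_def fourier_inv_def by (rule refl)
  also have "\<dots> = bessel l (forcing l g + quad l U U)"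
  proof (rule fourier_inv_eqI)
    show "AE \<xi> in lborel. rep_L2 (fourier_L2 (bessel l (forcing l g + quad l U U))) \<xi>
        = source_hat g (bessel l U) \<xi> / complex_of_real (1 + \<xi>\<^sup>2)"
      using rep_bessel[OF l(1), of "forcing l g + quad l U U"]
        rep_fourier_L2_add[of "forcing l g" "quad l U U"] rep_forcing[of g] rep_quad[OF l, of U U]
    proof eventually_elim
      case (elim \<xi>)
      have "weight (- l / 2) \<xi> * weight (l / 2 - 1) \<xi> = weight (- 1) \<xi>"
        by (simp flip: weight_add)
      also have "\<dots> = inverse (1 + \<xi>\<^sup>2)" by (simp add: weight_def powr_minus)
      finally have w: "weight (- l / 2) \<xi> * weight (l / 2 - 1) \<xi> = inverse (1 + \<xi>\<^sup>2)" .
      have src: "weight (l / 2 - 1) \<xi> *\<^sub>R rep_L2 (fourier_L2 g) \<xi> + quad_hat l U U \<xi>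
          = weight (l / 2 - 1) \<xi> *\<^sub>R source_hat g (bessel l U) \<xi>"
        unfolding quad_hat_def source_hat_def power2_eq_square scaleR_add_right[symmetric] by simp
      show ?case
        unfolding elim src scaleR_scaleR w
        by (simp only: scaleR_conv_of_real of_real_inverse divide_inverse mult.commute)
    qed
  qed
  finally show ?thesis .
qed

end

section \<open>Transfer to mild solutions in the Sobolev space\<close>

locale forced_problem =
  fixes l :: real and f :: "real \<Rightarrow> real L2"
  assumes l: "0 \<le> l" "l \<le> 1"
    and f_measurable: "f \<in> borel_measurable (lebesgue_on {0..})"
    and f_bounded: "bdd_above ((\<lambda>t. norm (f t)) ` {0..})"
begin

abbreviation "F \<equiv> (SUP t\<in>{0..}. norm (f t))"

text \<open>With \<open>K = 2\<close> from \<open>norm_quad_le\<close>, the smallness condition of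
  the abstract theory reads \<open>norm x + F < 1 / 16\<close>.\<close>

sublocale damped_bilinear "quad l" "\<lambda>s. forcing l (f s)" 2 F
proof (intro damped_bilinear.intro damped_bilinear_axioms.intro)
  show "bounded_bilinear (quad l)" by (rule bounded_bilinear_quad[OF l])
  show "norm (quad l x y) \<le> 2 * norm x * norm y" for x y by (rule norm_quad_le[OF l])
  show "(\<lambda>s. forcing l (f s)) \<in> borel_measurable (lebesgue_on {0..})"
    by (rule measurable_compose[OF f_measurable borel_measurable_continuous_onI])
       (rule linear_continuous_on[OF bounded_linear_forcing[OF l]])
  show "norm (forcing l (f s)) \<le> F" if "0 \<le> s" for s
    using that by (intro order_trans[OF norm_forcing_le[OF l]] cSUP_upper f_bounded) auto
qed simp

text \<open>A bounded linear map commutes with the Bochner integral. Continuity of \<open>U\<close>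
  on a compact interval bounds the source, which makes the integral exist.\<close>

lemma bessel_duhamel:
  assumes U: "continuous_on {0..S} U" and u: "\<And>s. s \<in> {0..S} \<Longrightarrow> u s = bessel l (U s)"
    and t: "t \<in> {0..S}"
  defines "h \<equiv> \<lambda>s. exp (- (t - s)) *\<^sub>R helmholtz_inverse (source_hat (f s) (u s))"
  shows "set_integrable lebesgue {0..t} h"
    and "(LINT s:{0..t}|lebesgue. h s) = bessel l (duhamel (source U) t)"
proof -
  have "compact (U ` {0..S})" by (intro compact_continuous_image U) simp
  then obtain R where R: "\<And>s. s \<in> {0..S} \<Longrightarrow> norm (U s) \<le> R"
    using compact_imp_bounded bounded_iff by (metis imageI)
  let ?k = "\<lambda>s. exp (- (t - s)) *\<^sub>R source U s"
  have int: "integrable lebesgue (\<lambda>s. indicator {0..t} s *\<^sub>R ?k s)"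
    using duhamel_integrable[OF source_measurable[OF U] norm_source t] R
    unfolding set_integrable_def by auto
  have h: "indicator {0..t} s *\<^sub>R h s = bessel l (indicator {0..t} s *\<^sub>R ?k s)" for s
  proof (cases "s \<in> {0..t}")
    case True
    then have "u s = bessel l (U s)" using t by (intro u) auto
    then show ?thesis
      using True
      by (simp add: h_def source_def helmholtz_inverse_source[OF l]
          linear_scale[OF bounded_linear.linear[OF bounded_linear_bessel[OF l(1)]]])
  qed (simp add: linear_0[OF bounded_linear.linear[OF bounded_linear_bessel[OF l(1)]]])
  show "set_integrable lebesgue {0..t} h"
    unfolding set_integrable_def h
    by (rule integrable_bounded_linear[OF bounded_linear_bessel[OF l(1)] int])
  show "(LINT s:{0..t}|lebesgue. h s) = bessel l (duhamel (source U) t)"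
    unfolding set_lebesgue_integral_def h duhamel_def
    by (rule integral_bounded_linear[OF bounded_linear_bessel[OF l(1)] int])
qed

lemma sobolev_norm_bessel_diff: "sobolev_norm l (bessel l U - bessel l V) = norm (U - V)"
  using sobolev_norm_bessel[OF l(1), of "U - V"]
  by (simp add: linear_diff[OF bounded_linear.linear[OF bounded_linear_bessel[OF l(1)]]])

lemma continuous_into_sobolev_bessel:
  assumes u: "\<And>s. s \<in> I \<Longrightarrow> u s = bessel l (U s)"
  shows "continuous_into_sobolev l I u \<longleftrightarrow> continuous_on I U"
proof -
  have "((\<lambda>s. sobolev_norm l (u s - u t)) \<longlongrightarrow> 0) (at t within I) \<longleftrightarrow> (U \<longlongrightarrow> U t) (at t within I)"
    if t: "t \<in> I" for t
  proof -
    have "((\<lambda>s. sobolev_norm l (u s - u t)) \<longlongrightarrow> 0) (at t within I)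
        \<longleftrightarrow> ((\<lambda>s. norm (U s - U t)) \<longlongrightarrow> 0) (at t within I)"
      by (rule Lim_cong_within) (simp_all add: u t sobolev_norm_bessel_diff)
    also have "\<dots> \<longleftrightarrow> (U \<longlongrightarrow> U t) (at t within I)"
      unfolding tendsto_norm_zero_iff by (rule LIM_zero_iff)
    finally show ?thesis .
  qed
  moreover have "u t \<in> sobolev_space l" if "t \<in> I" for t
    using that by (simp add: u bessel_in_sobolev[OF l(1)])
  ultimately show ?thesis
    by (auto simp: continuous_into_sobolev_def continuous_on_def)
qed

lemma mild_solution_bessel:
  assumes u: "\<And>s. s \<in> {0..S} \<Longrightarrow> u s = bessel l (U s)"
  shows "mild_solution l S (bessel l \<Phi>) f u \<longleftrightarrow> sol S \<Phi> U"
proof (cases "continuous_on {0..S} U")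
  case True
  have "u t = exp (- t) *\<^sub>R bessel l \<Phi> + (LINT s:{0..t}|lebesgue.
             exp (- (t - s)) *\<^sub>R helmholtz_inverse (source_hat (f s) (u s)))
      \<longleftrightarrow> U t = exp (- t) *\<^sub>R \<Phi> + duhamel (source U) t" (is "?l \<longleftrightarrow> ?r") if t: "t \<in> {0..S}" for t
  proof -
    have I: "(LINT s:{0..t}|lebesgue. exp (- (t - s)) *\<^sub>R helmholtz_inverse (source_hat (f s) (u s)))
        = bessel l (duhamel (source U) t)"
      by (rule bessel_duhamel(2)[OF True u t])
    have "?l \<longleftrightarrow> bessel l (U t) = bessel l (exp (- t) *\<^sub>R \<Phi> + duhamel (source U) t)"
      unfolding I u[OF t]
      by (simp add: linear_add[OF bounded_linear.linear[OF bounded_linear_bessel[OF l(1)]]]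
          linear_scale[OF bounded_linear.linear[OF bounded_linear_bessel[OF l(1)]]])
    also have "\<dots> \<longleftrightarrow> ?r" using bessel_inj[OF l(1)] by metis
    finally show ?thesis .
  qed
  moreover have "continuous_into_sobolev l {0..S} u"
    using True continuous_into_sobolev_bessel[of "{0..S}" u U] u by simp
  ultimately show ?thesis
    using True bessel_duhamel(1)[OF True u] by (simp add: mild_solution_def sol_def)
next
  case False
  then show ?thesis
    using continuous_into_sobolev_bessel[of "{0..S}" u U] u by (simp add: mild_solution_def sol_def)
qed

text \<open>A mild solution has values in the Sobolev space, so a preimage under
  \<open>bessel l\<close> can be chosen at each time. Continuity of the choice follows from the
  isometry through \<open>mild_solution_bessel\<close>.\<close>

lemma mild_solution_cases:
  assumes "mild_solution l S (bessel l \<Phi>) f u"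
  obtains U where "sol S \<Phi> U" "\<And>s. s \<in> {0..S} \<Longrightarrow> u s = bessel l (U s)"
proof -
  have "\<forall>s\<in>{0..S}. \<exists>V. u s = bessel l V"
    using assms bessel_surj[OF l(1)] by (metis mild_solution_def continuous_into_sobolev_def)
  then obtain U where "\<forall>s\<in>{0..S}. u s = bessel l (U s)" by metis
  with that assms mild_solution_bessel[of S u U \<Phi>] show thesis by simp
qed

text \<open>The a priori bound places every solution in the ball where \<open>sol_dist\<close>
  applies. The threshold \<open>1 / 64\<close> leaves room for perturbed initial data, for which the
  bound is used up to \<open>1 / 32\<close>.\<close>

lemma well_posed:
  assumes S: "0 \<le> S" and small: "norm \<Phi> + F \<le> 1 / 64"
  shows "well_posed_at l S (bessel l \<Phi>) f"
  unfolding well_posed_at_def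
proof (intro conjI allI impI ballI)
  \<comment> \<open>The radius \<open>1 / 8\<close> satisfies \<open>4 * K * R = 1\<close> for
    \<open>K = 2\<close>, as \<open>sol_dist\<close> requires.\<close>
  have bd: "norm (V t) \<le> 1 / 8" if "sol S \<Psi> V" "t \<in> {0..S}" "norm \<Psi> + F \<le> 1 / 32" for V \<Psi> t
    using sol_bound[OF that(1) _ that(2)] that(3) by simp
  obtain U where "sol S \<Phi> U" using sol_exists[OF S, of \<Phi>] small by auto
  then have "mild_solution l S (bessel l \<Phi>) f (\<lambda>t. bessel l (U t))"
    by (subst mild_solution_bessel[where U = U]) auto
  then show "\<exists>u. mild_solution l S (bessel l \<Phi>) f u" by blast
  fix u assume "mild_solution l S (bessel l \<Phi>) f u"
  then obtain U where U: "sol S \<Phi> U" "\<And>s. s \<in> {0..S} \<Longrightarrow> u s = bessel l (U s)"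
    by (rule mild_solution_cases) blast
  {
    fix v t assume "mild_solution l S (bessel l \<Phi>) f v" and t: "t \<in> {0..S}"
    then obtain V where V: "sol S \<Phi> V" "\<And>s. s \<in> {0..S} \<Longrightarrow> v s = bessel l (V s)"
      by (elim mild_solution_cases) blast
    have "norm (U t - V t) \<le> 2 * norm (\<Phi> - \<Phi>)"
      using small by (intro sol_dist[OF U(1) V(1) _ _ _ t, of "1/8"] bd[OF U(1)] bd[OF V(1)]) auto
    then show "u t = v t" by (simp add: U(2)[OF t] V(2)[OF t])
  }
  fix \<epsilon> :: real assume \<epsilon>: "0 < \<epsilon>"
  show "\<exists>\<eta>>0. \<forall>\<psi>\<in>sobolev_space l. \<forall>v. sobolev_norm l (\<psi> - bessel l \<Phi>) < \<eta> \<longrightarrow>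
      mild_solution l S \<psi> f v \<longrightarrow> (\<forall>t\<in>{0..S}. sobolev_norm l (v t - u t) < \<epsilon>)"
  \<comment> \<open>The first bound accounts for the factor 2 in \<open>sol_dist\<close>; the second
    keeps the perturbed data below \<open>1 / 32\<close>.\<close>
  proof (intro exI[of _ "min (\<epsilon> / 2) (1 / 64)"] conjI ballI allI impI)
    fix \<psi> v t
    assume "\<psi> \<in> sobolev_space l" and dist: "sobolev_norm l (\<psi> - bessel l \<Phi>) < min (\<epsilon> / 2) (1 / 64)"
      and v: "mild_solution l S \<psi> f v" and t: "t \<in> {0..S}"
    then obtain \<Psi> where \<Psi>: "\<psi> = bessel l \<Psi>" using bessel_surj[OF l(1)] by blast
    obtain V where V: "sol S \<Psi> V" "\<And>s. s \<in> {0..S} \<Longrightarrow> v s = bessel l (V s)"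
      using v unfolding \<Psi> by (rule mild_solution_cases) blast
    have d: "norm (\<Psi> - \<Phi>) < min (\<epsilon> / 2) (1 / 64)"
      using dist by (simp add: \<Psi> sobolev_norm_bessel_diff)
    then have "norm \<Psi> + F \<le> 1 / 32"
      using norm_triangle_sub[of \<Psi> \<Phi>] small by simp
    then have "norm (V t - U t) \<le> 2 * norm (\<Psi> - \<Phi>)"
      using small by (intro sol_dist[OF V(1) U(1) _ _ _ t, of "1/8"] bd[OF U(1)] bd[OF V(1)]) auto
    then show "sobolev_norm l (v t - u t) < \<epsilon>"
      using d by (simp add: U(2)[OF t] V(2)[OF t] sobolev_norm_bessel_diff)
  qed (use \<epsilon> in simp)
qed

text \<open>The pointwise bound \<open>2 * d\<close> from \<open>sol_bound\<close> controls the
  supremum by \<open>2 * d\<close> and the square root of the time integral by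
  \<open>sqrt T * (2 * d)\<close>.\<close>

lemma Y_bound:
  assumes \<tau>: "0 \<le> \<tau>" and T: "0 < T" and small: "norm \<Phi> + F \<le> 1 / 64"
    and u: "mild_solution l (\<tau> + T) (bessel l \<Phi>) f u"
  shows "u \<in> Y_space l \<tau> T" and "Y_norm l \<tau> T u \<le> 2 * (1 + sqrt T) * (norm \<Phi> + F)"
proof -
  obtain U where U: "sol (\<tau> + T) \<Phi> U" "\<And>s. s \<in> {0..\<tau> + T} \<Longrightarrow> u s = bessel l (U s)"
    by (rule mild_solution_cases[OF u]) blast
  define d where "d = norm \<Phi> + F"
  have d0: "0 \<le> d" using G_nonneg by (simp add: d_def)
  have sub: "{\<tau>..\<tau> + T} \<subseteq> {0..\<tau> + T}" using \<tau> by auto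
  have n: "sobolev_norm l (u s) = norm (U s)" "u s \<in> sobolev_space l" if "s \<in> {\<tau>..\<tau> + T}" for s
    using that sub U(2)[of s] by (auto simp: sobolev_norm_bessel[OF l(1)] bessel_in_sobolev[OF l(1)])
  have bd: "sobolev_norm l (u s) \<le> 2 * d" if "s \<in> {\<tau>..\<tau> + T}" for s
    using n(1)[OF that] sol_bound[OF U(1), of s] that sub small by (auto simp: d_def)
  have bd2: "(sobolev_norm l (u s))\<^sup>2 \<le> (2 * d)\<^sup>2" if "s \<in> {\<tau>..\<tau> + T}" for s
    using bd[OF that] n(1)[OF that] by (intro power_mono) auto
  have "continuous_on {\<tau>..\<tau> + T} (\<lambda>s. (norm (U s))\<^sup>2)"
    using U(1) by (intro continuous_intros continuous_on_subset[OF _ sub]) (simp add: sol_def)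
  then have cont: "continuous_on {\<tau>..\<tau> + T} (\<lambda>s. (sobolev_norm l (u s))\<^sup>2)"
    by (rule continuous_on_eq) (simp add: n)
  have int: "set_integrable lebesgue {\<tau>..\<tau> + T} (\<lambda>s. (sobolev_norm l (u s))\<^sup>2)"
    by (rule set_integrable_bounded_interval[OF borel_measurable_lebesgue_on_continuous[OF cont], of "(2 * d)\<^sup>2"])
       (use bd2 in auto)
  show "u \<in> Y_space l \<tau> T"
    using n int bd by (auto simp: Y_space_def intro!: bdd_aboveI[of _ "2 * d"])
  have "(SUP s\<in>{\<tau>..\<tau> + T}. sobolev_norm l (u s)) \<le> 2 * d"
    using T bd by (intro cSUP_least) auto
  moreover have "sqrt (LINT s:{\<tau>..\<tau> + T}|lebesgue. (sobolev_norm l (u s))\<^sup>2) \<le> sqrt T * (2 * d)"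
  proof -
    have "(LINT s:{\<tau>..\<tau> + T}|lebesgue. (sobolev_norm l (u s))\<^sup>2) \<le> (LINT s:{\<tau>..\<tau> + T}|lebesgue. (2 * d)\<^sup>2)"
    proof (rule set_integral_mono[OF int _ bd2])
      show "set_integrable lebesgue {\<tau>..\<tau> + T} (\<lambda>s. (2 * d)\<^sup>2)"
        by (rule set_integrable_bounded_interval[OF borel_measurable_const, of _ _ _ "(2 * d)\<^sup>2"]) auto
    qed
    also have "\<dots> = T * (2 * d)\<^sup>2"
      using T by (simp add: set_lebesgue_integral_def)
    finally have "sqrt (LINT s:{\<tau>..\<tau> + T}|lebesgue. (sobolev_norm l (u s))\<^sup>2) \<le> sqrt (T * (2 * d)\<^sup>2)"
      by (rule real_sqrt_le_mono)
    then show ?thesis using d0 by (simp add: real_sqrt_mult)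
  qed
  ultimately show "Y_norm l \<tau> T u \<le> 2 * (1 + sqrt T) * (norm \<Phi> + F)"
    unfolding Y_norm_def d_def[symmetric] by (simp add: algebra_simps)
qed

end

theorem theorem2p3:
  fixes l \<tau> T :: real
  assumes "0 \<le> l" and "l < 1" and "0 \<le> \<tau>" and "0 < T"
  shows "\<exists>\<delta>>0. \<exists>C>0. \<forall>\<phi>\<in>sobolev_space l. \<forall>f :: real \<Rightarrow> real L2.
    f \<in> borel_measurable (lebesgue_on {0..}) \<longrightarrow>
    bdd_above ((\<lambda>t. norm (f t)) ` {0..}) \<longrightarrow>
    sobolev_norm l \<phi> + (SUP t\<in>{0..}. norm (f t)) \<le> \<delta> \<longrightarrow>
      well_posed_at l (\<tau> + T) \<phi> f \<and>
      (\<forall>u. mild_solution l (\<tau> + T) \<phi> f u \<longrightarrow>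
         u \<in> Y_space l \<tau> T \<and>
         Y_norm l \<tau> T u \<le> C * (sobolev_norm l \<phi> + (SUP t\<in>{0..}. norm (f t))))"
proof (rule exI[of _ "1 / 64"], intro conjI exI[of _ "2 * (1 + sqrt T)"] ballI allI impI)
  fix \<phi> and f :: "real \<Rightarrow> real L2"
  assume \<phi>: "\<phi> \<in> sobolev_space l" and f: "f \<in> borel_measurable (lebesgue_on {0..})"
    "bdd_above ((\<lambda>t. norm (f t)) ` {0..})"
    and small: "sobolev_norm l \<phi> + (SUP t\<in>{0..}. norm (f t)) \<le> 1 / 64"
  \<comment> \<open>The threshold \<open>1 / 64\<close> depends on none of \<open>l\<close>,
    \<open>\<tau>\<close> and \<open>T\<close>; the constant in the estimate depends on
    \<open>T\<close> alone.\<close>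
  interpret forced_problem l f using assms f by unfold_locales auto
  obtain \<Phi> where \<Phi>: "\<phi> = bessel l \<Phi>" using bessel_surj[OF assms(1) \<phi>] by blast
  have n: "sobolev_norm l \<phi> = norm \<Phi>" by (simp add: \<Phi> sobolev_norm_bessel[OF assms(1)])
  note small = small[unfolded n]
  show "well_posed_at l (\<tau> + T) \<phi> f"
    unfolding \<Phi> using assms small by (intro well_posed) auto
  fix u assume "mild_solution l (\<tau> + T) \<phi> f u"
  note Y = Y_bound[OF assms(3,4) small this[unfolded \<Phi>]]
  show "u \<in> Y_space l \<tau> T" by (rule Y)
  show "Y_norm l \<tau> T u \<le> 2 * (1 + sqrt T) * (sobolev_norm l \<phi> + (SUP t\<in>{0..}. norm (f t)))"
    unfolding n by (rule Y)
qed (use assms in \<open>auto intro: add_pos_nonneg\<close>)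

end
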